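(* Let $n\ge 2$ be an integer. (a) If $R$ is any nonzero semiring which is additively cancellative and negative free (for example $R=\mathbb{N}$, $R=\mathbb{Q}_{\ge 0}$ or $R=\mathbb{R}_{\geq 0}$), then the group scheme $\mathrm{GL}_n$ is not flat over $R$. (b) The group scheme $\mathrm{GL}_n$ is flat over the Boolean semifield $\mathbb{B}$, and over $\mathbb{B}$ it agrees with the torus normalizer: the canonical map $\mathbb{G}_{\mathrm m}^n\rtimes\underline{S_n}\to \mathrm{GL}_n$ of group schemes over $\mathbb{B}$ is an isomorphism.
   Context: A semiring is commutative: a set $R$ with commutative monoid structures $(R,+,0)$ and $(R,\cdot,1)$ such that multiplication distributes over addition and $x\cdot0=0$. $R$ is additively cancellative if $x+z=y+z$ implies $x=y$; it is negative free if $x+y=0$ implies $x=y=0$. An $R$-module is a commutative monoid with a bilinear action of $(R,\cdot,1)$. An $R$-module $M$ is flat if $M\otimes_R-$ preserves all finite limits of $R$-modules. An $R$-algebra is a semiring with a homomorphism from $R$. The Boolean semifield is $\mathbb{B}=\{0,1\}$ with $1+1=1$. An affine group scheme over $R$ is a representable group-valued functor on $R$-algebras; it is flat over $R$ if the representing $R$-algebra is flat as an $R$-module. $\mathrm{GL}_n$ over $R$ is the functor sending an $R$-algebra $C$ to the group of $n\times n$ matrices over $C$ having a two-sided inverse; it is represented by $R\otimes_{\mathbb{N}}A_n$, where $$A_n=\mathbb{N}[x_{ij},y_{ij}\mid 1\le i,j\le n]\big/\big(\textstyle\sum_k x_{ik}y_{kj}\sim\delta_{ij},\ \sum_k y_{ik}x_{kj}\sim\delta_{ij}\big),$$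 the quotient by the semiring congruence generated by the displayed relations. $\mathbb{G}_{\mathrm m}$ is the functor $C\mapsto C^\times$. $\underline{S_n}=\mathrm{Spec}(\prod_{S_n}R)$ is the constant group scheme on the symmetric group: its $C$-points are families $(e_\sigma)_{\sigma\in S_n}$ in $C$ with $e_\sigma e_\tau=0$ for $\sigma\ne\tau$ and $\sum_\sigma e_\sigma=1$. The semidirect product is formed with respect to the permutation action of $S_n$ on $\mathbb{G}_{\mathrm m}^n$. The canonical map to $\mathrm{GL}_n$ sends a $C$-point $\big((d_1,\dots,d_n),(e_\sigma)_\sigma\big)$ to the matrix $\mathrm{diag}(d_1,\dots,d_n)\cdot\sum_\sigma e_\sigma P_\sigma$, where $P_\sigma$ is the permutation matrix of $\sigma$. *)

theory Defs
  imports
    "HOL-Library.Multiset"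
    "HOL-Library.Poly_Mapping"
    "HOL-Combinatorics.Permutations"
    "HOL-Algebra.Module"
begin

section \<open>Semirings, modules and algebras\<close>

text \<open>The locale \<open>semiring\<close> of HOL-Algebra has commutative addition and an absorbing zero, but its
  multiplication need not be commutative.\<close>

locale csemiring = semiring R + comm_monoid R for R (structure)

definition additively_cancellative :: "('r, 'm) ring_scheme \<Rightarrow> bool" where
  "additively_cancellative R \<longleftrightarrow>
    (\<forall>x \<in> carrier R. \<forall>y \<in> carrier R. \<forall>z \<in> carrier R. x \<oplus>\<^bsub>R\<^esub> z = y \<oplus>\<^bsub>R\<^esub> z \<longrightarrow> x = y)"

definition negative_free :: "('r, 'm) ring_scheme \<Rightarrow> bool" where
  "negative_free R \<longleftrightarrow>
    (\<forall>x \<in> carrier R. \<forall>y \<in> carrier R. x \<oplus>\<^bsub>R\<^esub> y = \<zero>\<^bsub>R\<^esub> \<longrightarrow> x = \<zero>\<^bsub>R\<^esub> \<and> y = \<zero>\<^bsub>R\<^esub>)"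

text \<open>Over semirings \<open>ring_hom\<close> is not enough: preservation of zero has to be required.\<close>

definition semiring_hom :: "('a, 'm) ring_scheme \<Rightarrow> ('b, 'n) ring_scheme \<Rightarrow> ('a \<Rightarrow> 'b) set" where
  "semiring_hom R S = {f \<in> ring_hom R S. f \<zero>\<^bsub>R\<^esub> = \<zero>\<^bsub>S\<^esub>}"

text \<open>Only the additive part of the record \<open>M\<close> and its scalar multiplication are used.\<close>

locale semimodule = R?: csemiring R + M?: abelian_monoid M
  for R (structure) and M (structure) +
  assumes smult_closed: "\<lbrakk>a \<in> carrier R; x \<in> carrier M\<rbrakk> \<Longrightarrow> a \<odot>\<^bsub>M\<^esub> x \<in> carrier M"
    and smult_add_left: "\<lbrakk>a \<in> carrier R; b \<in> carrier R; x \<in> carrier M\<rbrakk> \<Longrightarrow>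
      (a \<oplus>\<^bsub>R\<^esub> b) \<odot>\<^bsub>M\<^esub> x = (a \<odot>\<^bsub>M\<^esub> x) \<oplus>\<^bsub>M\<^esub> (b \<odot>\<^bsub>M\<^esub> x)"
    and smult_add_right: "\<lbrakk>a \<in> carrier R; x \<in> carrier M; y \<in> carrier M\<rbrakk> \<Longrightarrow>
      a \<odot>\<^bsub>M\<^esub> (x \<oplus>\<^bsub>M\<^esub> y) = (a \<odot>\<^bsub>M\<^esub> x) \<oplus>\<^bsub>M\<^esub> (a \<odot>\<^bsub>M\<^esub> y)"
    and smult_zero_left: "x \<in> carrier M \<Longrightarrow> \<zero>\<^bsub>R\<^esub> \<odot>\<^bsub>M\<^esub> x = \<zero>\<^bsub>M\<^esub>"
    and smult_zero_right: "a \<in> carrier R \<Longrightarrow> a \<odot>\<^bsub>M\<^esub> \<zero>\<^bsub>M\<^esub> = \<zero>\<^bsub>M\<^esub>"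
    and smult_assoc: "\<lbrakk>a \<in> carrier R; b \<in> carrier R; x \<in> carrier M\<rbrakk> \<Longrightarrow>
      (a \<otimes>\<^bsub>R\<^esub> b) \<odot>\<^bsub>M\<^esub> x = a \<odot>\<^bsub>M\<^esub> (b \<odot>\<^bsub>M\<^esub> x)"
    and smult_one: "x \<in> carrier M \<Longrightarrow> \<one>\<^bsub>R\<^esub> \<odot>\<^bsub>M\<^esub> x = x"

definition semimodule_hom ::
  "'r ring \<Rightarrow> ('r, 'a) module \<Rightarrow> ('r, 'b) module \<Rightarrow> ('a \<Rightarrow> 'b) set" where
  "semimodule_hom R M N =
    {f \<in> carrier M \<rightarrow> carrier N.
       f \<zero>\<^bsub>M\<^esub> = \<zero>\<^bsub>N\<^esub> \<and>
       (\<forall>x \<in> carrier M. \<forall>y \<in> carrier M. f (x \<oplus>\<^bsub>M\<^esub> y) = f x \<oplus>\<^bsub>N\<^esub> f y) \<and>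
       (\<forall>r \<in> carrier R. \<forall>x \<in> carrier M. f (r \<odot>\<^bsub>M\<^esub> x) = r \<odot>\<^bsub>N\<^esub> f x)}"

record ('r, 'a) alg = "'a ring" +
  structure_map :: "'r \<Rightarrow> 'a"

definition is_algebra :: "'r ring \<Rightarrow> ('r, 'a) alg \<Rightarrow> bool" where
  "is_algebra R A \<longleftrightarrow> csemiring A \<and> structure_map A \<in> semiring_hom R A"

definition alg_hom :: "'r ring \<Rightarrow> ('r, 'a) alg \<Rightarrow> ('r, 'b) alg \<Rightarrow> ('a \<Rightarrow> 'b) set" where
  "alg_hom R A B =
    {f \<in> semiring_hom A B. \<forall>r \<in> carrier R. f (structure_map A r) = structure_map B r}"

definition alg_module :: "('r, 'a) alg \<Rightarrow> ('r, 'a) module" where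
  "alg_module A = \<lparr>carrier = carrier A, monoid.mult = monoid.mult A, one = one A, zero = zero A, add = add A,
     smult = (\<lambda>r x. structure_map A r \<otimes>\<^bsub>A\<^esub> x)\<rparr>"

text \<open>For the types \<open>nat\<close>, \<open>rat\<close> and \<open>real\<close> this gives the standard examples.\<close>

definition nonneg_semiring :: "'a::linordered_semidom ring" where
  "nonneg_semiring = \<lparr>carrier = {x. 0 \<le> x}, monoid.mult = (*), one = 1, zero = 0, add = (+)\<rparr>"

abbreviation nat_semiring :: "nat ring" where
  "nat_semiring \<equiv> nonneg_semiring"

lemma nonneg_semiring_props:
  shows "csemiring (nonneg_semiring :: 'a::linordered_semidom ring)"
    and "carrier nonneg_semiring \<noteq> {\<zero>\<^bsub>nonneg_semiring :: 'a ring\<^esub>}"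
    and "additively_cancellative (nonneg_semiring :: 'a ring)"
    and "negative_free (nonneg_semiring :: 'a ring)"
proof -
  show "csemiring (nonneg_semiring :: 'a ring)"
    by unfold_locales (auto simp: nonneg_semiring_def algebra_simps)
  have "(1 :: 'a) \<in> {x. 0 \<le> x}" and "(1 :: 'a) \<notin> {0}" by simp_all
  then show "carrier nonneg_semiring \<noteq> {\<zero>\<^bsub>nonneg_semiring :: 'a ring\<^esub>}"
    unfolding nonneg_semiring_def ring_record_simps by blast
qed (auto simp: nonneg_semiring_def additively_cancellative_def negative_free_def
      add_nonneg_eq_0_iff)

definition bool_semifield :: "bool ring" where
  "bool_semifield = \<lparr>carrier = UNIV, monoid.mult = (\<and>), one = True, zero = False, add = (\<or>)\<rparr>"


section \<open>Tensor products\<close>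

text \<open>Elements of the free commutative monoid on \<open>carrier M \<times> carrier N\<close> are finite multisets of
  pairs; \<open>{#(m, n)#}\<close> stands for the pure tensor of \<open>m\<close> and \<open>n\<close>.\<close>

inductive_set tensor_rel ::
  "'r ring \<Rightarrow> ('r, 'a) module \<Rightarrow> ('r, 'b) module \<Rightarrow> (('a \<times> 'b) multiset \<times> ('a \<times> 'b) multiset) set"
  for R :: "'r ring" and M :: "('r, 'a) module" and N :: "('r, 'b) module" where
  refl: "set_mset w \<subseteq> carrier M \<times> carrier N \<Longrightarrow> (w, w) \<in> tensor_rel R M N"
| sym: "(v, w) \<in> tensor_rel R M N \<Longrightarrow> (w, v) \<in> tensor_rel R M N"
| trans: "\<lbrakk>(u, v) \<in> tensor_rel R M N; (v, w) \<in> tensor_rel R M N\<rbrakk> \<Longrightarrow> (u, w) \<in> tensor_rel R M N"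
| plus: "\<lbrakk>(v, w) \<in> tensor_rel R M N; (v', w') \<in> tensor_rel R M N\<rbrakk> \<Longrightarrow>
    (v + v', w + w') \<in> tensor_rel R M N"
| add_left: "\<lbrakk>m \<in> carrier M; m' \<in> carrier M; n \<in> carrier N\<rbrakk> \<Longrightarrow>
    ({#(m \<oplus>\<^bsub>M\<^esub> m', n)#}, {#(m, n), (m', n)#}) \<in> tensor_rel R M N"
| add_right: "\<lbrakk>m \<in> carrier M; n \<in> carrier N; n' \<in> carrier N\<rbrakk> \<Longrightarrow>
    ({#(m, n \<oplus>\<^bsub>N\<^esub> n')#}, {#(m, n), (m, n')#}) \<in> tensor_rel R M N"
| zero_left: "n \<in> carrier N \<Longrightarrow> ({#(\<zero>\<^bsub>M\<^esub>, n)#}, {#}) \<in> tensor_rel R M N"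
| zero_right: "m \<in> carrier M \<Longrightarrow> ({#(m, \<zero>\<^bsub>N\<^esub>)#}, {#}) \<in> tensor_rel R M N"
| balanced: "\<lbrakk>r \<in> carrier R; m \<in> carrier M; n \<in> carrier N\<rbrakk> \<Longrightarrow>
    ({#(r \<odot>\<^bsub>M\<^esub> m, n)#}, {#(m, r \<odot>\<^bsub>N\<^esub> n)#}) \<in> tensor_rel R M N"

definition tensor_class ::
  "'r ring \<Rightarrow> ('r, 'a) module \<Rightarrow> ('r, 'b) module \<Rightarrow> ('a \<times> 'b) multiset \<Rightarrow> ('a \<times> 'b) multiset set" where
  "tensor_class R M N w = tensor_rel R M N `` {w}"

text \<open>In the operations below the union over representatives is a union of equal classes
  (compare \<open>UN_equiv_class\<close>). The multiplicative part of the record is junk.\<close>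

definition tensor ::
  "'r ring \<Rightarrow> ('r, 'a) module \<Rightarrow> ('r, 'b) module \<Rightarrow> ('r, ('a \<times> 'b) multiset set) module" where
  "tensor R M N =
    \<lparr>carrier = {w. set_mset w \<subseteq> carrier M \<times> carrier N} // tensor_rel R M N,
     monoid.mult = undefined,
     one = undefined,
     zero = tensor_class R M N {#},
     add = (\<lambda>c d. \<Union>v \<in> c. \<Union>w \<in> d. tensor_class R M N (v + w)),
     smult = (\<lambda>r c. \<Union>w \<in> c. tensor_class R M N {# (r \<odot>\<^bsub>M\<^esub> m, n). (m, n) \<in># w #})\<rparr>"

text \<open>The map \<open>M \<otimes> N \<rightarrow> M \<otimes> N'\<close> induced by \<open>f : N \<rightarrow> N'\<close>.\<close>

definition tensor_map ::
  "'r ring \<Rightarrow> ('r, 'a) module \<Rightarrow> ('r, 'c) module \<Rightarrow> ('b \<Rightarrow> 'c) \<Rightarrow>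
   ('a \<times> 'b) multiset set \<Rightarrow> ('a \<times> 'c) multiset set" where
  "tensor_map R M N' f c = (\<Union>w \<in> c. tensor_class R M N' {# (m, f n). (m, n) \<in># w #})"


section \<open>Finite limits and flatness\<close>

record category =
  Obj :: "nat set"
  Arr :: "nat set"
  Dom :: "nat \<Rightarrow> nat"
  Cod :: "nat \<Rightarrow> nat"
  Ident :: "nat \<Rightarrow> nat"
  Comp :: "nat \<Rightarrow> nat \<Rightarrow> nat"

text \<open>\<open>Comp J b a\<close> is the composite ``first \<open>a\<close>, then \<open>b\<close>''. Every finite category is isomorphic to
  one whose objects and arrows are natural numbers.\<close>

definition finite_category :: "category \<Rightarrow> bool" where
  "finite_category J \<longleftrightarrow>
    finite (Obj J) \<and> finite (Arr J) \<and>
    (\<forall>a \<in> Arr J. Dom J a \<in> Obj J \<and> Cod J a \<in> Obj J) \<and>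
    (\<forall>j \<in> Obj J. Ident J j \<in> Arr J \<and> Dom J (Ident J j) = j \<and> Cod J (Ident J j) = j) \<and>
    (\<forall>a \<in> Arr J. \<forall>b \<in> Arr J. Cod J a = Dom J b \<longrightarrow>
       Comp J b a \<in> Arr J \<and> Dom J (Comp J b a) = Dom J a \<and> Cod J (Comp J b a) = Cod J b) \<and>
    (\<forall>a \<in> Arr J. Comp J a (Ident J (Dom J a)) = a \<and> Comp J (Ident J (Cod J a)) a = a) \<and>
    (\<forall>a \<in> Arr J. \<forall>b \<in> Arr J. \<forall>c \<in> Arr J. Cod J a = Dom J b \<longrightarrow> Cod J b = Dom J c \<longrightarrow>
       Comp J c (Comp J b a) = Comp J (Comp J c b) a)"

definition is_diagram ::
  "'r ring \<Rightarrow> category \<Rightarrow> (nat \<Rightarrow> ('r, 'u) module) \<Rightarrow> (nat \<Rightarrow> 'u \<Rightarrow> 'u) \<Rightarrow> bool" where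
  "is_diagram R J D \<phi> \<longleftrightarrow>
    (\<forall>j \<in> Obj J. semimodule R (D j)) \<and>
    (\<forall>a \<in> Arr J. \<phi> a \<in> semimodule_hom R (D (Dom J a)) (D (Cod J a))) \<and>
    (\<forall>j \<in> Obj J. \<forall>x \<in> carrier (D j). \<phi> (Ident J j) x = x) \<and>
    (\<forall>a \<in> Arr J. \<forall>b \<in> Arr J. Cod J a = Dom J b \<longrightarrow>
       (\<forall>x \<in> carrier (D (Dom J a)). \<phi> (Comp J b a) x = \<phi> b (\<phi> a x)))"

definition is_cone ::
  "'r ring \<Rightarrow> category \<Rightarrow> (nat \<Rightarrow> ('r, 'u) module) \<Rightarrow> (nat \<Rightarrow> 'u \<Rightarrow> 'u) \<Rightarrow>
   ('r, 'l) module \<Rightarrow> (nat \<Rightarrow> 'l \<Rightarrow> 'u) \<Rightarrow> bool" where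
  "is_cone R J D \<phi> L \<pi> \<longleftrightarrow>
    semimodule R L \<and>
    (\<forall>j \<in> Obj J. \<pi> j \<in> semimodule_hom R L (D j)) \<and>
    (\<forall>a \<in> Arr J. \<forall>x \<in> carrier L. \<phi> a (\<pi> (Dom J a) x) = \<pi> (Cod J a) x)"

text \<open>Limits of modules are created by the underlying sets: a cone is a limit cone iff it identifies
  \<open>L\<close> with the module of compatible families. The lemmas \<open>limit_cone_universal\<close> and
  \<open>limit_coneI_universal\<close> relate this to the universal property.\<close>

definition is_limit_cone ::
  "'r ring \<Rightarrow> category \<Rightarrow> (nat \<Rightarrow> ('r, 'u) module) \<Rightarrow> (nat \<Rightarrow> 'u \<Rightarrow> 'u) \<Rightarrow>
   ('r, 'l) module \<Rightarrow> (nat \<Rightarrow> 'l \<Rightarrow> 'u) \<Rightarrow> bool" where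
  "is_limit_cone R J D \<phi> L \<pi> \<longleftrightarrow>
    is_cone R J D \<phi> L \<pi> \<and>
    (\<forall>z. (\<forall>j \<in> Obj J. z j \<in> carrier (D j)) \<and>
         (\<forall>a \<in> Arr J. \<phi> a (z (Dom J a)) = z (Cod J a)) \<longrightarrow>
         (\<exists>!x. x \<in> carrier L \<and> (\<forall>j \<in> Obj J. \<pi> j x = z j)))"

lemma semimodule_homD:
  assumes "f \<in> semimodule_hom R M N"
  shows "x \<in> carrier M \<Longrightarrow> f x \<in> carrier N"
    and "f \<zero>\<^bsub>M\<^esub> = \<zero>\<^bsub>N\<^esub>"
    and "\<lbrakk>x \<in> carrier M; y \<in> carrier M\<rbrakk> \<Longrightarrow> f (x \<oplus>\<^bsub>M\<^esub> y) = f x \<oplus>\<^bsub>N\<^esub> f y"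
    and "\<lbrakk>r \<in> carrier R; x \<in> carrier M\<rbrakk> \<Longrightarrow> f (r \<odot>\<^bsub>M\<^esub> x) = r \<odot>\<^bsub>N\<^esub> f x"
  using assms by (auto simp: semimodule_hom_def)

lemma limit_cone_universal:
  assumes lim: "is_limit_cone R J D \<phi> L \<pi>" and cone: "is_cone R J D \<phi> N \<nu>"
  shows "\<exists>f \<in> semimodule_hom R N L. (\<forall>j \<in> Obj J. \<forall>x \<in> carrier N. \<pi> j (f x) = \<nu> j x) \<and>
    (\<forall>g \<in> semimodule_hom R N L. (\<forall>j \<in> Obj J. \<forall>x \<in> carrier N. \<pi> j (g x) = \<nu> j x) \<longrightarrow>
       (\<forall>x \<in> carrier N. g x = f x))"
proof -
  interpret L: semimodule R L using lim by (simp add: is_limit_cone_def is_cone_def)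
  interpret N: semimodule R N using cone by (simp add: is_cone_def)
  have pi: "\<pi> j \<in> semimodule_hom R L (D j)" and nu: "\<nu> j \<in> semimodule_hom R N (D j)"
    if "j \<in> Obj J" for j
    using lim cone that by (auto simp: is_limit_cone_def is_cone_def)
  note pi' = semimodule_homD[OF pi] and nu' = semimodule_homD[OF nu]
  have ex1: "\<exists>!y. y \<in> carrier L \<and> (\<forall>j \<in> Obj J. \<pi> j y = \<nu> j x)" if "x \<in> carrier N" for x
  proof -
    have "(\<forall>j \<in> Obj J. \<nu> j x \<in> carrier (D j)) \<and>
          (\<forall>a \<in> Arr J. \<phi> a (\<nu> (Dom J a) x) = \<nu> (Cod J a) x)"
      using cone that nu'(1)[OF _ that] unfolding is_cone_def by blast
    then show ?thesis
      by (rule lim[unfolded is_limit_cone_def, THEN conjunct2, THEN spec, THEN mp])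
  qed
  define f where "f x = (THE y. y \<in> carrier L \<and> (\<forall>j \<in> Obj J. \<pi> j y = \<nu> j x))" for x
  have f0: "f x \<in> carrier L \<and> (\<forall>j \<in> Obj J. \<pi> j (f x) = \<nu> j x)" if "x \<in> carrier N" for x
    unfolding f_def by (rule theI'[OF ex1[OF that]])
  have f: "f x \<in> carrier L" "j \<in> Obj J \<Longrightarrow> \<pi> j (f x) = \<nu> j x" if "x \<in> carrier N" for x j
    using f0[OF that] by blast+
  have eq: "f x = y" if "x \<in> carrier N" "y \<in> carrier L" "\<And>j. j \<in> Obj J \<Longrightarrow> \<pi> j y = \<nu> j x" for x y
    unfolding f_def by (rule the1_equality[OF ex1[OF that(1)]]) (simp add: that)
  have "f \<in> semimodule_hom R N L"
    unfolding semimodule_hom_def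
  proof (intro CollectI conjI ballI)
    show "f \<in> carrier N \<rightarrow> carrier L" using f(1) by blast
    show "f \<zero>\<^bsub>N\<^esub> = \<zero>\<^bsub>L\<^esub>"
      by (rule eq) (simp_all add: pi'(2) nu'(2))
    show "f (x \<oplus>\<^bsub>N\<^esub> y) = f x \<oplus>\<^bsub>L\<^esub> f y" if "x \<in> carrier N" "y \<in> carrier N" for x y
      by (rule eq) (simp_all add: that f pi'(3) nu'(3))
    show "f (r \<odot>\<^bsub>N\<^esub> x) = r \<odot>\<^bsub>L\<^esub> f x" if "r \<in> carrier R" "x \<in> carrier N" for r x
      by (rule eq) (simp_all add: that f pi'(4) nu'(4) L.smult_closed N.smult_closed)
  qed
  moreover have "g x = f x"
    if "g \<in> semimodule_hom R N L" "\<forall>j \<in> Obj J. \<forall>x \<in> carrier N. \<pi> j (g x) = \<nu> j x" "x \<in> carrier N"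
    for g x
    by (rule eq[symmetric]) (use that semimodule_homD(1)[OF that(1)] in simp_all)
  ultimately show ?thesis using f by blast
qed

definition regular_module :: "'r ring \<Rightarrow> ('r, 'r) module" where
  "regular_module R = \<lparr>carrier = carrier R, monoid.mult = monoid.mult R, one = one R,
     zero = zero R, add = add R, smult = monoid.mult R\<rparr>"

lemma semimodule_regular:
  assumes "csemiring R" shows "semimodule R (regular_module R)"
proof -
  interpret csemiring R by fact
  have "abelian_monoid (regular_module R)"
    by (rule abelian_monoidI) (auto simp: regular_module_def a_ac)
  then show ?thesis
    unfolding semimodule_def semimodule_axioms_def
    using assms by (auto simp: regular_module_def l_distr r_distr m_assoc)
qed

text \<open>The regular module suffices as a test object, since it represents the underlying set.\<close>

lemma limit_coneI_universal:
  assumes cat: "finite_category J" and diag: "is_diagram R J D \<phi>" and cone: "is_cone R J D \<phi> L \<pi>"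
    and ex: "\<And>\<nu>. is_cone R J D \<phi> (regular_module R) \<nu> \<Longrightarrow>
      \<exists>f \<in> semimodule_hom R (regular_module R) L.
        \<forall>j \<in> Obj J. \<forall>x \<in> carrier R. \<pi> j (f x) = \<nu> j x"
    and uniq: "\<And>\<nu> f g. \<lbrakk>is_cone R J D \<phi> (regular_module R) \<nu>;
        f \<in> semimodule_hom R (regular_module R) L; g \<in> semimodule_hom R (regular_module R) L;
        \<forall>j \<in> Obj J. \<forall>x \<in> carrier R. \<pi> j (f x) = \<nu> j x;
        \<forall>j \<in> Obj J. \<forall>x \<in> carrier R. \<pi> j (g x) = \<nu> j x\<rbrakk> \<Longrightarrow> \<forall>x \<in> carrier R. f x = g x"
  shows "is_limit_cone R J D \<phi> L \<pi>"
  unfolding is_limit_cone_def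
proof (intro conjI cone allI impI)
  fix z assume z: "(\<forall>j \<in> Obj J. z j \<in> carrier (D j)) \<and> (\<forall>a \<in> Arr J. \<phi> a (z (Dom J a)) = z (Cod J a))"
  interpret L: semimodule R L using cone by (simp add: is_cone_def)
  have carr [simp]: "carrier (regular_module R) = carrier R"
    by (simp add: regular_module_def)
  have D: "semimodule R (D j)" if "j \<in> Obj J" for j
    using diag that by (simp add: is_diagram_def)
  have orbit: "(\<lambda>r. r \<odot>\<^bsub>M\<^esub> x) \<in> semimodule_hom R (regular_module R) M"
    if "semimodule R M" "x \<in> carrier M" for M and x
  proof -
    interpret M: semimodule R M by fact
    show ?thesis using that(2)
      by (auto simp: semimodule_hom_def regular_module_def M.smult_closed M.smult_add_left
          M.smult_zero_left M.smult_assoc)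
  qed
  define \<nu> where "\<nu> j r = r \<odot>\<^bsub>D j\<^esub> z j" for j r
  have nu: "is_cone R J D \<phi> (regular_module R) \<nu>"
    unfolding is_cone_def
  proof (intro conjI ballI)
    show "semimodule R (regular_module R)" by (rule semimodule_regular) unfold_locales
    show "\<nu> j \<in> semimodule_hom R (regular_module R) (D j)" if "j \<in> Obj J" for j
      unfolding \<nu>_def using orbit[OF D[OF that]] z that by blast
    fix a x assume a: "a \<in> Arr J" and x: "x \<in> carrier (regular_module R)"
    then have "\<phi> a \<in> semimodule_hom R (D (Dom J a)) (D (Cod J a))"
      using diag by (simp add: is_diagram_def)
    moreover have "z (Dom J a) \<in> carrier (D (Dom J a))"
      using cat a z by (simp add: finite_category_def)
    ultimately show "\<phi> a (\<nu> (Dom J a) x) = \<nu> (Cod J a) x"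
      using x a z by (simp add: \<nu>_def semimodule_homD(4))
  qed
  obtain f where f: "f \<in> semimodule_hom R (regular_module R) L"
      "\<forall>j \<in> Obj J. \<forall>x \<in> carrier R. \<pi> j (f x) = \<nu> j x"
    using ex[OF nu] by blast
  show "\<exists>!x. x \<in> carrier L \<and> (\<forall>j \<in> Obj J. \<pi> j x = z j)"
  proof (rule ex1I[of _ "f \<one>\<^bsub>R\<^esub>"])
    show "f \<one>\<^bsub>R\<^esub> \<in> carrier L \<and> (\<forall>j \<in> Obj J. \<pi> j (f \<one>\<^bsub>R\<^esub>) = z j)"
      using f(2) z D semimodule_homD(1)[OF f(1)]
      by (auto simp: \<nu>_def semimodule.smult_one)
    fix y assume y: "y \<in> carrier L \<and> (\<forall>j \<in> Obj J. \<pi> j y = z j)"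
    have "\<pi> j \<in> semimodule_hom R L (D j)" if "j \<in> Obj J" for j
      using cone that by (simp add: is_cone_def)
    then have "\<forall>j \<in> Obj J. \<forall>x \<in> carrier R. \<pi> j (x \<odot>\<^bsub>L\<^esub> y) = \<nu> j x"
      using y semimodule_homD(4) by (fastforce simp: \<nu>_def)
    then have "\<one>\<^bsub>R\<^esub> \<odot>\<^bsub>L\<^esub> y = f \<one>\<^bsub>R\<^esub>"
      using uniq[OF nu orbit[OF L.semimodule_axioms] f(1) _ f(2)] y by blast
    then show "y = f \<one>\<^bsub>R\<^esub>" using y by (simp add: L.smult_one)
  qed
qed

text \<open>HOL cannot quantify over the carrier types of all modules at once, so flatness is relative to
  a universe \<open>'u\<close>: the functor is tested on the finite diagrams (and limits) of modules whose
  carriers are subsets of \<open>'u\<close>. Flatness in the usual sense is flatness for every \<open>'u\<close>; asserting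
  non-flatness is meaningful only for a \<open>'u\<close> that is large enough, e.g. one containing a copy of \<open>R\<close>
  when \<open>R\<close> is infinite.\<close>

definition flat :: "'u itself \<Rightarrow> 'r ring \<Rightarrow> ('r, 'a) module \<Rightarrow> bool" where
  "flat U R M \<longleftrightarrow>
    (\<forall>J (D :: nat \<Rightarrow> ('r, 'u) module) \<phi> (L :: ('r, 'u) module) \<pi>.
       finite_category J \<and> is_diagram R J D \<phi> \<and> is_limit_cone R J D \<phi> L \<pi> \<longrightarrow>
       is_limit_cone R J
         (\<lambda>j. tensor R M (D j)) (\<lambda>a. tensor_map R M (D (Cod J a)) (\<phi> a))
         (tensor R M L) (\<lambda>j. tensor_map R M (D j) (\<pi> j)))"


section \<open>Base change from the natural numbers\<close>

definition nat_module :: "('a, 'm) ring_scheme \<Rightarrow> (nat, 'a) module" where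
  "nat_module A = \<lparr>carrier = carrier A, monoid.mult = monoid.mult A, one = one A, zero = zero A, add = add A,
     smult = (\<lambda>k x. [k] \<cdot>\<^bsub>A\<^esub> x)\<rparr>"

text \<open>The \<open>R\<close>-algebra \<open>R \<otimes> A\<close> (tensor product over the natural numbers), with multiplication
  \<open>(r \<otimes> a)(s \<otimes> b) = rs \<otimes> ab\<close> and structure map \<open>r \<mapsto> r \<otimes> 1\<close>.\<close>

definition base_change :: "'r ring \<Rightarrow> 'a ring \<Rightarrow> ('r, ('r \<times> 'a) multiset set) alg" where
  "base_change R A =
    (let T = tensor nat_semiring (nat_module R) (nat_module A);
         cls = tensor_class nat_semiring (nat_module R) (nat_module A)
     in \<lparr>carrier = carrier T,
         monoid.mult = (\<lambda>c d. \<Union>v \<in> c. \<Union>w \<in> d.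
           cls (\<Sum>(r, a) \<in># v. {# (r \<otimes>\<^bsub>R\<^esub> s, a \<otimes>\<^bsub>A\<^esub> b). (s, b) \<in># w #})),
         one = cls {#(\<one>\<^bsub>R\<^esub>, \<one>\<^bsub>A\<^esub>)#},
         zero = zero T,
         add = add T,
         structure_map = (\<lambda>r. cls {#(r, \<one>\<^bsub>A\<^esub>)#})\<rparr>)"


section \<open>The general linear group\<close>

text \<open>The index set \<open>{1, \<dots>, n}\<close> is rendered by a finite type \<open>'n\<close>, so
  \<open>n = card (UNIV :: 'n set)\<close>. A polynomial over the natural numbers in the variables of type \<open>'v\<close> is a finitely supported function on the
  monomials \<open>'v \<Rightarrow>\<^sub>0 nat\<close>.\<close>

datatype 'n gl_var = X_entry 'n 'n | Y_entry 'n 'n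

type_synonym 'n gl_poly = "('n gl_var \<Rightarrow>\<^sub>0 nat) \<Rightarrow>\<^sub>0 nat"

definition poly_var :: "'v \<Rightarrow> (('v \<Rightarrow>\<^sub>0 nat) \<Rightarrow>\<^sub>0 nat)" where
  "poly_var v = Poly_Mapping.single (Poly_Mapping.single v 1) 1"

inductive_set gl_cong :: "('n::finite gl_poly \<times> 'n gl_poly) set" where
  refl: "(p, p) \<in> gl_cong"
| sym: "(p, q) \<in> gl_cong \<Longrightarrow> (q, p) \<in> gl_cong"
| trans: "\<lbrakk>(p, q) \<in> gl_cong; (q, r) \<in> gl_cong\<rbrakk> \<Longrightarrow> (p, r) \<in> gl_cong"
| add: "\<lbrakk>(p, q) \<in> gl_cong; (p', q') \<in> gl_cong\<rbrakk> \<Longrightarrow> (p + p', q + q') \<in> gl_cong"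
| mult: "\<lbrakk>(p, q) \<in> gl_cong; (p', q') \<in> gl_cong\<rbrakk> \<Longrightarrow> (p * p', q * q') \<in> gl_cong"
| XY: "(\<Sum>k\<in>UNIV. poly_var (X_entry i k) * poly_var (Y_entry k j), if i = j then 1 else 0) \<in> gl_cong"
| YX: "(\<Sum>k\<in>UNIV. poly_var (Y_entry i k) * poly_var (X_entry k j), if i = j then 1 else 0) \<in> gl_cong"

definition gl_nat_algebra :: "'n::finite gl_poly set ring" where
  "gl_nat_algebra =
    \<lparr>carrier = UNIV // gl_cong,
     monoid.mult = (\<lambda>c d. \<Union>p \<in> c. \<Union>q \<in> d. gl_cong `` {p * q}),
     one = gl_cong `` {1},
     zero = gl_cong `` {0},
     add = (\<lambda>c d. \<Union>p \<in> c. \<Union>q \<in> d. gl_cong `` {p + q})\<rparr>"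

definition gl_algebra ::
  "'n::finite itself \<Rightarrow> 'r ring \<Rightarrow> ('r, ('r \<times> 'n gl_poly set) multiset set) alg" where
  "gl_algebra n R = base_change R gl_nat_algebra"

definition GL_flat :: "'u itself \<Rightarrow> 'n::finite itself \<Rightarrow> 'r ring \<Rightarrow> bool" where
  "GL_flat U n R \<longleftrightarrow> flat U R (alg_module (gl_algebra n R))"

definition mat_monoid :: "('r, 'c) alg \<Rightarrow> ('n::finite \<Rightarrow> 'n \<Rightarrow> 'c) monoid" where
  "mat_monoid C =
    \<lparr>carrier = {A. \<forall>i j. A i j \<in> carrier C},
     monoid.mult = (\<lambda>A B i j. \<Oplus>\<^bsub>C\<^esub>k\<in>UNIV. A i k \<otimes>\<^bsub>C\<^esub> B k j),
     one = (\<lambda>i j. if i = j then \<one>\<^bsub>C\<^esub> else \<zero>\<^bsub>C\<^esub>)\<rparr>"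

definition GL :: "('r, 'c) alg \<Rightarrow> ('n::finite \<Rightarrow> 'n \<Rightarrow> 'c) monoid" where
  "GL C = units_of (mat_monoid C)"

definition GL_map :: "('c \<Rightarrow> 'c) \<Rightarrow> ('n::finite \<Rightarrow> 'n \<Rightarrow> 'c) \<Rightarrow> ('n \<Rightarrow> 'n \<Rightarrow> 'c)" where
  "GL_map f A = (\<lambda>i j. f (A i j))"


section \<open>The torus normalizer\<close>

abbreviation perms :: "('n::finite \<Rightarrow> 'n) set" where
  "perms \<equiv> {\<sigma>. \<sigma> permutes UNIV}"

definition torus :: "('r, 'c) alg \<Rightarrow> ('n::finite \<Rightarrow> 'c) monoid" where
  "torus C =
    \<lparr>carrier = {d. \<forall>i. d i \<in> carrier (units_of C)},
     monoid.mult = (\<lambda>d d' i. d i \<otimes>\<^bsub>C\<^esub> d' i),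
     one = (\<lambda>i. \<one>\<^bsub>C\<^esub>)\<rparr>"

text \<open>The multiplication of the constant group scheme is dual to the comultiplication
  \<open>\<delta>\<^sub>\<rho> \<mapsto> \<Sum>\<^bsub>\<sigma>\<tau> = \<rho>\<^esub> \<delta>\<^sub>\<sigma> \<otimes> \<delta>\<^sub>\<tau>\<close> of the coordinate algebra;
  here \<open>\<tau> = \<sigma>\<^sup>-\<^sup>1 \<rho>\<close>.\<close>

definition const_Sn :: "('r, 'c) alg \<Rightarrow> (('n::finite \<Rightarrow> 'n) \<Rightarrow> 'c) monoid" where
  "const_Sn C =
    \<lparr>carrier = {e \<in> perms \<rightarrow>\<^sub>E carrier C.
       (\<forall>\<sigma> \<in> perms. \<forall>\<tau> \<in> perms. \<sigma> \<noteq> \<tau> \<longrightarrow> e \<sigma> \<otimes>\<^bsub>C\<^esub> e \<tau> = \<zero>\<^bsub>C\<^esub>) \<and>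
       (\<Oplus>\<^bsub>C\<^esub>\<sigma>\<in>perms. e \<sigma>) = \<one>\<^bsub>C\<^esub>},
     monoid.mult = (\<lambda>e e'. \<lambda>\<rho> \<in> perms.
       \<Oplus>\<^bsub>C\<^esub>\<sigma>\<in>perms. e \<sigma> \<otimes>\<^bsub>C\<^esub> e' (inv_into UNIV \<sigma> \<circ> \<rho>)),
     one = (\<lambda>\<rho> \<in> perms. if \<rho> = id then \<one>\<^bsub>C\<^esub> else \<zero>\<^bsub>C\<^esub>)\<rparr>"

text \<open>A permutation \<open>\<sigma>\<close> acts on \<open>d\<close> by \<open>(\<sigma> d)\<^sub>i = d (\<sigma>\<^sup>-\<^sup>1 i)\<close>; a point \<open>e\<close> of the constant group
  scheme acts as \<open>\<sigma>\<close> on the component cut out by the idempotent \<open>e \<sigma>\<close>.\<close>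

definition perm_action ::
  "('r, 'c) alg \<Rightarrow> (('n::finite \<Rightarrow> 'n) \<Rightarrow> 'c) \<Rightarrow> ('n \<Rightarrow> 'c) \<Rightarrow> ('n \<Rightarrow> 'c)" where
  "perm_action C e d = (\<lambda>i. \<Oplus>\<^bsub>C\<^esub>\<sigma>\<in>perms. e \<sigma> \<otimes>\<^bsub>C\<^esub> d (inv_into UNIV \<sigma> i))"

definition torus_normalizer ::
  "('r, 'c) alg \<Rightarrow> (('n::finite \<Rightarrow> 'c) \<times> (('n \<Rightarrow> 'n) \<Rightarrow> 'c)) monoid" where
  "torus_normalizer C =
    \<lparr>carrier = carrier (torus C) \<times> carrier (const_Sn C),
     monoid.mult = (\<lambda>(d, e) (d', e'). (d \<otimes>\<^bsub>torus C\<^esub> perm_action C e d', e \<otimes>\<^bsub>const_Sn C\<^esub> e')),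
     one = (\<one>\<^bsub>torus C\<^esub>, \<one>\<^bsub>const_Sn C\<^esub>)\<rparr>"

definition torus_normalizer_map ::
  "('c \<Rightarrow> 'c) \<Rightarrow> (('n::finite \<Rightarrow> 'c) \<times> (('n \<Rightarrow> 'n) \<Rightarrow> 'c)) \<Rightarrow> (('n \<Rightarrow> 'c) \<times> (('n \<Rightarrow> 'n) \<Rightarrow> 'c))" where
  "torus_normalizer_map f = (\<lambda>(d, e). (\<lambda>i. f (d i), \<lambda>\<sigma> \<in> perms. f (e \<sigma>)))"

definition diag_matrix :: "('r, 'c) alg \<Rightarrow> ('n::finite \<Rightarrow> 'c) \<Rightarrow> ('n \<Rightarrow> 'n \<Rightarrow> 'c)" where
  "diag_matrix C d = (\<lambda>i j. if i = j then d i else \<zero>\<^bsub>C\<^esub>)"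

definition perm_matrix :: "('r, 'c) alg \<Rightarrow> ('n::finite \<Rightarrow> 'n) \<Rightarrow> ('n \<Rightarrow> 'n \<Rightarrow> 'c)" where
  "perm_matrix C \<sigma> = (\<lambda>i j. if i = \<sigma> j then \<one>\<^bsub>C\<^esub> else \<zero>\<^bsub>C\<^esub>)"

definition canonical_map ::
  "('r, 'c) alg \<Rightarrow> (('n::finite \<Rightarrow> 'c) \<times> (('n \<Rightarrow> 'n) \<Rightarrow> 'c)) \<Rightarrow> ('n \<Rightarrow> 'n \<Rightarrow> 'c)" where
  "canonical_map C = (\<lambda>(d, e).
     diag_matrix C d \<otimes>\<^bsub>mat_monoid C\<^esub> (\<lambda>i j. \<Oplus>\<^bsub>C\<^esub>\<sigma>\<in>perms. e \<sigma> \<otimes>\<^bsub>C\<^esub> perm_matrix C \<sigma> i j))"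


section \<open>Group-valued functors\<close>

text \<open>A functor is given by its values \<open>F C\<close> on the \<open>R\<close>-algebras \<open>C\<close> with carrier in a type \<open>'c\<close> and
  by its action \<open>F'\<close> on \<open>R\<close>-algebra homomorphisms. An isomorphism of group schemes is a natural
  isomorphism of the group-valued functors.\<close>

definition group_functor ::
  "'r ring \<Rightarrow> (('r, 'c) alg \<Rightarrow> 'g monoid) \<Rightarrow> (('c \<Rightarrow> 'c) \<Rightarrow> 'g \<Rightarrow> 'g) \<Rightarrow> bool" where
  "group_functor R F F' \<longleftrightarrow>
    (\<forall>C. is_algebra R C \<longrightarrow> group (F C) \<and> (\<forall>x \<in> carrier (F C). F' id x = x)) \<and>
    (\<forall>C D f. is_algebra R C \<and> is_algebra R D \<and> f \<in> alg_hom R C D \<longrightarrow> F' f \<in> hom (F C) (F D)) \<and>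
    (\<forall>B C D f g. is_algebra R B \<and> is_algebra R C \<and> is_algebra R D \<and>
       f \<in> alg_hom R B C \<and> g \<in> alg_hom R C D \<longrightarrow>
       (\<forall>x \<in> carrier (F B). F' (g \<circ> f) x = F' g (F' f x)))"

definition group_functor_iso ::
  "'r ring \<Rightarrow> (('r, 'c) alg \<Rightarrow> 'g monoid) \<Rightarrow> (('c \<Rightarrow> 'c) \<Rightarrow> 'g \<Rightarrow> 'g) \<Rightarrow>
   (('r, 'c) alg \<Rightarrow> 'h monoid) \<Rightarrow> (('c \<Rightarrow> 'c) \<Rightarrow> 'h \<Rightarrow> 'h) \<Rightarrow> (('r, 'c) alg \<Rightarrow> 'g \<Rightarrow> 'h) \<Rightarrow> bool" where
  "group_functor_iso R F F' G G' \<eta> \<longleftrightarrow>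
    group_functor R F F' \<and> group_functor R G G' \<and>
    (\<forall>C. is_algebra R C \<longrightarrow> \<eta> C \<in> iso (F C) (G C)) \<and>
    (\<forall>C D f. is_algebra R C \<and> is_algebra R D \<and> f \<in> alg_hom R C D \<longrightarrow>
       (\<forall>x \<in> carrier (F C). \<eta> D (F' f x) = G' f (\<eta> C x)))"

end

theory Submission
  imports Defs
begin

text \<open>Write \<open>A\<^sub>n\<close> for the coordinate algebra of \<open>GL\<^sub>n\<close> over the natural numbers, with entries \<open>x\<^bsub>ij\<^esub>\<close> of
  the generic matrix and \<open>y\<^bsub>ij\<^esub>\<close> of its inverse. Both parts rest on the off-diagonal relations
  \<open>\<Sum>\<^sub>k x\<^bsub>ik\<^esub> y\<^bsub>kj\<^esub> = 0\<close> for \<open>i \<noteq> j\<close>, in which a sum of several elements vanishes.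

  Over a negative free semiring \<open>R\<close> the kernel of addition \<open>R\<^sup>2 \<rightarrow> R\<close> is zero. This kernel is a finite
  limit, so for a flat module \<open>M\<close> the kernel of addition \<open>M\<^sup>2 \<rightarrow> M\<close> is zero as well, that is, \<open>M\<close> is
  negative free (\<open>flat_imp_negative_free\<close>). But \<open>R \<otimes> A\<^sub>n\<close> is not: the relation for \<open>i = a\<close>, \<open>j = b\<close>
  gives \<open>x\<^bsub>ab\<^esub> y\<^bsub>bb\<^esub>\<close> an additive inverse (\<open>product_has_negative\<close>), while this product takes the
  value \<open>1\<close> at the elementary matrix with an extra entry \<open>1\<close> in position \<open>(a, b)\<close>
  (\<open>product_nonzero\<close>). The inverse of that matrix has an entry \<open>-1\<close>, so it is a point over the ring
  of differences of \<open>R\<close>, in which \<open>1 \<noteq> 0\<close> because \<open>R\<close> is cancellative.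

  An algebra over the Boolean semifield is additively idempotent, hence negative free, and now the
  relations force every product \<open>x\<^bsub>ik\<^esub> y\<^bsub>kj\<^esub>\<close> with \<open>i \<noteq> j\<close> to vanish. It follows that the elements
  \<open>f\<^bsub>ij\<^esub> = x\<^bsub>ij\<^esub> y\<^bsub>ji\<^esub>\<close> are idempotents, orthogonal along rows and columns, and that the products
  \<open>e\<^sub>\<sigma> = \<Prod>\<^sub>j f\<^bsub>\<sigma> j, j\<^esub>\<close> form a complete orthogonal system indexed by the permutations
  (\<open>idempotent_system\<close>). On the component of \<open>\<sigma>\<close> the matrix is a permutation matrix scaled by units,
  and so every invertible matrix comes from the torus normalizer (\<open>canonical_map_onto\<close>).

  For flatness the same decomposition is applied to the generic matrix. On the component of \<open>\<sigma>\<close> the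
  elements \<open>x\<^bsub>\<sigma> j, j\<^esub>\<close> and \<open>y\<^bsub>j, \<sigma> j\<^esub>\<close> are inverse units and all other entries vanish, so the Laurent
  monomials in the \<open>x\<^bsub>\<sigma> j, j\<^esub>\<close>, for all \<open>\<sigma>\<close>, span the coordinate algebra. Reading off which of them
  occur in a polynomial provides a dual basis (\<open>dual_basis_B\<close>). A module with a dual basis is flat,
  because an element of \<open>M \<otimes> N\<close> is determined by its finitely many coefficients in \<open>N\<close>, and taking
  coefficients commutes with limits in \<open>N\<close> (\<open>dual_basis_imp_flat\<close>).\<close>

section \<open>Sums over multisets\<close>

text \<open>Addition commutes only on the carrier, so the sum runs over the finite set of elements, with
  multiplicities turned into multiples.\<close>

definition msum :: "('a, 'm) ring_scheme \<Rightarrow> ('b \<Rightarrow> 'a) \<Rightarrow> 'b multiset \<Rightarrow> 'a" where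
  "msum G f w = (\<Oplus>\<^bsub>G\<^esub>p\<in>set_mset w. [count w p] \<cdot>\<^bsub>G\<^esub> f p)"

context abelian_monoid
begin

lemma msum_superset:
  assumes "set_mset w \<subseteq> S" "finite S" "f \<in> S \<rightarrow> carrier G"
  shows "msum G f w = (\<Oplus>p\<in>S. [count w p] \<cdot> f p)"
  unfolding msum_def
proof (rule add.finprod_mono_neutral_cong_left)
  show "finite S" "set_mset w \<subseteq> S" using assms by auto
  show "[count w i] \<cdot> f i = \<zero>" if "i \<in> S - set_mset w" for i
    using that assms(3) by (auto simp: not_in_iff)
qed (use assms in auto)

lemma msum_closed: "f \<in> set_mset w \<rightarrow> carrier G \<Longrightarrow> msum G f w \<in> carrier G"
  unfolding msum_def by (intro finsum_closed) auto

lemma msum_empty [simp]: "msum G f {#} = \<zero>"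
  by (simp add: msum_def)

lemma msum_single [simp]: "f p \<in> carrier G \<Longrightarrow> msum G f {#p#} = f p"
  by (simp add: msum_def finsum_insert)

lemma msum_union:
  assumes f: "f \<in> set_mset v \<union> set_mset w \<rightarrow> carrier G"
  shows "msum G f (v + w) = msum G f v \<oplus> msum G f w"
proof -
  let ?S = "set_mset v \<union> set_mset w"
  have fc: "f p \<in> carrier G" if "p \<in> set_mset v \<or> p \<in> set_mset w" for p
    using f that by blast
  have "msum G f (v + w) = (\<Oplus>p\<in>?S. [count v p] \<cdot> f p \<oplus> [count w p] \<cdot> f p)"
    unfolding msum_def set_mset_union
    by (intro finsum_cong') (auto simp: fc add.nat_pow_mult[symmetric])
  also have "\<dots> = (\<Oplus>p\<in>?S. [count v p] \<cdot> f p) \<oplus> (\<Oplus>p\<in>?S. [count w p] \<cdot> f p)"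
    using f by (intro finsum_addf) auto
  also have "\<dots> = msum G f v \<oplus> msum G f w"
    using f by (subst (1 2) msum_superset[of _ ?S]) auto
  finally show ?thesis .
qed

lemma msum_add_mset:
  assumes "f \<in> insert p (set_mset w) \<rightarrow> carrier G"
  shows "msum G f (add_mset p w) = f p \<oplus> msum G f w"
  using msum_union[of f "{#p#}" w] assms by simp

end


section \<open>The tensor product of semimodules\<close>

locale semimodule_pair = M: semimodule R M + N: semimodule R N
  for R :: "'r ring" and M :: "('r, 'a) module" and N :: "('r, 'b) module"
begin

abbreviation "words \<equiv> {w. set_mset w \<subseteq> carrier M \<times> carrier N}"

abbreviation "cls \<equiv> tensor_class R M N"

lemma tensor_rel_words:
  assumes "(v, w) \<in> tensor_rel R M N"
  shows "v \<in> words" "w \<in> words"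
  using assms
  by (induction rule: tensor_rel.induct)
     (auto simp: M.smult_closed N.smult_closed)

lemma equiv_tensor_rel: "equiv words (tensor_rel R M N)"
  using tensor_rel_words
  by (intro equivI refl_onI symI transI subsetI)
     (auto intro: tensor_rel.refl tensor_rel.sym tensor_rel.trans)

lemma cls_eq_iff:
  "\<lbrakk>v \<in> words; w \<in> words\<rbrakk> \<Longrightarrow> cls v = cls w \<longleftrightarrow> (v, w) \<in> tensor_rel R M N"
  unfolding tensor_class_def using eq_equiv_class_iff[OF equiv_tensor_rel] by simp

lemma cls_eqI: "(v, w) \<in> tensor_rel R M N \<Longrightarrow> cls v = cls w"
  using cls_eq_iff tensor_rel_words by blast

lemma cls_in_carrier: "w \<in> words \<Longrightarrow> cls w \<in> carrier (tensor R M N)"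
  by (simp add: tensor_def tensor_class_def quotientI)

lemma carrier_tensorE:
  assumes "c \<in> carrier (tensor R M N)"
  obtains w where "w \<in> words" "c = cls w"
  using assms by (auto simp: tensor_def tensor_class_def elim!: quotientE)

lemma zero_tensor: "\<zero>\<^bsub>tensor R M N\<^esub> = cls {#}"
  by (simp add: tensor_def)

text \<open>Every operation on classes is a union over representatives of classes; such a union
  collapses as soon as the operation respects the congruence.\<close>

lemma UN_cls:
  assumes "w \<in> words" "\<And>w'. (w, w') \<in> tensor_rel R M N \<Longrightarrow> F w' = F w"
  shows "(\<Union>w'\<in>cls w. F w') = F w"
  using assms tensor_rel.refl[of w M N R] unfolding tensor_class_def by blast

lemma add_cls:
  assumes "v \<in> words" "w \<in> words"
  shows "cls v \<oplus>\<^bsub>tensor R M N\<^esub> cls w = cls (v + w)"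
proof -
  have "(\<Union>w'\<in>cls w. cls (v' + w')) = cls (v + w)" if "(v, v') \<in> tensor_rel R M N" for v'
  proof -
    have "cls (v' + w') = cls (v + w)" if "(w, w') \<in> tensor_rel R M N" for w'
      using that \<open>(v, v') \<in> _\<close> by (intro cls_eqI tensor_rel.sym[OF tensor_rel.plus])
    then show ?thesis
      using assms(2) by (subst UN_cls) (auto intro: tensor_rel.refl)
  qed
  then show ?thesis
    using assms by (simp add: tensor_def UN_cls tensor_rel.refl)
qed

lemma smult_tensor_rel:
  assumes "r \<in> carrier R" "(v, w) \<in> tensor_rel R M N"
  shows "({# (r \<odot>\<^bsub>M\<^esub> m, n). (m, n) \<in># v #}, {# (r \<odot>\<^bsub>M\<^esub> m, n). (m, n) \<in># w #})
    \<in> tensor_rel R M N"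
  using assms(2)
proof (induction rule: tensor_rel.induct)
  case (balanced s m n)
  have "({#(s \<odot>\<^bsub>M\<^esub> (r \<odot>\<^bsub>M\<^esub> m), n)#}, {#(r \<odot>\<^bsub>M\<^esub> m, s \<odot>\<^bsub>N\<^esub> n)#}) \<in> tensor_rel R M N"
    using balanced assms(1) by (intro tensor_rel.balanced) (auto simp: M.smult_closed)
  moreover have "s \<odot>\<^bsub>M\<^esub> (r \<odot>\<^bsub>M\<^esub> m) = r \<odot>\<^bsub>M\<^esub> (s \<odot>\<^bsub>M\<^esub> m)"
    using balanced assms(1) by (simp add: M.smult_assoc[symmetric] M.R.m_comm)
  ultimately show ?case by simp
next
  case (refl w)
  then show ?case using assms(1) by (intro tensor_rel.refl) (auto simp: M.smult_closed)
next
  case (trans u v w)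
  then show ?case by (blast intro: tensor_rel.trans)
qed (simp_all add: assms(1) M.smult_closed M.smult_add_right M.smult_zero_right
      tensor_rel.sym tensor_rel.plus tensor_rel.add_left tensor_rel.add_right
      tensor_rel.zero_left tensor_rel.zero_right)

lemma smult_words:
  "\<lbrakk>r \<in> carrier R; w \<in> words\<rbrakk> \<Longrightarrow> {# (r \<odot>\<^bsub>M\<^esub> m, n). (m, n) \<in># w #} \<in> words"
  by (auto simp: subset_iff M.smult_closed)

lemma smult_cls:
  assumes "r \<in> carrier R" "w \<in> words"
  shows "r \<odot>\<^bsub>tensor R M N\<^esub> cls w = cls {# (r \<odot>\<^bsub>M\<^esub> m, n). (m, n) \<in># w #}"
  using assms by (simp add: tensor_def UN_cls cls_eqI[OF tensor_rel.sym[OF smult_tensor_rel]])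

lemma add_cls_left:
  "\<lbrakk>m \<in> carrier M; m' \<in> carrier M; n \<in> carrier N\<rbrakk> \<Longrightarrow>
    cls {#(m \<oplus>\<^bsub>M\<^esub> m', n)#} = cls {#(m, n), (m', n)#}"
  by (intro cls_eqI tensor_rel.add_left)

lemma add_cls_right:
  "\<lbrakk>m \<in> carrier M; n \<in> carrier N; n' \<in> carrier N\<rbrakk> \<Longrightarrow>
    cls {#(m, n \<oplus>\<^bsub>N\<^esub> n')#} = cls {#(m, n), (m, n')#}"
  by (intro cls_eqI tensor_rel.add_right)

lemma cls_plus_cong:
  assumes "cls v = cls v'" "cls w = cls w'" "v \<in> words" "v' \<in> words" "w \<in> words" "w' \<in> words"
  shows "cls (v + w) = cls (v' + w')"
  using assms add_cls by metis

lemma abelian_monoid_tensor: "abelian_monoid (tensor R M N)"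
proof (rule abelian_monoidI)
  show "\<zero>\<^bsub>tensor R M N\<^esub> \<in> carrier (tensor R M N)"
    by (simp add: zero_tensor cls_in_carrier)
  fix x assume "x \<in> carrier (tensor R M N)"
  then obtain u where u: "u \<in> words" "x = cls u" by (rule carrier_tensorE)
  show "\<zero>\<^bsub>tensor R M N\<^esub> \<oplus>\<^bsub>tensor R M N\<^esub> x = x"
    using add_cls[of "{#}" u] u by (simp add: zero_tensor)
  fix y assume "y \<in> carrier (tensor R M N)"
  then obtain v where v: "v \<in> words" "y = cls v" by (rule carrier_tensorE)
  have uv: "u + v \<in> words" using u v by simp
  show "x \<oplus>\<^bsub>tensor R M N\<^esub> y \<in> carrier (tensor R M N)"
    using u v uv by (simp only: add_cls cls_in_carrier)
  show "x \<oplus>\<^bsub>tensor R M N\<^esub> y = y \<oplus>\<^bsub>tensor R M N\<^esub> x"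
    using u v by (simp only: add_cls add.commute)
  fix z assume "z \<in> carrier (tensor R M N)"
  then obtain w where w: "w \<in> words" "z = cls w" by (rule carrier_tensorE)
  have "v + w \<in> words" using v w by simp
  then show "(x \<oplus>\<^bsub>tensor R M N\<^esub> y) \<oplus>\<^bsub>tensor R M N\<^esub> z =
      x \<oplus>\<^bsub>tensor R M N\<^esub> (y \<oplus>\<^bsub>tensor R M N\<^esub> z)"
    using u v w uv by (simp only: add_cls add.assoc)
qed

lemma semimodule_tensor: "semimodule R (tensor R M N)"
proof -
  interpret T: abelian_monoid "tensor R M N" by (rule abelian_monoid_tensor)
  have left: "cls {# ((a \<oplus>\<^bsub>R\<^esub> b) \<odot>\<^bsub>M\<^esub> m, n). (m, n) \<in># w #} =
      cls ({# (a \<odot>\<^bsub>M\<^esub> m, n). (m, n) \<in># w #} + {# (b \<odot>\<^bsub>M\<^esub> m, n). (m, n) \<in># w #})"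
    if "a \<in> carrier R" "b \<in> carrier R" "w \<in> words" for a b w
    using that(3)
  proof (induction w)
    case (add p w)
    obtain m n where p: "p = (m, n)" "m \<in> carrier M" "n \<in> carrier N" using add.prems by (cases p) auto
    have "cls ({#((a \<oplus>\<^bsub>R\<^esub> b) \<odot>\<^bsub>M\<^esub> m, n)#} + {# ((a \<oplus>\<^bsub>R\<^esub> b) \<odot>\<^bsub>M\<^esub> m, n). (m, n) \<in># w #}) =
      cls ({#(a \<odot>\<^bsub>M\<^esub> m, n), (b \<odot>\<^bsub>M\<^esub> m, n)#} +
        ({# (a \<odot>\<^bsub>M\<^esub> m, n). (m, n) \<in># w #} + {# (b \<odot>\<^bsub>M\<^esub> m, n). (m, n) \<in># w #}))"
    proof (rule cls_plus_cong)
      show "cls {#((a \<oplus>\<^bsub>R\<^esub> b) \<odot>\<^bsub>M\<^esub> m, n)#} = cls {#(a \<odot>\<^bsub>M\<^esub> m, n), (b \<odot>\<^bsub>M\<^esub> m, n)#}"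
        using that p by (simp add: M.smult_add_left add_cls_left M.smult_closed)
    qed (use add that p in \<open>auto simp: M.smult_closed\<close>)
    then show ?case using p by (simp add: add_mset_commute)
  qed simp
  have zero: "cls {# (\<zero>\<^bsub>R\<^esub> \<odot>\<^bsub>M\<^esub> m, n). (m, n) \<in># w #} = cls {#}" if "w \<in> words" for w
    using that
  proof (induction w)
    case (add p w)
    obtain m n where p: "p = (m, n)" "m \<in> carrier M" "n \<in> carrier N" using add.prems by (cases p) auto
    have "cls ({#(\<zero>\<^bsub>R\<^esub> \<odot>\<^bsub>M\<^esub> m, n)#} + {# (\<zero>\<^bsub>R\<^esub> \<odot>\<^bsub>M\<^esub> m, n). (m, n) \<in># w #}) = cls ({#} + {#})"
      using add p
      by (intro cls_plus_cong) (auto simp: M.smult_zero_left intro!: cls_eqI tensor_rel.zero_left)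
    then show ?case using p by simp
  qed simp
  have cong: "{# f p. p \<in># w #} = {# g p. p \<in># w #}"
    if "\<And>p. p \<in># w \<Longrightarrow> f p = g p" for f g :: "'a \<times> 'b \<Rightarrow> 'a \<times> 'b" and w
    using that by (rule image_mset_cong)
  show ?thesis
  proof (intro semimodule.intro semimodule_axioms.intro)
    show "csemiring R" by (rule M.csemiring_axioms)
    show "abelian_monoid (tensor R M N)" by (rule T.abelian_monoid_axioms)
    fix x assume "x \<in> carrier (tensor R M N)"
    then obtain w where w: "w \<in> words" "x = cls w" by (rule carrier_tensorE)
    show "\<one>\<^bsub>R\<^esub> \<odot>\<^bsub>tensor R M N\<^esub> x = x"
    proof -
      have "{# (\<one>\<^bsub>R\<^esub> \<odot>\<^bsub>M\<^esub> m, n). (m, n) \<in># w #} = {# p. p \<in># w #}"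
        using w(1) by (intro cong) (auto simp: M.smult_one)
      then show ?thesis using w by (simp add: smult_cls)
    qed
    show "\<zero>\<^bsub>R\<^esub> \<odot>\<^bsub>tensor R M N\<^esub> x = \<zero>\<^bsub>tensor R M N\<^esub>"
      using w by (simp only: smult_cls zero zero_tensor M.R.zero_closed)
    fix a assume a: "a \<in> carrier R"
    show "a \<odot>\<^bsub>tensor R M N\<^esub> x \<in> carrier (tensor R M N)"
      using a w by (simp only: smult_cls cls_in_carrier smult_words)
    fix b assume b: "b \<in> carrier R"
    show "(a \<oplus>\<^bsub>R\<^esub> b) \<odot>\<^bsub>tensor R M N\<^esub> x =
        (a \<odot>\<^bsub>tensor R M N\<^esub> x) \<oplus>\<^bsub>tensor R M N\<^esub> (b \<odot>\<^bsub>tensor R M N\<^esub> x)"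
      using a b w by (simp only: smult_cls left add_cls smult_words M.R.a_closed)
    show "(a \<otimes>\<^bsub>R\<^esub> b) \<odot>\<^bsub>tensor R M N\<^esub> x = a \<odot>\<^bsub>tensor R M N\<^esub> (b \<odot>\<^bsub>tensor R M N\<^esub> x)"
    proof -
      have "{# ((a \<otimes>\<^bsub>R\<^esub> b) \<odot>\<^bsub>M\<^esub> m, n). (m, n) \<in># w #} =
        {# (a \<odot>\<^bsub>M\<^esub> m, n). (m, n) \<in># {# (b \<odot>\<^bsub>M\<^esub> m, n). (m, n) \<in># w #} #}"
        unfolding image_mset.compositionality o_def
        using w(1) a b by (intro cong) (auto simp: M.smult_assoc)
      then show ?thesis using a b w by (simp only: smult_cls smult_words M.R.m_closed)
    qed
  next
    fix a x y
    assume a: "a \<in> carrier R" and "x \<in> carrier (tensor R M N)" "y \<in> carrier (tensor R M N)"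
    then obtain v w where "v \<in> words" "x = cls v" "w \<in> words" "y = cls w"
      by (metis carrier_tensorE)
    then show "a \<odot>\<^bsub>tensor R M N\<^esub> (x \<oplus>\<^bsub>tensor R M N\<^esub> y) =
        a \<odot>\<^bsub>tensor R M N\<^esub> x \<oplus>\<^bsub>tensor R M N\<^esub> a \<odot>\<^bsub>tensor R M N\<^esub> y"
      using a smult_words[OF a, of v] smult_words[OF a, of w] by (simp add: smult_cls add_cls)
  next
    fix a assume "a \<in> carrier R"
    then show "a \<odot>\<^bsub>tensor R M N\<^esub> \<zero>\<^bsub>tensor R M N\<^esub> = \<zero>\<^bsub>tensor R M N\<^esub>"
      by (simp add: zero_tensor smult_cls)
  qed
qed

text \<open>The universal property of the tensor product, which serves below to tell tensor classes
  apart: an invariant of classes is obtained from any bilinear map.\<close>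

lemma msum_tensor_rel:
  assumes "abelian_monoid P"
    and closed: "\<And>m n. \<lbrakk>m \<in> carrier M; n \<in> carrier N\<rbrakk> \<Longrightarrow> f (m, n) \<in> carrier P"
    and add_left: "\<And>m m' n. \<lbrakk>m \<in> carrier M; m' \<in> carrier M; n \<in> carrier N\<rbrakk> \<Longrightarrow>
      f (m \<oplus>\<^bsub>M\<^esub> m', n) = f (m, n) \<oplus>\<^bsub>P\<^esub> f (m', n)"
    and add_right: "\<And>m n n'. \<lbrakk>m \<in> carrier M; n \<in> carrier N; n' \<in> carrier N\<rbrakk> \<Longrightarrow>
      f (m, n \<oplus>\<^bsub>N\<^esub> n') = f (m, n) \<oplus>\<^bsub>P\<^esub> f (m, n')"
    and zero_left: "\<And>n. n \<in> carrier N \<Longrightarrow> f (\<zero>\<^bsub>M\<^esub>, n) = \<zero>\<^bsub>P\<^esub>"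
    and zero_right: "\<And>m. m \<in> carrier M \<Longrightarrow> f (m, \<zero>\<^bsub>N\<^esub>) = \<zero>\<^bsub>P\<^esub>"
    and balanced: "\<And>r m n. \<lbrakk>r \<in> carrier R; m \<in> carrier M; n \<in> carrier N\<rbrakk> \<Longrightarrow>
      f (r \<odot>\<^bsub>M\<^esub> m, n) = f (m, r \<odot>\<^bsub>N\<^esub> n)"
    and rel: "(v, w) \<in> tensor_rel R M N"
  shows "msum P f v = msum P f w"
proof -
  interpret P: abelian_monoid P by fact
  have funcset: "f \<in> set_mset w \<rightarrow> carrier P" if "w \<in> words" for w
    using that by (force intro: closed)
  show ?thesis
    using rel
  proof (induction rule: tensor_rel.induct)
    case (plus v w v' w')
    then show ?case
      using funcset[OF tensor_rel_words(1)[OF plus(1)]] funcset[OF tensor_rel_words(2)[OF plus(1)]]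
        funcset[OF tensor_rel_words(1)[OF plus(2)]] funcset[OF tensor_rel_words(2)[OF plus(2)]]
      by (subst (1 2) P.msum_union) auto
  qed (simp_all add: assms P.msum_add_mset M.smult_closed N.smult_closed)
qed

end

lemma semimodule_pairI: "semimodule R M \<Longrightarrow> semimodule R N \<Longrightarrow> semimodule_pair R M N"
  by (simp add: semimodule_pair_def)

locale tensor_functor = A: semimodule_pair R M N + B: semimodule_pair R M N'
  for R :: "'r ring" and M :: "('r, 'a) module" and N :: "('r, 'b) module"
    and N' :: "('r, 'c) module" +
  fixes f :: "'b \<Rightarrow> 'c"
  assumes hom: "f \<in> semimodule_hom R N N'"
begin

lemma tensor_map_rel:
  assumes "(v, w) \<in> tensor_rel R M N"
  shows "({# (m, f n). (m, n) \<in># v #}, {# (m, f n). (m, n) \<in># w #}) \<in> tensor_rel R M N'"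
  using assms
proof (induction rule: tensor_rel.induct)
  case (refl w)
  then show ?case by (intro tensor_rel.refl) (force intro: semimodule_homD(1)[OF hom])
next
  case (trans u v w)
  then show ?case by (blast intro: tensor_rel.trans)
qed (simp_all add: semimodule_homD[OF hom] tensor_rel.sym tensor_rel.plus tensor_rel.add_left
      tensor_rel.add_right tensor_rel.zero_left tensor_rel.zero_right tensor_rel.balanced)

lemma map_words: "w \<in> A.words \<Longrightarrow> {# (m, f n). (m, n) \<in># w #} \<in> B.words"
  by (auto simp: subset_iff semimodule_homD(1)[OF hom])

lemma tensor_map_cls:
  assumes "w \<in> A.words"
  shows "tensor_map R M N' f (A.cls w) = B.cls {# (m, f n). (m, n) \<in># w #}"
  unfolding tensor_map_def
  using assms by (simp add: A.UN_cls B.cls_eqI[OF tensor_rel.sym[OF tensor_map_rel]])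

lemma tensor_map_hom:
  "tensor_map R M N' f \<in> semimodule_hom R (tensor R M N) (tensor R M N')"
proof -
  have swap: "{# (m, f n). (m, n) \<in># {# (r \<odot>\<^bsub>M\<^esub> m, n). (m, n) \<in># w #} #} =
      {# (r \<odot>\<^bsub>M\<^esub> m, n). (m, n) \<in># {# (m, f n). (m, n) \<in># w #} #}" for r w
    by (simp add: image_mset.compositionality o_def case_prod_unfold)
  show ?thesis
    unfolding semimodule_hom_def
  proof (intro CollectI conjI ballI Pi_I)
    show "tensor_map R M N' f \<zero>\<^bsub>tensor R M N\<^esub> = \<zero>\<^bsub>tensor R M N'\<^esub>"
      using tensor_map_cls[of "{#}"] by (simp add: A.zero_tensor B.zero_tensor)
    fix x assume "x \<in> carrier (tensor R M N)"
    then obtain v where v: "v \<in> A.words" "x = A.cls v" by (rule A.carrier_tensorE)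
    show "tensor_map R M N' f x \<in> carrier (tensor R M N')"
      using v by (simp only: tensor_map_cls B.cls_in_carrier map_words)
    show "tensor_map R M N' f (x \<oplus>\<^bsub>tensor R M N\<^esub> y) =
        tensor_map R M N' f x \<oplus>\<^bsub>tensor R M N'\<^esub> tensor_map R M N' f y"
      if y: "y \<in> carrier (tensor R M N)" for y
    proof -
      obtain w where w: "w \<in> A.words" "y = A.cls w" by (rule A.carrier_tensorE[OF y])
      then have vw: "v + w \<in> A.words" using v by auto
      show ?thesis
        unfolding v w using v w map_words[OF v(1)] map_words[OF w(1)]
        by (simp only: tensor_map_cls[OF vw] tensor_map_cls A.add_cls B.add_cls image_mset_union)
    qed
    show "tensor_map R M N' f (r \<odot>\<^bsub>tensor R M N\<^esub> x) = r \<odot>\<^bsub>tensor R M N'\<^esub> tensor_map R M N' f x"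
      if "r \<in> carrier R" for r
      using v map_words[OF v(1)] A.smult_words[OF that v(1)] that
      by (simp only: A.smult_cls B.smult_cls tensor_map_cls swap)
  qed
qed

end

lemma tensor_functorI:
  "\<lbrakk>semimodule R M; semimodule R N; semimodule R N'; f \<in> semimodule_hom R N N'\<rbrakk> \<Longrightarrow>
    tensor_functor R M N N' f"
  by (simp add: tensor_functor_def tensor_functor_axioms_def semimodule_pair_def)

section \<open>Base change from the natural numbers\<close>

lemma semimodule_nat_module:
  assumes "abelian_monoid A"
  shows "semimodule nat_semiring (nat_module A)"
proof -
  interpret A: abelian_monoid A by fact
  have "abelian_monoid (nat_module A)"
    by (rule abelian_monoidI) (auto simp: nat_module_def A.a_ac)
  then show ?thesis
    by (intro semimodule.intro semimodule_axioms.intro nonneg_semiring_props)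
       (auto simp: nat_module_def nonneg_semiring_def A.add.nat_pow_mult A.add.nat_pow_distrib
         A.add.nat_pow_pow mult.commute)
qed

lemma nat_module_simps [simp]:
  "carrier (nat_module A) = carrier A"
  "\<zero>\<^bsub>nat_module A\<^esub> = \<zero>\<^bsub>A\<^esub>"
  "x \<oplus>\<^bsub>nat_module A\<^esub> y = x \<oplus>\<^bsub>A\<^esub> y"
  "k \<odot>\<^bsub>nat_module A\<^esub> x = [k] \<cdot>\<^bsub>A\<^esub> x"
  by (simp_all add: nat_module_def)

lemma carrier_nat_semiring [simp]: "k \<in> carrier nat_semiring"
  by (simp add: nonneg_semiring_def)

lemma semimodule_alg_module:
  assumes "csemiring R" "is_algebra R A"
  shows "semimodule R (alg_module A)"
proof -
  interpret R: csemiring R by fact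
  interpret A: csemiring A using assms(2) by (simp add: is_algebra_def)
  have hom: "structure_map A \<in> semiring_hom R A" using assms(2) by (simp add: is_algebra_def)
  then have closed: "structure_map A r \<in> carrier A" if "r \<in> carrier R" for r
    using that by (auto simp: semiring_hom_def ring_hom_def)
  have "abelian_monoid (alg_module A)"
    by (rule abelian_monoidI) (auto simp: alg_module_def A.a_ac)
  then show ?thesis
    using hom closed
    by (intro semimodule.intro semimodule_axioms.intro \<open>csemiring R\<close>)
       (auto simp: alg_module_def semiring_hom_def ring_hom_def A.l_distr A.r_distr A.m_assoc)
qed

locale csemiring_pair = R: csemiring R + A: csemiring A
  for R :: "'r ring" and A :: "'a ring"

sublocale csemiring_pair \<subseteq> T: semimodule_pair nat_semiring "nat_module R" "nat_module A"
  by (intro semimodule_pairI semimodule_nat_module R.abelian_monoid_axioms A.abelian_monoid_axioms)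

context csemiring_pair
begin

definition scale_word :: "'r \<Rightarrow> 'a \<Rightarrow> ('r \<times> 'a) multiset \<Rightarrow> ('r \<times> 'a) multiset" where
  "scale_word r a w = {# (r \<otimes>\<^bsub>R\<^esub> s, a \<otimes>\<^bsub>A\<^esub> b). (s, b) \<in># w #}"

definition mult_word :: "('r \<times> 'a) multiset \<Rightarrow> ('r \<times> 'a) multiset \<Rightarrow> ('r \<times> 'a) multiset" where
  "mult_word v w = (\<Sum>(r, a) \<in># v. scale_word r a w)"

lemma scale_word_simps [simp]:
  "scale_word r a {#} = {#}"
  "scale_word r a (v + w) = scale_word r a v + scale_word r a w"
  "scale_word r a (add_mset (s, b) w) = add_mset (r \<otimes>\<^bsub>R\<^esub> s, a \<otimes>\<^bsub>A\<^esub> b) (scale_word r a w)"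
  by (simp_all add: scale_word_def)

lemma mult_word_simps [simp]:
  "mult_word {#} w = {#}"
  "mult_word (u + v) w = mult_word u w + mult_word v w"
  "mult_word (add_mset (r, a) v) w = scale_word r a w + mult_word v w"
  by (simp_all add: mult_word_def)

lemma mult_word_right_simps [simp]:
  "mult_word w {#} = {#}"
  "mult_word w (u + v) = mult_word w u + mult_word w v"
  by (induction w) auto

lemma scale_word_words:
  "\<lbrakk>r \<in> carrier R; a \<in> carrier A; w \<in> T.words\<rbrakk> \<Longrightarrow> scale_word r a w \<in> T.words"
  by (auto simp: scale_word_def subset_iff)

lemma mult_word_words:
  assumes "v \<in> T.words" "w \<in> T.words"
  shows "mult_word v w \<in> T.words"
  using assms(1)
proof (induction v)
  case (add p v)
  then show ?case using scale_word_words[OF _ _ assms(2), of "fst p" "snd p"] by (cases p) auto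
qed simp

lemma mult_word_single: "mult_word w {#(r, a)#} = {# (s \<otimes>\<^bsub>R\<^esub> r, b \<otimes>\<^bsub>A\<^esub> a). (s, b) \<in># w #}"
  by (induction w) auto

lemma mult_word_commute:
  assumes "v \<in> T.words" "w \<in> T.words"
  shows "mult_word v w = mult_word w v"
  using assms(1)
proof (induction v)
  case (add p v)
  obtain r a where p: "p = (r, a)" by (cases p)
  have "scale_word r a w = mult_word w {#(r, a)#}"
    unfolding mult_word_single scale_word_def
    using add.prems assms(2) by (intro image_mset_cong) (auto simp: p R.m_comm A.m_comm subset_iff)
  moreover have "mult_word v w = mult_word w v" using add by simp
  ultimately show ?case
    using mult_word_right_simps(2)[of w "{#p#}" v] by (simp add: p)
qed simp

lemma mult_word_scale:
  assumes "r \<in> carrier R" "a \<in> carrier A" "v \<in> T.words" "w \<in> T.words"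
  shows "mult_word (scale_word r a v) w = scale_word r a (mult_word v w)"
  using assms(3)
proof (induction v)
  case (add p v)
  obtain s b where p: "p = (s, b)" "s \<in> carrier R" "b \<in> carrier A" using add.prems by (cases p) auto
  have "scale_word (r \<otimes>\<^bsub>R\<^esub> s) (a \<otimes>\<^bsub>A\<^esub> b) w = scale_word r a (scale_word s b w)"
    unfolding scale_word_def image_mset.compositionality o_def
    using assms p by (intro image_mset_cong) (auto simp: R.m_assoc A.m_assoc subset_iff)
  then show ?case using add p by simp
qed simp

lemma mult_word_assoc:
  assumes "u \<in> T.words" "v \<in> T.words" "w \<in> T.words"
  shows "mult_word (mult_word u v) w = mult_word u (mult_word v w)"
  using assms(1)
proof (induction u)
  case (add p u)
  then show ?case using assms mult_word_scale[of "fst p" "snd p" v w] by (cases p) auto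
qed simp

lemma scale_word_rel:
  assumes ra: "r \<in> carrier R" "a \<in> carrier A"
    and "(v, w) \<in> tensor_rel nat_semiring (nat_module R) (nat_module A)"
  shows "(scale_word r a v, scale_word r a w) \<in> tensor_rel nat_semiring (nat_module R) (nat_module A)"
  using assms(3)
proof (induction rule: tensor_rel.induct)
  case (refl w)
  then show ?case using scale_word_words[OF ra, of w] by (intro tensor_rel.refl) auto
next
  case (trans u v w)
  then show ?case by (blast intro: tensor_rel.trans)
next
  case (add_left m m' n)
  then show ?case
    using ra tensor_rel.add_left[where R = nat_semiring and M = "nat_module R" and N = "nat_module A" and m = "r \<otimes>\<^bsub>R\<^esub> m"
        and m' = "r \<otimes>\<^bsub>R\<^esub> m'" and n = "a \<otimes>\<^bsub>A\<^esub> n"]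
    by (simp add: R.r_distr)
next
  case (add_right m n n')
  then show ?case
    using ra tensor_rel.add_right[where R = nat_semiring and M = "nat_module R" and N = "nat_module A" and m = "r \<otimes>\<^bsub>R\<^esub> m"
        and n = "a \<otimes>\<^bsub>A\<^esub> n" and n' = "a \<otimes>\<^bsub>A\<^esub> n'"]
    by (simp add: A.r_distr)
next
  case (zero_left n)
  then show ?case
    using ra tensor_rel.zero_left[where R = nat_semiring and M = "nat_module R" and N = "nat_module A" and n = "a \<otimes>\<^bsub>A\<^esub> n"] by simp
next
  case (zero_right m)
  then show ?case
    using ra tensor_rel.zero_right[where R = nat_semiring and M = "nat_module R" and N = "nat_module A" and m = "r \<otimes>\<^bsub>R\<^esub> m"] by simp
next
  case (balanced k m n)
  then show ?case
    using ra tensor_rel.balanced[where R = nat_semiring and M = "nat_module R" and N = "nat_module A" and r = k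
        and m = "r \<otimes>\<^bsub>R\<^esub> m" and n = "a \<otimes>\<^bsub>A\<^esub> n"]
    by (simp add: R.add_pow_rdistr A.add_pow_rdistr)
qed (simp_all add: tensor_rel.sym tensor_rel.plus)

lemma mult_word_rel_right:
  assumes "u \<in> T.words" "(v, w) \<in> tensor_rel nat_semiring (nat_module R) (nat_module A)"
  shows "(mult_word u v, mult_word u w) \<in> tensor_rel nat_semiring (nat_module R) (nat_module A)"
  using assms(1)
proof (induction u)
  case empty
  show ?case by (simp add: tensor_rel.refl)
next
  case (add p u)
  then show ?case
    using scale_word_rel[OF _ _ assms(2), of "fst p" "snd p"] by (cases p) (simp add: tensor_rel.plus)
qed

text \<open>Together with the previous lemma this makes the product of classes well defined; by
  commutativity one side suffices.\<close>

lemma mult_word_rel_left: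
  assumes "w \<in> T.words" "(u, v) \<in> tensor_rel nat_semiring (nat_module R) (nat_module A)"
  shows "(mult_word u w, mult_word v w) \<in> tensor_rel nat_semiring (nat_module R) (nat_module A)"
  using mult_word_rel_right[OF assms] mult_word_commute assms(1) T.tensor_rel_words[OF assms(2)]
  by metis

abbreviation "cls \<equiv> tensor_class nat_semiring (nat_module R) (nat_module A)"

lemma base_change_simps:
  "carrier (base_change R A) = carrier (tensor nat_semiring (nat_module R) (nat_module A))"
  "\<zero>\<^bsub>base_change R A\<^esub> = cls {#}"
  "\<one>\<^bsub>base_change R A\<^esub> = cls {#(\<one>\<^bsub>R\<^esub>, \<one>\<^bsub>A\<^esub>)#}"
  "structure_map (base_change R A) r = cls {#(r, \<one>\<^bsub>A\<^esub>)#}"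
  "add (base_change R A) = add (tensor nat_semiring (nat_module R) (nat_module A))"
  by (simp_all add: base_change_def Let_def T.zero_tensor)

lemma base_change_mult:
  assumes "v \<in> T.words" "w \<in> T.words"
  shows "cls v \<otimes>\<^bsub>base_change R A\<^esub> cls w = cls (mult_word v w)"
proof -
  have inner: "(\<Union>w'\<in>cls w. cls (mult_word v' w')) = cls (mult_word v' w)" if "v' \<in> T.words" for v'
    using that assms
    by (intro T.UN_cls T.cls_eqI tensor_rel.sym[OF mult_word_rel_right]) auto
  have "(\<Union>v'\<in>cls v. \<Union>w'\<in>cls w. cls (mult_word v' w')) = (\<Union>v'\<in>cls v. cls (mult_word v' w))"
    by (intro SUP_cong refl inner) (auto simp: tensor_class_def dest!: T.tensor_rel_words(2))
  also have "\<dots> = cls (mult_word v w)"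
    using assms by (intro T.UN_cls T.cls_eqI tensor_rel.sym[OF mult_word_rel_left]) auto
  finally show ?thesis
    by (simp add: base_change_def Let_def mult_word_def scale_word_def)
qed

lemma base_change_add:
  "\<lbrakk>v \<in> T.words; w \<in> T.words\<rbrakk> \<Longrightarrow> cls v \<oplus>\<^bsub>base_change R A\<^esub> cls w = cls (v + w)"
  by (simp add: base_change_simps T.add_cls)

lemma base_change_E:
  assumes "x \<in> carrier (base_change R A)"
  obtains w where "w \<in> T.words" "x = cls w"
  using assms T.carrier_tensorE unfolding base_change_simps by blast

lemma single_word: "\<lbrakk>r \<in> carrier R; a \<in> carrier A\<rbrakk> \<Longrightarrow> {#(r, a)#} \<in> T.words"
  by simp

lemma one_word: "w \<in> T.words \<Longrightarrow> mult_word {#(\<one>\<^bsub>R\<^esub>, \<one>\<^bsub>A\<^esub>)#} w = w"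
proof -
  assume "w \<in> T.words"
  then have "scale_word \<one>\<^bsub>R\<^esub> \<one>\<^bsub>A\<^esub> w = image_mset (\<lambda>p. p) w"
    unfolding scale_word_def by (intro image_mset_cong) (auto simp: subset_iff)
  then show ?thesis by simp
qed

lemma csemiring_base_change: "csemiring (base_change R A)"
proof -
  let ?B = "base_change R A"
  interpret T': semimodule nat_semiring "tensor nat_semiring (nat_module R) (nat_module A)"
    by (rule T.semimodule_tensor)
  have abel: "abelian_monoid ?B"
    by (rule abelian_monoidI)
       (auto simp: base_change_simps T.zero_tensor[symmetric] T'.M.a_ac)
  have closed: "cls w \<in> carrier ?B" if "w \<in> T.words" for w
    unfolding base_change_simps by (rule T.cls_in_carrier[OF that])
  have monoid: "comm_monoid ?B"
  proof (rule comm_monoidI)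
    show "\<one>\<^bsub>?B\<^esub> \<in> carrier ?B"
      by (simp only: base_change_simps T.cls_in_carrier single_word R.one_closed A.one_closed)
    fix x assume "x \<in> carrier ?B"
    then obtain u where u: "u \<in> T.words" "x = cls u" by (rule base_change_E)
    show "\<one>\<^bsub>?B\<^esub> \<otimes>\<^bsub>?B\<^esub> x = x"
      unfolding u base_change_simps(3)
      by (simp only: base_change_mult u(1) single_word R.one_closed A.one_closed one_word)
    fix y assume "y \<in> carrier ?B"
    then obtain v where v: "v \<in> T.words" "y = cls v" by (rule base_change_E)
    note uv = mult_word_words[OF u(1) v(1)]
    show "x \<otimes>\<^bsub>?B\<^esub> y \<in> carrier ?B"
      unfolding u v by (simp only: base_change_mult u(1) v(1) uv closed)
    show "x \<otimes>\<^bsub>?B\<^esub> y = y \<otimes>\<^bsub>?B\<^esub> x"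
      unfolding u v base_change_mult[OF u(1) v(1)] base_change_mult[OF v(1) u(1)]
      by (simp only: mult_word_commute[OF u(1) v(1)])
    fix z assume "z \<in> carrier ?B"
    then obtain w where w: "w \<in> T.words" "z = cls w" by (rule base_change_E)
    show "x \<otimes>\<^bsub>?B\<^esub> y \<otimes>\<^bsub>?B\<^esub> z = x \<otimes>\<^bsub>?B\<^esub> (y \<otimes>\<^bsub>?B\<^esub> z)"
      unfolding u v w
      by (simp only: base_change_mult u(1) v(1) w(1) uv mult_word_words mult_word_assoc)
  qed
  interpret B: abelian_monoid ?B by (rule abel)
  interpret B: comm_monoid ?B by (rule monoid)
  have "semiring ?B"
  proof (intro semiring.intro semiring_axioms.intro)
    show "abelian_monoid ?B" "monoid ?B" by unfold_locales
    fix x assume "x \<in> carrier ?B"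
    then obtain u where u: "u \<in> T.words" "x = cls u" by (rule base_change_E)
    show "\<zero>\<^bsub>?B\<^esub> \<otimes>\<^bsub>?B\<^esub> x = \<zero>\<^bsub>?B\<^esub>" "x \<otimes>\<^bsub>?B\<^esub> \<zero>\<^bsub>?B\<^esub> = \<zero>\<^bsub>?B\<^esub>"
      using base_change_mult[of "{#}" u] base_change_mult[of u "{#}"] u
      by (simp_all add: base_change_simps)
    fix y z assume "y \<in> carrier ?B" "z \<in> carrier ?B"
    then obtain v w where v: "v \<in> T.words" "y = cls v" and w: "w \<in> T.words" "z = cls w"
      by (metis base_change_E)
    have uv: "u + v \<in> T.words" using u v by simp
    show "(x \<oplus>\<^bsub>?B\<^esub> y) \<otimes>\<^bsub>?B\<^esub> z = x \<otimes>\<^bsub>?B\<^esub> z \<oplus>\<^bsub>?B\<^esub> y \<otimes>\<^bsub>?B\<^esub> z"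
      unfolding u v w
      by (simp only: base_change_add base_change_mult u(1) v(1) w(1) uv mult_word_words mult_word_simps)
    then show "z \<otimes>\<^bsub>?B\<^esub> (x \<oplus>\<^bsub>?B\<^esub> y) = z \<otimes>\<^bsub>?B\<^esub> x \<oplus>\<^bsub>?B\<^esub> z \<otimes>\<^bsub>?B\<^esub> y"
      using \<open>x \<in> carrier ?B\<close> \<open>y \<in> carrier ?B\<close> \<open>z \<in> carrier ?B\<close> by (simp add: B.m_comm)
  qed
  then show ?thesis by (simp add: csemiring_def monoid)
qed

lemma base_change_is_algebra: "is_algebra R (base_change R A)"
proof -
  have w: "{#(r, \<one>\<^bsub>A\<^esub>)#} \<in> T.words" if "r \<in> carrier R" for r
    using that by simp
  have closed: "structure_map (base_change R A) r \<in> carrier (base_change R A)" if "r \<in> carrier R" for r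
    using w[OF that] by (simp only: base_change_simps T.cls_in_carrier)
  have mult: "structure_map (base_change R A) (r \<otimes>\<^bsub>R\<^esub> s) =
      structure_map (base_change R A) r \<otimes>\<^bsub>base_change R A\<^esub> structure_map (base_change R A) s"
    if "r \<in> carrier R" "s \<in> carrier R" for r s
    unfolding base_change_simps(4) base_change_mult[OF w[OF that(1)] w[OF that(2)]] by simp
  have add: "structure_map (base_change R A) (r \<oplus>\<^bsub>R\<^esub> s) =
      structure_map (base_change R A) r \<oplus>\<^bsub>base_change R A\<^esub> structure_map (base_change R A) s"
    if "r \<in> carrier R" "s \<in> carrier R" for r s
    unfolding base_change_simps(4) base_change_add[OF w[OF that(1)] w[OF that(2)]]
    using T.add_cls_left[of r s "\<one>\<^bsub>A\<^esub>"] that by (simp add: add_mset_commute)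
  have "structure_map (base_change R A) \<zero>\<^bsub>R\<^esub> = \<zero>\<^bsub>base_change R A\<^esub>"
    unfolding base_change_simps
    using tensor_rel.zero_left[where R = nat_semiring and M = "nat_module R" and N = "nat_module A" and n = "\<one>\<^bsub>A\<^esub>"]
    by (intro T.cls_eqI) simp
  then have "structure_map (base_change R A) \<in> semiring_hom R (base_change R A)"
    using closed mult add by (simp add: semiring_hom_def ring_hom_def base_change_simps(3,4))
  then show ?thesis by (simp add: is_algebra_def csemiring_base_change)
qed

end

section \<open>Semimodules with a dual basis are flat\<close>

context semimodule_pair
begin

lemma family_words:
  assumes "finite F" "u \<in> F \<rightarrow> carrier M" "v \<in> F \<rightarrow> carrier N"
  shows "{# (u k, v k). k \<in># mset_set F #} \<in> words"
  using assms by auto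

lemma cls_family_cong:
  assumes "finite F" "p \<in> F \<rightarrow> carrier M \<times> carrier N" "q \<in> F \<rightarrow> carrier M \<times> carrier N"
    and "\<And>k. k \<in> F \<Longrightarrow> cls {#p k#} = cls {#q k#}"
  shows "cls {# p k. k \<in># mset_set F #} = cls {# q k. k \<in># mset_set F #}"
  using assms
proof (induction F)
  case (insert k F)
  have "cls ({#p k#} + {# p k. k \<in># mset_set F #}) = cls ({#q k#} + {# q k. k \<in># mset_set F #})"
    using insert by (intro cls_plus_cong) (simp_all add: image_subset_iff_funcset)
  then show ?case using insert by simp
qed simp

lemma cls_family_zero:
  assumes "finite F" "u \<in> F \<rightarrow> carrier M"
  shows "cls {# (u k, \<zero>\<^bsub>N\<^esub>). k \<in># mset_set F #} = cls {#}"
  using assms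
proof (induction F)
  case (insert k F)
  have "cls ({#(u k, \<zero>\<^bsub>N\<^esub>)#} + {# (u k, \<zero>\<^bsub>N\<^esub>). k \<in># mset_set F #}) = cls ({#} + {#})"
  proof (rule cls_plus_cong)
    show "cls {#(u k, \<zero>\<^bsub>N\<^esub>)#} = cls {#}"
      using insert by (intro cls_eqI tensor_rel.zero_right) auto
  qed (use insert in auto)
  then show ?case using insert by simp
qed simp

lemma cls_family_add:
  assumes "finite F" "u \<in> F \<rightarrow> carrier M" "v \<in> F \<rightarrow> carrier N" "v' \<in> F \<rightarrow> carrier N"
  shows "cls {# (u k, v k \<oplus>\<^bsub>N\<^esub> v' k). k \<in># mset_set F #} =
    cls ({# (u k, v k). k \<in># mset_set F #} + {# (u k, v' k). k \<in># mset_set F #})"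
  using assms
proof (induction F)
  case (insert k F)
  have "cls ({#(u k, v k \<oplus>\<^bsub>N\<^esub> v' k)#} + {# (u k, v k \<oplus>\<^bsub>N\<^esub> v' k). k \<in># mset_set F #}) =
      cls ({#(u k, v k), (u k, v' k)#} +
        ({# (u k, v k). k \<in># mset_set F #} + {# (u k, v' k). k \<in># mset_set F #}))"
    using insert by (intro cls_plus_cong add_cls_right) (auto simp: Pi_iff)
  then show ?case using insert by (simp add: add_mset_commute)
qed simp

lemma cls_finsum_left:
  assumes "finite F" "u \<in> F \<rightarrow> carrier M" "n \<in> carrier N"
  shows "cls {#(\<Oplus>\<^bsub>M\<^esub>k\<in>F. u k, n)#} = cls {# (u k, n). k \<in># mset_set F #}"
  using assms
proof (induction F)
  case empty
  then show ?case by (auto intro!: cls_eqI tensor_rel.zero_left)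
next
  case (insert k F)
  have sum: "(\<Oplus>\<^bsub>M\<^esub>k\<in>F. u k) \<in> carrier M" using insert by auto
  have "cls {#(\<Oplus>\<^bsub>M\<^esub>k\<in>insert k F. u k, n)#} = cls {#(u k \<oplus>\<^bsub>M\<^esub> (\<Oplus>\<^bsub>M\<^esub>k\<in>F. u k), n)#}"
    using insert by (simp add: M.finsum_insert)
  also have "\<dots> = cls ({#(u k, n)#} + {#(\<Oplus>\<^bsub>M\<^esub>k\<in>F. u k, n)#})"
    using insert sum by (subst add_cls_left) (auto simp: add_mset_commute)
  also have "\<dots> = cls ({#(u k, n)#} + {# (u k, n). k \<in># mset_set F #})"
    using insert sum by (intro cls_plus_cong) auto
  finally show ?case using insert by simp
qed

end

text \<open>As for projective modules over a ring: elements \<open>b k\<close> and functionals \<open>c k\<close> such that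
  \<open>m = \<Sum>\<^sub>k c k m \<odot> b k\<close>, with finitely many nonzero terms. A basis of a free module together with its
  coordinate functions is the standard example.\<close>

locale dual_basis = semimodule R M for R :: "'r ring" and M :: "('r, 'a) module" +
  fixes K :: "'k set" and b :: "'k \<Rightarrow> 'a" and c :: "'k \<Rightarrow> 'a \<Rightarrow> 'r"
  assumes basis_closed: "k \<in> K \<Longrightarrow> b k \<in> carrier M"
    and coeff_hom: "k \<in> K \<Longrightarrow> c k \<in> semimodule_hom R M (regular_module R)"
    and finite_support: "m \<in> carrier M \<Longrightarrow> finite {k \<in> K. c k m \<noteq> \<zero>\<^bsub>R\<^esub>}"
    and expansion: "m \<in> carrier M \<Longrightarrow>
      m = (\<Oplus>\<^bsub>M\<^esub>k\<in>{k \<in> K. c k m \<noteq> \<zero>\<^bsub>R\<^esub>}. c k m \<odot>\<^bsub>M\<^esub> b k)"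
begin

lemma coeff_simps:
  assumes "k \<in> K"
  shows "m \<in> carrier M \<Longrightarrow> c k m \<in> carrier R"
    and "c k \<zero>\<^bsub>M\<^esub> = \<zero>\<^bsub>R\<^esub>"
    and "\<lbrakk>m \<in> carrier M; m' \<in> carrier M\<rbrakk> \<Longrightarrow> c k (m \<oplus>\<^bsub>M\<^esub> m') = c k m \<oplus>\<^bsub>R\<^esub> c k m'"
    and "\<lbrakk>r \<in> carrier R; m \<in> carrier M\<rbrakk> \<Longrightarrow> c k (r \<odot>\<^bsub>M\<^esub> m) = r \<otimes>\<^bsub>R\<^esub> c k m"
  using semimodule_homD[OF coeff_hom[OF assms]] by (auto simp: regular_module_def)

text \<open>Applying \<open>c k\<close> to the first factor of \<open>M \<otimes> N\<close> gives an element of \<open>R \<otimes> N \<cong> N\<close>.\<close>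

definition coeff :: "('r, 'b) module \<Rightarrow> 'k \<Rightarrow> ('a \<times> 'b) multiset \<Rightarrow> 'b" where
  "coeff N k w = msum N (\<lambda>(m, n). c k m \<odot>\<^bsub>N\<^esub> n) w"

definition support :: "('a \<times> 'b) multiset \<Rightarrow> 'k set" where
  "support w = (\<Union>(m, n)\<in>set_mset w. {k \<in> K. c k m \<noteq> \<zero>\<^bsub>R\<^esub>})"

end

locale dual_basis_tensor = dual_basis R M K b c + N: semimodule R N
  for R :: "'r ring" and M :: "('r, 'a) module" and K :: "'k set" and b c
    and N :: "('r, 'b) module"

sublocale dual_basis_tensor \<subseteq> T: semimodule_pair R M N
  by (intro semimodule_pairI) unfold_locales

context dual_basis_tensor
begin

lemma coeff_summand:
  assumes "k \<in> K" "w \<in> T.words"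
  shows "(\<lambda>(m, n). c k m \<odot>\<^bsub>N\<^esub> n) \<in> set_mset w \<rightarrow> carrier N"
  using assms by (auto intro!: N.smult_closed coeff_simps(1))

lemma coeff_closed: "\<lbrakk>k \<in> K; w \<in> T.words\<rbrakk> \<Longrightarrow> coeff N k w \<in> carrier N"
  unfolding coeff_def by (intro N.msum_closed coeff_summand)

lemma coeff_cong:
  assumes k: "k \<in> K" and w: "v \<in> T.words" "w \<in> T.words" and eq: "T.cls v = T.cls w"
  shows "coeff N k v = coeff N k w"
  unfolding coeff_def
proof (rule T.msum_tensor_rel)
  show "(v, w) \<in> tensor_rel R M N" using eq T.cls_eq_iff[OF w] by simp
  show "abelian_monoid N" by unfold_locales
  fix r m n assume "r \<in> carrier R" "m \<in> carrier M" "n \<in> carrier N"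
  then show "(case (r \<odot>\<^bsub>M\<^esub> m, n) of (m, n) \<Rightarrow> c k m \<odot>\<^bsub>N\<^esub> n) =
      (case (m, r \<odot>\<^bsub>N\<^esub> n) of (m, n) \<Rightarrow> c k m \<odot>\<^bsub>N\<^esub> n)"
    using k by (simp add: coeff_simps N.smult_assoc[symmetric] R.m_comm)
qed (use k in \<open>simp_all add: coeff_simps N.smult_closed N.smult_add_left N.smult_add_right
      N.smult_zero_left N.smult_zero_right\<close>)

lemma finite_support_word: "w \<in> T.words \<Longrightarrow> finite (support w)"
  unfolding support_def by (intro finite_UN_I) (auto intro: finite_support)

lemma support_subset: "support w \<subseteq> K"
  by (auto simp: support_def)

lemma normal_form_single:
  assumes F: "finite F" "F \<subseteq> K" "{k \<in> K. c k m \<noteq> \<zero>\<^bsub>R\<^esub>} \<subseteq> F"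
    and mn: "m \<in> carrier M" "n \<in> carrier N"
  shows "T.cls {#(m, n)#} = T.cls {# (b k, c k m \<odot>\<^bsub>N\<^esub> n). k \<in># mset_set F #}"
proof -
  have cl: "b k \<in> carrier M" "c k m \<in> carrier R" if "k \<in> F" for k
    using that F mn by (auto intro: basis_closed coeff_simps)
  have "m = (\<Oplus>\<^bsub>M\<^esub>k\<in>{k \<in> K. c k m \<noteq> \<zero>\<^bsub>R\<^esub>}. c k m \<odot>\<^bsub>M\<^esub> b k)"
    by (rule expansion[OF mn(1)])
  also have "\<dots> = (\<Oplus>\<^bsub>M\<^esub>k\<in>F. c k m \<odot>\<^bsub>M\<^esub> b k)"
    by (rule add.finprod_mono_neutral_cong_left)
       (use F cl in \<open>auto simp: smult_zero_left smult_closed\<close>)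
  finally have "T.cls {#(m, n)#} = T.cls {#(\<Oplus>\<^bsub>M\<^esub>k\<in>F. c k m \<odot>\<^bsub>M\<^esub> b k, n)#}" by simp
  also have "\<dots> = T.cls {# (c k m \<odot>\<^bsub>M\<^esub> b k, n). k \<in># mset_set F #}"
    using F cl mn by (intro T.cls_finsum_left) (auto simp: smult_closed)
  also have "\<dots> = T.cls {# (b k, c k m \<odot>\<^bsub>N\<^esub> n). k \<in># mset_set F #}"
    using F cl mn
    by (intro T.cls_family_cong T.cls_eqI tensor_rel.balanced) (auto simp: smult_closed N.smult_closed)
  finally show ?thesis .
qed

text \<open>Expanding the first factor of each pure tensor and moving the coefficients across the tensor
  sign recovers an element from its coefficients. Any finite \<open>F\<close> that contains the support will do, so
  that one \<open>F\<close> can serve for several elements.\<close>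

lemma normal_form:
  assumes F: "finite F" "F \<subseteq> K" and "support w \<subseteq> F" "w \<in> T.words"
  shows "T.cls w = T.cls {# (b k, coeff N k w). k \<in># mset_set F #}"
  using assms(3,4)
proof (induction w)
  case empty
  have "T.cls {# (b k, \<zero>\<^bsub>N\<^esub>). k \<in># mset_set F #} = T.cls {#}"
    using F by (intro T.cls_family_zero) (auto intro: basis_closed)
  then show ?case by (simp add: coeff_def)
next
  case (add p w)
  obtain m n where p: "p = (m, n)" "m \<in> carrier M" "n \<in> carrier N"
    using add.prems by (cases p) auto
  have w: "w \<in> T.words" "support w \<subseteq> F" and m: "{k \<in> K. c k m \<noteq> \<zero>\<^bsub>R\<^esub>} \<subseteq> F"
    using add.prems p by (auto simp: support_def)
  have coeff: "coeff N k (add_mset p w) = c k m \<odot>\<^bsub>N\<^esub> n \<oplus>\<^bsub>N\<^esub> coeff N k w" if "k \<in> F" for k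
  proof -
    have "(\<lambda>(m, n). c k m \<odot>\<^bsub>N\<^esub> n) \<in> insert p (set_mset w) \<rightarrow> carrier N"
      using coeff_summand[OF subsetD[OF F(2) that] add.prems(2)]
      by (simp only: set_mset_add_mset_insert)
    from N.msum_add_mset[OF this] show ?thesis by (simp add: coeff_def p)
  qed
  have cl: "b k \<in> carrier M" "c k m \<odot>\<^bsub>N\<^esub> n \<in> carrier N" "coeff N k w \<in> carrier N" if "k \<in> F" for k
    using that F p w by (auto intro!: basis_closed N.smult_closed coeff_simps coeff_closed)
  have "T.cls (add_mset p w) = T.cls ({#(m, n)#} + w)" by (simp add: p)
  also have "\<dots> = T.cls ({# (b k, c k m \<odot>\<^bsub>N\<^esub> n). k \<in># mset_set F #} +
      {# (b k, coeff N k w). k \<in># mset_set F #})"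
    using add.IH[OF w(2,1)] normal_form_single[OF F m p(2,3)] p w F cl
    by (intro T.cls_plus_cong) auto
  also have "\<dots> = T.cls {# (b k, c k m \<odot>\<^bsub>N\<^esub> n \<oplus>\<^bsub>N\<^esub> coeff N k w). k \<in># mset_set F #}"
    using F cl by (intro T.cls_family_add[symmetric]) auto
  also have "\<dots> = T.cls {# (b k, coeff N k (add_mset p w)). k \<in># mset_set F #}"
    using coeff F(1) by (intro arg_cong[of _ _ T.cls] image_mset_cong) auto
  finally show ?case .
qed

lemma cls_eq_if_coeff_eq:
  assumes "v \<in> T.words" "w \<in> T.words" "\<And>k. k \<in> K \<Longrightarrow> coeff N k v = coeff N k w"
  shows "T.cls v = T.cls w"
proof -
  let ?F = "support v \<union> support w"
  have F: "finite ?F" "?F \<subseteq> K" using assms finite_support_word support_subset by (simp, meson Un_least support_subset)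
  have "T.cls v = T.cls {# (b k, coeff N k v). k \<in># mset_set ?F #}"
    using F assms by (intro normal_form) auto
  also have "\<dots> = T.cls {# (b k, coeff N k w). k \<in># mset_set ?F #}"
    using F assms(3) by (intro arg_cong[of _ _ T.cls] image_mset_cong) auto
  also have "\<dots> = T.cls w"
    using F assms by (intro normal_form[symmetric]) auto
  finally show ?thesis .
qed

end

lemma (in dual_basis) coeff_natural:
  assumes N: "semimodule R N" and N': "semimodule R N'" and h: "h \<in> semimodule_hom R N N'"
    and k: "k \<in> K" and w: "set_mset w \<subseteq> carrier M \<times> carrier N"
  shows "coeff N' k {# (m, h n). (m, n) \<in># w #} = h (coeff N k w)"
proof -
  interpret N: dual_basis_tensor R M K b c N
    by (intro dual_basis_tensor.intro dual_basis_axioms N)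
  interpret N': dual_basis_tensor R M K b c N'
    by (intro dual_basis_tensor.intro dual_basis_axioms N')
  interpret h: tensor_functor R M N N' h
    by (intro tensor_functorI semimodule_axioms N N' h)
  show ?thesis
    using w
  proof (induction w)
    case empty
    show ?case using semimodule_homD(2)[OF h] by (simp add: coeff_def)
  next
    case (add p w)
    obtain m n where p: "p = (m, n)" "m \<in> carrier M" "n \<in> carrier N"
      using add.prems by (cases p) auto
    have cm: "c k m \<in> carrier R" using k p by (simp add: coeff_simps)
    have w: "w \<in> N.T.words" using add.prems by simp
    have 1: "coeff N k (add_mset p w) = c k m \<odot>\<^bsub>N\<^esub> n \<oplus>\<^bsub>N\<^esub> coeff N k w"
      unfolding coeff_def using N.coeff_summand[of k "add_mset p w"] k add.prems
      by (subst N.N.msum_add_mset) (auto simp: p)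
    have 2: "coeff N' k (add_mset (m, h n) {# (m, h n). (m, n) \<in># w #}) =
        c k m \<odot>\<^bsub>N'\<^esub> h n \<oplus>\<^bsub>N'\<^esub> coeff N' k {# (m, h n). (m, n) \<in># w #}"
      unfolding coeff_def
      using N'.coeff_summand[of k "add_mset (m, h n) {# (m, h n). (m, n) \<in># w #}"] k
        h.map_words[of "add_mset p w"] add.prems
      by (subst N'.N.msum_add_mset) (auto simp: p)
    show ?case
      using add w p cm k
      by (simp add: 1[unfolded p(1)] 2 semimodule_homD[OF h] N.N.smult_closed N.coeff_closed)
  qed
qed

text \<open>Since coefficients are natural in \<open>N\<close>, a compatible family in the modules \<open>M \<otimes> D j\<close> amounts to
  one compatible family in the \<open>D j\<close> for each \<open>k\<close>, and each of these has a limit \<open>l k\<close> in \<open>L\<close>. The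
  elements \<open>b k \<otimes> l k\<close> add up to the required element of \<open>M \<otimes> L\<close>. Only finitely many \<open>k\<close> matter,
  because there are finitely many objects.\<close>

theorem (in dual_basis) dual_basis_imp_flat: "flat U R M"
  unfolding flat_def
proof (intro allI impI, elim conjE)
  fix J and D :: "nat \<Rightarrow> ('r, 'u) module" and \<phi> and L :: "('r, 'u) module" and \<pi>
  assume J: "finite_category J" and D: "is_diagram R J D \<phi>" and lim: "is_limit_cone R J D \<phi> L \<pi>"
  have finJ: "finite (Obj J)" and arr: "\<And>a. a \<in> Arr J \<Longrightarrow> Dom J a \<in> Obj J \<and> Cod J a \<in> Obj J"
    using J by (auto simp: finite_category_def)
  have sD: "semimodule R (D j)" if "j \<in> Obj J" for j
    using D that by (simp add: is_diagram_def)
  have h\<phi>: "\<phi> a \<in> semimodule_hom R (D (Dom J a)) (D (Cod J a))" if "a \<in> Arr J" for a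
    using D that by (simp add: is_diagram_def)
  have cone: "is_cone R J D \<phi> L \<pi>" using lim by (simp add: is_limit_cone_def)
  have sL: "semimodule R L" and h\<pi>: "\<And>j. j \<in> Obj J \<Longrightarrow> \<pi> j \<in> semimodule_hom R L (D j)"
    and comp: "\<And>a x. \<lbrakk>a \<in> Arr J; x \<in> carrier L\<rbrakk> \<Longrightarrow> \<phi> a (\<pi> (Dom J a) x) = \<pi> (Cod J a) x"
    using cone by (auto simp: is_cone_def)
  have ex1: "\<exists>!x. x \<in> carrier L \<and> (\<forall>j \<in> Obj J. \<pi> j x = y j)"
    if "\<And>j. j \<in> Obj J \<Longrightarrow> y j \<in> carrier (D j)"
      "\<And>a. a \<in> Arr J \<Longrightarrow> \<phi> a (y (Dom J a)) = y (Cod J a)" for y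
    using lim that unfolding is_limit_cone_def by blast
  interpret L: dual_basis_tensor R M K b c L
    by (intro dual_basis_tensor.intro dual_basis_axioms sL)
  note sM = semimodule_axioms
  have ft: "dual_basis_tensor R M K b c (D j)" if "j \<in> Obj J" for j
    by (intro dual_basis_tensor.intro dual_basis_axioms sD that)
  have f\<pi>: "tensor_functor R M L (D j) (\<pi> j)" if "j \<in> Obj J" for j
    by (intro tensor_functorI sM sL sD h\<pi> that)
  have f\<phi>: "tensor_functor R M (D (Dom J a)) (D (Cod J a)) (\<phi> a)" if "a \<in> Arr J" for a
    using arr[OF that] by (intro tensor_functorI sM sD h\<phi> that) auto
  let ?T = "\<lambda>j. tensor R M (D j)" and ?w = "\<lambda>j. {w. set_mset w \<subseteq> carrier M \<times> carrier (D j)}"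
  let ?\<phi> = "\<lambda>a. tensor_map R M (D (Cod J a)) (\<phi> a)" and ?\<pi> = "\<lambda>j. tensor_map R M (D j) (\<pi> j)"
  let ?cls = "\<lambda>j. tensor_class R M (D j)"
  have \<phi>_cls: "?\<phi> a (?cls (Dom J a) w) = ?cls (Cod J a) {# (m, \<phi> a n). (m, n) \<in># w #}"
    if "a \<in> Arr J" "w \<in> ?w (Dom J a)" for a w
    by (rule tensor_functor.tensor_map_cls[OF f\<phi>[OF that(1)] that(2)])
  have \<pi>_cls: "?\<pi> j (L.T.cls w) = ?cls j {# (m, \<pi> j n). (m, n) \<in># w #}"
    if "j \<in> Obj J" "w \<in> L.T.words" for j w
    by (rule tensor_functor.tensor_map_cls[OF f\<pi>[OF that(1)] that(2)])
  have "is_cone R J ?T ?\<phi> (tensor R M L) ?\<pi>"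
    unfolding is_cone_def
  proof (intro conjI ballI)
    show "semimodule R (tensor R M L)" by (rule L.T.semimodule_tensor)
    show "?\<pi> j \<in> semimodule_hom R (tensor R M L) (?T j)" if "j \<in> Obj J" for j
      by (rule tensor_functor.tensor_map_hom[OF f\<pi>[OF that]])
    fix a x assume a: "a \<in> Arr J" and "x \<in> carrier (tensor R M L)"
    then obtain w where w: "w \<in> L.T.words" "x = L.T.cls w" by (metis L.T.carrier_tensorE)
    have "{# (m, \<phi> a n). (m, n) \<in># {# (m, \<pi> (Dom J a) n). (m, n) \<in># w #} #} =
        {# (m, \<pi> (Cod J a) n). (m, n) \<in># w #}"
      unfolding image_mset.compositionality o_def
      using w(1) comp[OF a] by (intro image_mset_cong) (auto simp: subset_iff)
    then show "?\<phi> a (?\<pi> (Dom J a) x) = ?\<pi> (Cod J a) x"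
      unfolding w(2) using arr[OF a] w(1) tensor_functor.map_words[OF f\<pi>]
      by (simp only: \<pi>_cls \<phi>_cls[OF a])
  qed
  moreover have "\<exists>!x. x \<in> carrier (tensor R M L) \<and> (\<forall>j \<in> Obj J. ?\<pi> j x = z j)"
    if z: "\<forall>j \<in> Obj J. z j \<in> carrier (?T j)" and z\<phi>: "\<forall>a \<in> Arr J. ?\<phi> a (z (Dom J a)) = z (Cod J a)" for z
  proof -
    have "\<forall>j \<in> Obj J. \<exists>w. w \<in> ?w j \<and> z j = ?cls j w"
    proof
      fix j assume j: "j \<in> Obj J"
      have "z j \<in> carrier (?T j)" using z j by blast
      then show "\<exists>w. w \<in> ?w j \<and> z j = ?cls j w"
        by (rule semimodule_pair.carrier_tensorE[OF semimodule_pairI[OF sM sD[OF j]]]) blast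
    qed
    then obtain w where w: "\<And>j. j \<in> Obj J \<Longrightarrow> w j \<in> ?w j" "\<And>j. j \<in> Obj J \<Longrightarrow> z j = ?cls j (w j)"
      by metis
    \<comment> \<open>For every \<open>k\<close> the coefficients of the \<open>z j\<close> form a compatible family.\<close>
    have limit_coeff: "\<exists>!x. x \<in> carrier L \<and> (\<forall>j \<in> Obj J. \<pi> j x = coeff (D j) k (w j))"
      if k: "k \<in> K" for k
    proof (rule ex1)
      show "coeff (D j) k (w j) \<in> carrier (D j)" if "j \<in> Obj J" for j
        by (rule dual_basis_tensor.coeff_closed[OF ft[OF that] k w(1)[OF that]])
      fix a assume a: "a \<in> Arr J"
      note dc = arr[OF a]
      have "?cls (Cod J a) {# (m, \<phi> a n). (m, n) \<in># w (Dom J a) #} = ?cls (Cod J a) (w (Cod J a))"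
        using z\<phi> a w dc \<phi>_cls[OF a, of "w (Dom J a)"] by metis
      then have "coeff (D (Cod J a)) k {# (m, \<phi> a n). (m, n) \<in># w (Dom J a) #} =
          coeff (D (Cod J a)) k (w (Cod J a))"
        using dc w tensor_functor.map_words[OF f\<phi>[OF a]]
        by (intro dual_basis_tensor.coeff_cong[OF ft k]) blast+
      then show "\<phi> a (coeff (D (Dom J a)) k (w (Dom J a))) = coeff (D (Cod J a)) k (w (Cod J a))"
        using coeff_natural[OF sD sD h\<phi>[OF a] k] dc w(1) by auto
    qed
    then obtain l where l: "\<And>k. k \<in> K \<Longrightarrow> l k \<in> carrier L"
        "\<And>k j. \<lbrakk>k \<in> K; j \<in> Obj J\<rbrakk> \<Longrightarrow> \<pi> j (l k) = coeff (D j) k (w j)"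
      by metis
    define F where "F = (\<Union>j\<in>Obj J. support (w j))"
    have F: "finite F" "F \<subseteq> K"
      unfolding F_def using finJ w dual_basis_tensor.finite_support_word[OF ft] dual_basis_tensor.support_subset[OF ft]
      by (auto, blast)
    define u where "u = {# (b k, l k). k \<in># mset_set F #}"
    have u: "u \<in> L.T.words"
      unfolding u_def using F l basis_closed by (intro L.T.family_words) auto
    show ?thesis
    proof (rule ex1I[of _ "L.T.cls u"], intro conjI ballI)
      show "L.T.cls u \<in> carrier (tensor R M L)" by (rule L.T.cls_in_carrier[OF u])
      show "?\<pi> j (L.T.cls u) = z j" if j: "j \<in> Obj J" for j
      proof -
        have "{# (m, \<pi> j n). (m, n) \<in># u #} = {# (b k, coeff (D j) k (w j)). k \<in># mset_set F #}"
          unfolding u_def image_mset.compositionality o_def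
          using F l j by (intro image_mset_cong) auto
        moreover have "support (w j) \<subseteq> F" using j by (auto simp: F_def)
        ultimately show ?thesis
          using dual_basis_tensor.normal_form[OF ft[OF j] F _ w(1)[OF j]] \<pi>_cls[OF j u] w(2)[OF j] by simp
      qed
      fix x assume x: "x \<in> carrier (tensor R M L) \<and> (\<forall>j \<in> Obj J. ?\<pi> j x = z j)"
      then obtain v where v: "v \<in> L.T.words" "x = L.T.cls v" by (metis L.T.carrier_tensorE)
      have coeff_u: "\<pi> j (coeff L k y) = coeff (D j) k (w j)"
        if "y \<in> L.T.words" "?\<pi> j (L.T.cls y) = z j" "k \<in> K" "j \<in> Obj J" for y k j
      proof -
        have "?cls j {# (m, \<pi> j n). (m, n) \<in># y #} = ?cls j (w j)"
          using that \<pi>_cls w by metis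
        then have "coeff (D j) k {# (m, \<pi> j n). (m, n) \<in># y #} = coeff (D j) k (w j)"
          using that w tensor_functor.map_words[OF f\<pi>[OF that(4)]]
          by (intro dual_basis_tensor.coeff_cong[OF ft]) blast+
        then show ?thesis
          using coeff_natural[OF sL sD h\<pi> that(3)] that by auto
      qed
      show "x = L.T.cls u"
        unfolding v(2)
      proof (rule L.cls_eq_if_coeff_eq[OF v(1) u])
        fix k assume k: "k \<in> K"
        have "\<forall>j \<in> Obj J. \<pi> j (coeff L k v) = coeff (D j) k (w j)"
          using coeff_u[OF v(1) _ k] x v(2) by blast
        moreover have "\<forall>j \<in> Obj J. \<pi> j (coeff L k u) = coeff (D j) k (w j)"
          using coeff_u[OF u _ k] \<open>\<And>j. j \<in> Obj J \<Longrightarrow> ?\<pi> j (L.T.cls u) = z j\<close> by blast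
        ultimately show "coeff L k v = coeff L k u"
          using limit_coeff[OF k] L.coeff_closed[OF k v(1)] L.coeff_closed[OF k u] by blast
      qed
    qed
  qed
  ultimately show "is_limit_cone R J ?T ?\<phi> (tensor R M L) ?\<pi>"
    unfolding is_limit_cone_def by blast
qed

section \<open>Polynomials and the coordinate algebra of the general linear group\<close>

abbreviation "lookup \<equiv> Poly_Mapping.lookup"

abbreviation "keys \<equiv> Poly_Mapping.keys"

lemma poly_mapping_sum_single: "p = (\<Sum>m\<in>keys p. Poly_Mapping.single m (lookup p m))"
  by (rule poly_mapping_eqI) (auto simp: lookup_sum lookup_single when_def in_keys_iff)

lemma poly_mult_sum_single:
  fixes p q :: "'a::comm_monoid_add \<Rightarrow>\<^sub>0 'b::comm_semiring_1"
  shows "p * q = (\<Sum>m\<in>keys p. \<Sum>m'\<in>keys q. Poly_Mapping.single (m + m') (lookup p m * lookup q m'))"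
proof -
  have "p * q = (\<Sum>m\<in>keys p. Poly_Mapping.single m (lookup p m)) *
      (\<Sum>m\<in>keys q. Poly_Mapping.single m (lookup q m))"
    using poly_mapping_sum_single[of p] poly_mapping_sum_single[of q] by simp
  then show ?thesis by (simp add: sum_product mult_single)
qed

definition monomial_eval :: "('v \<Rightarrow> 'b::comm_semiring_1) \<Rightarrow> ('v \<Rightarrow>\<^sub>0 nat) \<Rightarrow> 'b" where
  "monomial_eval f m = (\<Prod>v\<in>keys m. f v ^ lookup m v)"

definition poly_eval :: "('v \<Rightarrow> 'b::comm_semiring_1) \<Rightarrow> (('v \<Rightarrow>\<^sub>0 nat) \<Rightarrow>\<^sub>0 nat) \<Rightarrow> 'b" where
  "poly_eval f p = (\<Sum>m\<in>keys p. of_nat (lookup p m) * monomial_eval f m)"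

lemma monomial_eval_superset:
  assumes "finite V" "keys m \<subseteq> V"
  shows "monomial_eval f m = (\<Prod>v\<in>V. f v ^ lookup m v)"
  unfolding monomial_eval_def using assms
  by (intro prod.mono_neutral_left) (auto simp: in_keys_iff)

lemma monomial_eval_add: "monomial_eval f (m + m') = monomial_eval f m * monomial_eval f m'"
proof -
  let ?V = "keys m \<union> keys m'"
  have "keys (m + m') \<subseteq> ?V" by (rule keys_add)
  then show ?thesis
    using monomial_eval_superset[of ?V m f] monomial_eval_superset[of ?V m' f]
      monomial_eval_superset[of ?V "m + m'" f]
    by (simp add: lookup_add power_add prod.distrib)
qed

lemma poly_eval_superset:
  assumes "finite S" "keys p \<subseteq> S"
  shows "poly_eval f p = (\<Sum>m\<in>S. of_nat (lookup p m) * monomial_eval f m)"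
  unfolding poly_eval_def using assms
  by (intro sum.mono_neutral_left) (auto simp: in_keys_iff)

lemma poly_eval_add: "poly_eval f (p + q) = poly_eval f p + poly_eval f q"
proof -
  let ?S = "keys p \<union> keys q"
  have "keys (p + q) \<subseteq> ?S" by (rule keys_add)
  then show ?thesis
    using poly_eval_superset[of ?S p f] poly_eval_superset[of ?S q f]
      poly_eval_superset[of ?S "p + q" f]
    by (simp add: lookup_add sum.distrib distrib_right)
qed

lemma poly_eval_zero: "poly_eval f 0 = 0"
  by (simp add: poly_eval_def)

lemma poly_eval_sum: "poly_eval f (sum p I) = (\<Sum>i\<in>I. poly_eval f (p i))"
  by (induction I rule: infinite_finite_induct) (auto simp: poly_eval_add poly_eval_zero)

lemma poly_eval_single: "poly_eval f (Poly_Mapping.single m c) = of_nat c * monomial_eval f m"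
  by (cases "c = 0") (auto simp: poly_eval_def)

lemma poly_eval_mult: "poly_eval f (p * q) = poly_eval f p * poly_eval f q"
  by (subst poly_mult_sum_single)
     (simp add: poly_eval_sum poly_eval_single poly_eval_def[of f p] poly_eval_def[of f q]
       sum_product monomial_eval_add algebra_simps)

lemma poly_eval_one: "poly_eval f 1 = 1"
  unfolding single_one[symmetric] poly_eval_single by (simp add: monomial_eval_def)

lemma poly_eval_var: "poly_eval f (poly_var v) = f v"
  by (simp add: poly_var_def poly_eval_single monomial_eval_def)

text \<open>A pair of inverse matrices in a commutative semiring is a point of the coordinate algebra.\<close>

lemma poly_eval_gl_cong:
  fixes f :: "'n::finite gl_var \<Rightarrow> 'b::comm_semiring_1"
  assumes "(p, q) \<in> gl_cong"
    and "\<And>i j. (\<Sum>k\<in>UNIV. f (X_entry i k) * f (Y_entry k j)) = (if i = j then 1 else 0)"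
    and "\<And>i j. (\<Sum>k\<in>UNIV. f (Y_entry i k) * f (X_entry k j)) = (if i = j then 1 else 0)"
  shows "poly_eval f p = poly_eval f q"
  using assms(1)
  by (induction rule: gl_cong.induct)
     (simp_all add: poly_eval_add poly_eval_mult poly_eval_sum poly_eval_var poly_eval_one
       poly_eval_zero assms)

abbreviation gl_class :: "'n::finite gl_poly \<Rightarrow> 'n gl_poly set" where
  "gl_class p \<equiv> gl_cong `` {p}"

lemma equiv_gl_cong: "equiv UNIV gl_cong"
  by (intro equivI refl_onI symI transI) (auto intro: gl_cong.intros)

lemma gl_class_eq_iff: "gl_class p = gl_class q \<longleftrightarrow> (p, q) \<in> gl_cong"
  using eq_equiv_class_iff[OF equiv_gl_cong] by simp

lemma carrier_gl_nat_algebra: "carrier gl_nat_algebra = range gl_class"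
  by (auto simp: gl_nat_algebra_def quotient_def)

lemma UN_gl_class:
  assumes "\<And>p'. (p, p') \<in> gl_cong \<Longrightarrow> F p' = F p"
  shows "(\<Union>p'\<in>gl_class p. F p') = F p"
  using assms gl_cong.refl[of p] by blast

lemma gl_class_simps:
  "gl_class p \<oplus>\<^bsub>gl_nat_algebra\<^esub> gl_class q = gl_class (p + q)"
  "gl_class p \<otimes>\<^bsub>gl_nat_algebra\<^esub> gl_class q = gl_class (p * q)"
  "\<zero>\<^bsub>gl_nat_algebra\<^esub> = gl_class 0"
  "\<one>\<^bsub>gl_nat_algebra\<^esub> = gl_class 1"
proof -
  have add: "(\<Union>q'\<in>gl_class q. gl_class (p' + q')) = gl_class (p' + q)"
    and mult: "(\<Union>q'\<in>gl_class q. gl_class (p' * q')) = gl_class (p' * q)" for p'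
    by (rule UN_gl_class, simp only: gl_class_eq_iff,
        blast intro: gl_cong.add gl_cong.mult gl_cong.refl gl_cong.sym)+
  have "(\<Union>p'\<in>gl_class p. gl_class (p' + q)) = gl_class (p + q)"
    "(\<Union>p'\<in>gl_class p. gl_class (p' * q)) = gl_class (p * q)"
    by (rule UN_gl_class, simp only: gl_class_eq_iff,
        blast intro: gl_cong.add gl_cong.mult gl_cong.refl gl_cong.sym)+
  then show "gl_class p \<oplus>\<^bsub>gl_nat_algebra\<^esub> gl_class q = gl_class (p + q)"
    "gl_class p \<otimes>\<^bsub>gl_nat_algebra\<^esub> gl_class q = gl_class (p * q)"
    by (simp_all only: gl_nat_algebra_def ring_record_simps monoid.select_convs add mult)
qed (simp_all add: gl_nat_algebra_def)

lemma csemiring_gl_nat_algebra: "csemiring (gl_nat_algebra :: 'n::finite gl_poly set ring)"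
proof -
  let ?A = "gl_nat_algebra :: 'n gl_poly set ring"
  have "abelian_monoid ?A"
    by (rule abelian_monoidI) (auto simp: carrier_gl_nat_algebra gl_class_simps ac_simps)
  moreover have "comm_monoid ?A"
    by (rule comm_monoidI) (auto simp: carrier_gl_nat_algebra gl_class_simps ac_simps)
  ultimately show ?thesis
    by (intro csemiring.intro semiring.intro semiring_axioms.intro)
       (auto simp: carrier_gl_nat_algebra gl_class_simps algebra_simps comm_monoid.axioms)
qed

locale gl_over = R: csemiring R for R :: "'r ring" and n :: "'n::finite itself"

sublocale gl_over \<subseteq> csemiring_pair R "gl_nat_algebra :: 'n::finite gl_poly set ring"
  by (intro csemiring_pair.intro csemiring_gl_nat_algebra R.csemiring_axioms)

context gl_over
begin

abbreviation "B \<equiv> gl_algebra n R"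

text \<open>The image in \<open>R \<otimes> A\<^sub>n\<close> of a polynomial with natural coefficients.\<close>

definition poly_elem :: "'n gl_poly \<Rightarrow> ('r \<times> 'n gl_poly set) multiset set" where
  "poly_elem p = cls {#(\<one>\<^bsub>R\<^esub>, gl_class p)#}"

lemma poly_word: "{#(\<one>\<^bsub>R\<^esub>, gl_class p)#} \<in> T.words"
  by (simp add: carrier_gl_nat_algebra)

lemma gl_algebra_is_algebra: "is_algebra R B"
  unfolding gl_algebra_def by (rule base_change_is_algebra)

lemma poly_elem_closed [simp]: "poly_elem p \<in> carrier B"
  unfolding gl_algebra_def poly_elem_def base_change_simps by (rule T.cls_in_carrier[OF poly_word])

lemma poly_elem_cong: "(p, q) \<in> gl_cong \<Longrightarrow> poly_elem p = poly_elem q"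
  by (simp add: poly_elem_def gl_class_eq_iff[symmetric])

lemma poly_elem_add: "poly_elem (p + q) = poly_elem p \<oplus>\<^bsub>B\<^esub> poly_elem q"
  unfolding poly_elem_def gl_algebra_def base_change_add[OF poly_word poly_word]
  using T.add_cls_right[of "\<one>\<^bsub>R\<^esub>" "gl_class p" "gl_class q"]
  by (simp add: gl_class_simps carrier_gl_nat_algebra add_mset_commute)

lemma poly_elem_mult: "poly_elem (p * q) = poly_elem p \<otimes>\<^bsub>B\<^esub> poly_elem q"
  unfolding poly_elem_def gl_algebra_def base_change_mult[OF poly_word poly_word]
  by (simp add: gl_class_simps)

lemma poly_elem_one: "poly_elem 1 = \<one>\<^bsub>B\<^esub>"
  by (simp add: poly_elem_def gl_algebra_def base_change_simps gl_class_simps)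

lemma poly_elem_zero: "poly_elem 0 = \<zero>\<^bsub>B\<^esub>"
  unfolding poly_elem_def gl_algebra_def base_change_simps
  using tensor_rel.zero_right[where R = nat_semiring and M = "nat_module R" and
      N = "nat_module gl_nat_algebra" and m = "\<one>\<^bsub>R\<^esub>"]
  by (intro T.cls_eqI) (simp add: gl_class_simps)

end

section \<open>Flat semimodules are negative free\<close>

text \<open>The shape of an equalizer: \<open>0\<close> and \<open>1\<close> are the objects and their identities, \<open>2\<close> and \<open>3\<close> are
  the parallel arrows \<open>0 \<rightarrow> 1\<close>.\<close>

definition parallel_pair :: category where
  "parallel_pair = \<lparr>Obj = {0, 1}, Arr = {0, 1, 2, 3}, Dom = (\<lambda>a. if a = 1 then 1 else 0),
     Cod = (\<lambda>a. if a = 0 then 0 else 1), Ident = id, Comp = (\<lambda>b a. if a \<le> 1 then b else a)\<rparr>"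

lemma finite_parallel_pair: "finite_category parallel_pair"
  by (auto simp: parallel_pair_def finite_category_def)

text \<open>Flatness is tested on modules with carriers in a given type \<open>'u\<close>. For this purpose the module
  \<open>R\<^sup>2\<close> is transported into \<open>'u\<close> along an injection \<open>\<kappa>\<close>.\<close>

locale square_copy = R: csemiring R for R :: "'r ring" +
  fixes \<kappa> :: "'r \<times> 'r \<Rightarrow> 'u"
  assumes inj: "inj_on \<kappa> (carrier R \<times> carrier R)"
begin

definition coord :: "'u \<Rightarrow> 'r \<times> 'r" where
  "coord = the_inv_into (carrier R \<times> carrier R) \<kappa>"

lemma coord [simp]: "\<lbrakk>a \<in> carrier R; b \<in> carrier R\<rbrakk> \<Longrightarrow> coord (\<kappa> (a, b)) = (a, b)"
  unfolding coord_def by (rule the_inv_into_f_f[OF inj]) simp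

definition Sq :: "('r, 'u) module" where
  "Sq = \<lparr>carrier = \<kappa> ` (carrier R \<times> carrier R), monoid.mult = undefined, one = undefined,
     zero = \<kappa> (\<zero>\<^bsub>R\<^esub>, \<zero>\<^bsub>R\<^esub>),
     add = (\<lambda>x y. \<kappa> (fst (coord x) \<oplus>\<^bsub>R\<^esub> fst (coord y), snd (coord x) \<oplus>\<^bsub>R\<^esub> snd (coord y))),
     smult = (\<lambda>r x. \<kappa> (r \<otimes>\<^bsub>R\<^esub> fst (coord x), r \<otimes>\<^bsub>R\<^esub> snd (coord x)))\<rparr>"

lemma Sq_simps:
  "carrier Sq = \<kappa> ` (carrier R \<times> carrier R)"
  "\<zero>\<^bsub>Sq\<^esub> = \<kappa> (\<zero>\<^bsub>R\<^esub>, \<zero>\<^bsub>R\<^esub>)"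
  "x \<oplus>\<^bsub>Sq\<^esub> y = \<kappa> (fst (coord x) \<oplus>\<^bsub>R\<^esub> fst (coord y), snd (coord x) \<oplus>\<^bsub>R\<^esub> snd (coord y))"
  "r \<odot>\<^bsub>Sq\<^esub> x = \<kappa> (r \<otimes>\<^bsub>R\<^esub> fst (coord x), r \<otimes>\<^bsub>R\<^esub> snd (coord x))"
  by (simp_all add: Sq_def)

lemma semimodule_Sq: "semimodule R Sq"
proof -
  have "abelian_monoid Sq"
    by (rule abelian_monoidI) (auto simp: Sq_simps R.a_ac)
  then show ?thesis
    by (intro semimodule.intro semimodule_axioms.intro R.csemiring_axioms)
       (auto simp: Sq_simps R.l_distr R.r_distr R.m_assoc)
qed

text \<open>The zero submodule, which is the kernel of addition when \<open>R\<close> is negative free.\<close>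

definition Z :: "('r, 'u) module" where
  "Z = Sq\<lparr>carrier := {\<kappa> (\<zero>\<^bsub>R\<^esub>, \<zero>\<^bsub>R\<^esub>)}\<rparr>"

lemma Z_simps:
  "carrier Z = {\<kappa> (\<zero>\<^bsub>R\<^esub>, \<zero>\<^bsub>R\<^esub>)}" "\<zero>\<^bsub>Z\<^esub> = \<zero>\<^bsub>Sq\<^esub>" "x \<oplus>\<^bsub>Z\<^esub> y = x \<oplus>\<^bsub>Sq\<^esub> y" "r \<odot>\<^bsub>Z\<^esub> x = r \<odot>\<^bsub>Sq\<^esub> x"
  by (simp_all add: Z_def Sq_def)

lemma semimodule_Z: "semimodule R Z"
proof -
  have "abelian_monoid Z"
    by (rule abelian_monoidI) (auto simp: Z_simps Sq_simps)
  then show ?thesis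
    by (intro semimodule.intro semimodule_axioms.intro R.csemiring_axioms)
       (auto simp: Z_simps Sq_simps)
qed

text \<open>The two parallel arrows are addition and zero. Both stay inside \<open>R\<^sup>2\<close>, with \<open>R\<close> embedded as
  the first summand, so that a single module serves for both objects.\<close>

definition arrow :: "nat \<Rightarrow> 'u \<Rightarrow> 'u" where
  "arrow a x =
    (if a = 2 then \<kappa> (fst (coord x) \<oplus>\<^bsub>R\<^esub> snd (coord x), \<zero>\<^bsub>R\<^esub>)
     else if a = 3 then \<kappa> (\<zero>\<^bsub>R\<^esub>, \<zero>\<^bsub>R\<^esub>) else x)"

lemma arrow_hom: "arrow a \<in> semimodule_hom R Sq Sq"
  by (auto simp: semimodule_hom_def arrow_def Sq_simps R.r_distr R.a_ac)

lemma diagram_parallel_pair: "is_diagram R parallel_pair (\<lambda>_. Sq) arrow"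
  by (auto simp: is_diagram_def semimodule_Sq arrow_hom) (auto simp: parallel_pair_def arrow_def)

lemma limit_parallel_pair:
  assumes "negative_free R"
  shows "is_limit_cone R parallel_pair (\<lambda>_. Sq) arrow Z (\<lambda>_ x. x)"
  unfolding is_limit_cone_def
proof (intro conjI allI impI)
  show "is_cone R parallel_pair (\<lambda>_. Sq) arrow Z (\<lambda>_ x. x)"
    by (auto simp: is_cone_def semimodule_Z semimodule_hom_def Z_simps arrow_def Sq_simps)
  fix z :: "nat \<Rightarrow> 'u"
  assume z: "(\<forall>j\<in>Obj parallel_pair. z j \<in> carrier Sq) \<and>
    (\<forall>a\<in>Arr parallel_pair. arrow a (z (Dom parallel_pair a)) = z (Cod parallel_pair a))"
  then obtain a b where ab: "a \<in> carrier R" "b \<in> carrier R" "z 0 = \<kappa> (a, b)"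
    by (auto simp: parallel_pair_def Sq_simps)
  have z1: "z 1 = \<kappa> (\<zero>\<^bsub>R\<^esub>, \<zero>\<^bsub>R\<^esub>)" and "z 1 = \<kappa> (a \<oplus>\<^bsub>R\<^esub> b, \<zero>\<^bsub>R\<^esub>)"
    using z ab by (auto simp: parallel_pair_def arrow_def)
  then have "coord (\<kappa> (a \<oplus>\<^bsub>R\<^esub> b, \<zero>\<^bsub>R\<^esub>)) = coord (\<kappa> (\<zero>\<^bsub>R\<^esub>, \<zero>\<^bsub>R\<^esub>))" by simp
  then have "a \<oplus>\<^bsub>R\<^esub> b = \<zero>\<^bsub>R\<^esub>" using ab by simp
  then have "a = \<zero>\<^bsub>R\<^esub> \<and> b = \<zero>\<^bsub>R\<^esub>" using assms ab unfolding negative_free_def by blast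
  then show "\<exists>!x. x \<in> carrier Z \<and> (\<forall>j\<in>Obj parallel_pair. x = z j)"
    using ab z1 by (auto simp: Z_simps parallel_pair_def)
qed

text \<open>If \<open>m + m' = 0\<close>, then \<open>m \<otimes> (1, 0) + m' \<otimes> (0, 1)\<close> lies in the kernel of addition on
  \<open>M \<otimes> R\<^sup>2\<close>, which is zero when \<open>M\<close> is flat. Applying the pairing \<open>m \<otimes> (r, s) \<mapsto> r m\<close> gives \<open>m = 0\<close>.\<close>

theorem flat_imp_negative_free:
  assumes nf: "negative_free R" and M: "semimodule R M" and flat: "flat TYPE('u) R M"
    and m: "m \<in> carrier M" "m' \<in> carrier M" and sum: "m \<oplus>\<^bsub>M\<^esub> m' = \<zero>\<^bsub>M\<^esub>"
  shows "m = \<zero>\<^bsub>M\<^esub>"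
proof -
  interpret S: semimodule_pair R M Sq by (intro semimodule_pairI M semimodule_Sq)
  interpret Z: semimodule_pair R M Z by (intro semimodule_pairI M semimodule_Z)
  let ?J = parallel_pair
  define e where "e = \<kappa> (\<one>\<^bsub>R\<^esub>, \<zero>\<^bsub>R\<^esub>)"
  define e' where "e' = \<kappa> (\<zero>\<^bsub>R\<^esub>, \<one>\<^bsub>R\<^esub>)"
  have e: "e \<in> carrier Sq" "e' \<in> carrier Sq" by (auto simp: e_def e'_def Sq_simps)
  define u where "u = {#(m, e), (m', e')#}"
  have u: "u \<in> S.words" using m e by (simp add: u_def)
  define z where "z j = (if j = 0 then S.cls u else S.cls {#})" for j :: nat
  have arrow_f: "tensor_functor R M Sq Sq (arrow a)" for a
    by (intro tensor_functorI M semimodule_Sq arrow_hom)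
  have map_cls: "tensor_map R M Sq (arrow a) (S.cls w) = S.cls {# (m, arrow a x). (m, x) \<in># w #}"
    if "w \<in> S.words" for a w
    by (rule tensor_functor.tensor_map_cls[OF arrow_f that])
  have zero: "S.cls w = S.cls {#}" if "set_mset w \<subseteq> carrier M \<times> {\<kappa> (\<zero>\<^bsub>R\<^esub>, \<zero>\<^bsub>R\<^esub>)}" for w
    using that
  proof (induction w)
    case (add p w)
    obtain m where m: "p = (m, \<zero>\<^bsub>Sq\<^esub>)" "m \<in> carrier M"
      using add.prems by (cases p) (auto simp: Sq_simps)
    have w: "w \<in> S.words" "p \<in> carrier M \<times> carrier Sq"
      using add.prems by (auto simp: Sq_simps)
    have "S.cls {#p#} = S.cls {#}"
      unfolding m(1) by (intro S.cls_eqI tensor_rel.zero_right m(2))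
    with w have "S.cls ({#p#} + w) = S.cls ({#} + {#})"
      using add by (intro S.cls_plus_cong) auto
    then show ?case by simp
  qed simp
  have arrow2: "S.cls {# (m, arrow 2 x). (m, x) \<in># u #} = S.cls {#}"
  proof -
    have "S.cls {# (m, arrow 2 x). (m, x) \<in># u #} = S.cls {#(m, e), (m', e)#}"
      by (simp add: u_def arrow_def e_def e'_def)
    also have "\<dots> = S.cls {#(m \<oplus>\<^bsub>M\<^esub> m', e)#}"
      using m e by (simp add: S.add_cls_left)
    also have "\<dots> = S.cls {#}"
      unfolding sum by (intro S.cls_eqI tensor_rel.zero_left e)
    finally show ?thesis .
  qed
  have arrow3: "S.cls {# (m, arrow 3 x). (m, x) \<in># u #} = S.cls {#}"
    using m by (intro zero) (auto simp: u_def arrow_def)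
  have id: "{# (m, arrow a x). (m, x) \<in># w #} = w" if "a \<noteq> 2" "a \<noteq> 3" for a w
    using that by (simp add: arrow_def)
  have lim: "is_limit_cone R ?J (\<lambda>_. tensor R M Sq) (\<lambda>a. tensor_map R M Sq (arrow a))
      (tensor R M Z) (\<lambda>_. tensor_map R M Sq (\<lambda>x. x))"
    using flat finite_parallel_pair diagram_parallel_pair limit_parallel_pair[OF nf]
    unfolding flat_def by blast
  have z_closed: "\<forall>j\<in>Obj ?J. z j \<in> carrier (tensor R M Sq)"
    using S.cls_in_carrier[OF u] S.cls_in_carrier[of "{#}"] by (simp add: z_def)
  have z_comp: "\<forall>a\<in>Arr ?J. tensor_map R M Sq (arrow a) (z (Dom ?J a)) = z (Cod ?J a)"
  proof
    fix a assume "a \<in> Arr ?J"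
    then have "a \<in> {0, 1, 2, 3}" by (simp add: parallel_pair_def)
    then show "tensor_map R M Sq (arrow a) (z (Dom ?J a)) = z (Cod ?J a)"
      using map_cls[OF u] map_cls[of "{#}"] arrow2 arrow3 id[of _ u]
      by (auto simp: z_def parallel_pair_def)
  qed
  have "0 \<in> Obj ?J" by (simp add: parallel_pair_def)
  with lim[unfolded is_limit_cone_def, THEN conjunct2, THEN spec, THEN mp, OF conjI[OF z_closed z_comp]]
  obtain x where x: "x \<in> carrier (tensor R M Z)" "tensor_map R M Sq (\<lambda>x. x) x = z 0"
    by blast
  obtain w where w: "w \<in> Z.words" "x = Z.cls w" using Z.carrier_tensorE[OF x(1)] .
  have incl: "tensor_functor R M Z Sq (\<lambda>x. x)"
    by (intro tensor_functorI M semimodule_Z semimodule_Sq)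
       (auto simp: semimodule_hom_def Z_simps Sq_simps)
  have "S.cls u = S.cls w"
    using tensor_functor.tensor_map_cls[OF incl w(1)] x(2) w(2) by (simp add: z_def)
  also have "\<dots> = S.cls {#}"
    using w(1) by (intro zero) (simp add: Z_simps)
  finally have rel: "(u, {#}) \<in> tensor_rel R M Sq"
    using S.cls_eq_iff[OF u, of "{#}"] by simp
  have "msum M (\<lambda>(m, x). fst (coord x) \<odot>\<^bsub>M\<^esub> m) u = msum M (\<lambda>(m, x). fst (coord x) \<odot>\<^bsub>M\<^esub> m) {#}"
    by (rule S.msum_tensor_rel[OF _ _ _ _ _ _ _ rel])
       (auto simp: Sq_simps S.M.smult_closed S.M.smult_add_left S.M.smult_add_right
         S.M.smult_zero_left S.M.smult_zero_right S.M.smult_assoc[symmetric] R.m_comm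
         intro: S.M.M.abelian_monoid_axioms)
  then show ?thesis
    using m by (simp add: u_def S.M.msum_add_mset e_def e'_def S.M.smult_one S.M.smult_zero_left)
qed

end


section \<open>The general linear group over a cancellative semiring\<close>

context csemiring
begin

text \<open>If two multiples of \<open>1\<close> agree, cancelling the smaller one writes \<open>0\<close> as a sum with the summand
  \<open>1\<close>. Infinity of \<open>R\<close> is what gives room for \<open>R\<^sup>2\<close> in every type that contains a copy of \<open>R\<close>.\<close>

lemma cancellative_negative_free_infinite:
  assumes nz: "carrier R \<noteq> {\<zero>}" and canc: "additively_cancellative R" and nf: "negative_free R"
  shows "infinite (carrier R)"
proof -
  have one: "\<one> \<noteq> \<zero>"
  proof
    assume "\<one> = \<zero>"
    then have "x = \<zero>" if "x \<in> carrier R" for x using that l_one[of x] l_null[of x] by simp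
    then show False using nz by auto
  qed
  have "inj (\<lambda>k::nat. [k] \<cdot> \<one>)"
  proof (rule linorder_injI)
    fix k l :: nat assume "k < l"
    then obtain d where l: "l = k + Suc d" using less_iff_Suc_add by auto
    show "[k] \<cdot> \<one> \<noteq> [l] \<cdot> \<one>"
    proof
      assume "[k] \<cdot> \<one> = [l] \<cdot> \<one>"
      moreover have "[Suc d] \<cdot> \<one> \<oplus> [k] \<cdot> \<one> = [l] \<cdot> \<one>"
        by (subst add.nat_pow_mult) (simp_all only: one_closed l add.commute)
      ultimately have "\<zero> \<oplus> [k] \<cdot> \<one> = [Suc d] \<cdot> \<one> \<oplus> [k] \<cdot> \<one>"
        by simp
      then have "\<zero> = [Suc d] \<cdot> \<one>"
        using canc unfolding additively_cancellative_def by (meson add.nat_pow_closed one_closed zero_closed)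
      then have "[d] \<cdot> \<one> \<oplus> \<one> = \<zero>" by simp
      then show False
        using nf one unfolding negative_free_def by (meson add.nat_pow_closed one_closed)
    qed
  qed
  then have "infinite (range (\<lambda>k::nat. [k] \<cdot> \<one>))"
    using finite_imageD infinite_UNIV_nat by blast
  then show ?thesis
    using finite_subset[of "range (\<lambda>k::nat. [k] \<cdot> \<one>)" "carrier R"] by auto
qed

end

lemma inj_on_Times_if_infinite:
  fixes \<iota> :: "'a \<Rightarrow> 'u"
  assumes "infinite A" and \<iota>: "inj_on \<iota> A"
  shows "\<exists>\<kappa> :: 'a \<times> 'a \<Rightarrow> 'u. inj_on \<kappa> (A \<times> A)"
proof -
  obtain h where h: "bij_betw h (A \<times> A) A"
    using card_of_Times_same_infinite[OF assms(1)] card_of_ordIso by blast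
  have "inj_on (\<iota> \<circ> h) (A \<times> A)"
    using h \<iota> by (auto intro!: comp_inj_on simp: bij_betw_def)
  then show ?thesis by blast
qed

text \<open>Evaluation at an elementary matrix. Its inverse has a negative entry, so it is not a point over
  \<open>R\<close> itself, but over the ring of differences of \<open>R\<close>.\<close>

locale elementary_point = gl_over R n for R :: "'r ring" and n :: "'n::finite itself" +
  fixes a b :: 'n
  assumes ab: "a \<noteq> b" and canc: "additively_cancellative R"
begin

fun entry :: "'n gl_var \<Rightarrow> int" where
  "entry (X_entry i j) = (if i = j then 1 else 0) + (if i = a \<and> j = b then 1 else 0)"
| "entry (Y_entry i j) = (if i = j then 1 else 0) - (if i = a \<and> j = b then 1 else 0)"

lemma entry_inverse:
  "(\<Sum>k\<in>UNIV. entry (X_entry i k) * entry (Y_entry k j)) = (if i = j then 1 else 0)"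
  "(\<Sum>k\<in>UNIV. entry (Y_entry i k) * entry (X_entry k j)) = (if i = j then 1 else 0)"
proof -
  have 1: "(\<Sum>k\<in>UNIV. (if i = k then 1 else 0) * f k) = (f i :: int)" for f :: "'n \<Rightarrow> int"
    by (simp add: if_distrib[of "\<lambda>x. x * _"] cong: if_cong)
  have 2: "(\<Sum>k\<in>UNIV. (if i = a \<and> k = b then 1 else 0) * f k) = (if i = a then f b else 0 :: int)"
    for f :: "'n \<Rightarrow> int"
    by (simp add: if_distrib[of "\<lambda>x. x * _"] cong: if_cong)
  show "(\<Sum>k\<in>UNIV. entry (X_entry i k) * entry (Y_entry k j)) = (if i = j then 1 else 0)"
    "(\<Sum>k\<in>UNIV. entry (Y_entry i k) * entry (X_entry k j)) = (if i = j then 1 else 0)"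
    using ab by (simp_all only: entry.simps distrib_right left_diff_distrib sum.distrib sum_subtractf 1 2) auto
qed

definition val :: "'n gl_poly set \<Rightarrow> int" where
  "val c = poly_eval entry (SOME p. p \<in> c)"

lemma val_class: "val (gl_class p) = poly_eval entry p"
proof -
  have "(SOME q. q \<in> gl_class p) \<in> gl_class p"
    by (rule someI[of _ p]) (simp add: gl_cong.refl)
  then show ?thesis
    unfolding val_def using poly_eval_gl_cong[of p _ entry] entry_inverse by simp
qed

lemma val_add:
  "\<lbrakk>c \<in> carrier gl_nat_algebra; d \<in> carrier gl_nat_algebra\<rbrakk> \<Longrightarrow>
    val (c \<oplus>\<^bsub>gl_nat_algebra\<^esub> d) = val c + val d"
  by (auto simp: carrier_gl_nat_algebra gl_class_simps val_class poly_eval_add)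

lemma val_zero: "val \<zero>\<^bsub>gl_nat_algebra\<^esub> = 0"
  by (simp add: gl_class_simps val_class poly_eval_zero)

lemma val_multiple:
  "c \<in> carrier gl_nat_algebra \<Longrightarrow> val ([k] \<cdot>\<^bsub>gl_nat_algebra\<^esub> c) = int k * val c"
  by (induction k) (simp_all add: val_zero val_add algebra_simps)

lemmas val_simps = val_add val_zero val_multiple

text \<open>An element of \<open>R \<otimes> A\<^sub>n\<close> is mapped to the formal difference of the following two elements of
  \<open>R\<close>; the ring of differences itself is not constructed.\<close>

definition pos :: "('r \<times> 'n gl_poly set) multiset \<Rightarrow> 'r" where
  "pos = msum R (\<lambda>(r, c). [nat (val c)] \<cdot>\<^bsub>R\<^esub> r)"

definition neg :: "('r \<times> 'n gl_poly set) multiset \<Rightarrow> 'r" where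
  "neg = msum R (\<lambda>(r, c). [nat (- val c)] \<cdot>\<^bsub>R\<^esub> r)"

lemma pos_neg_closed: "w \<in> T.words \<Longrightarrow> pos w \<in> carrier R" "w \<in> T.words \<Longrightarrow> neg w \<in> carrier R"
  unfolding pos_def neg_def by (intro R.msum_closed; auto)+

lemma pos_neg_plus:
  assumes "v \<in> T.words" "w \<in> T.words"
  shows "pos (v + w) = pos v \<oplus>\<^bsub>R\<^esub> pos w" "neg (v + w) = neg v \<oplus>\<^bsub>R\<^esub> neg w"
  unfolding pos_def neg_def by (rule R.msum_union; use assms in auto)+

lemma pos_neg_simps:
  "pos {#} = \<zero>\<^bsub>R\<^esub>" "neg {#} = \<zero>\<^bsub>R\<^esub>"
  "r \<in> carrier R \<Longrightarrow> pos {#(r, c)#} = [nat (val c)] \<cdot>\<^bsub>R\<^esub> r"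
  "r \<in> carrier R \<Longrightarrow> neg {#(r, c)#} = [nat (- val c)] \<cdot>\<^bsub>R\<^esub> r"
  "\<lbrakk>r \<in> carrier R; s \<in> carrier R\<rbrakk> \<Longrightarrow>
    pos {#(r, c), (s, d)#} = [nat (val c)] \<cdot>\<^bsub>R\<^esub> r \<oplus>\<^bsub>R\<^esub> [nat (val d)] \<cdot>\<^bsub>R\<^esub> s"
  "\<lbrakk>r \<in> carrier R; s \<in> carrier R\<rbrakk> \<Longrightarrow>
    neg {#(r, c), (s, d)#} = [nat (- val c)] \<cdot>\<^bsub>R\<^esub> r \<oplus>\<^bsub>R\<^esub> [nat (- val d)] \<cdot>\<^bsub>R\<^esub> s"
  by (simp_all add: pos_def neg_def R.msum_add_mset)

lemma cancel:
  "\<lbrakk>x \<in> carrier R; y \<in> carrier R; z \<in> carrier R; x \<oplus>\<^bsub>R\<^esub> z = y \<oplus>\<^bsub>R\<^esub> z\<rbrakk> \<Longrightarrow> x = y"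
  using canc by (auto simp: additively_cancellative_def)

text \<open>This is equality of the formal differences \<open>pos - neg\<close>, written without subtraction. Its
  transitivity is where cancellation enters.\<close>

lemma pos_neg_rel:
  assumes "(v, w) \<in> tensor_rel nat_semiring (nat_module R) (nat_module gl_nat_algebra)"
  shows "pos v \<oplus>\<^bsub>R\<^esub> neg w = pos w \<oplus>\<^bsub>R\<^esub> neg v"
  using assms
proof (induction rule: tensor_rel.induct)
  case (trans u v w)
  note words = T.tensor_rel_words[OF trans(1)] T.tensor_rel_words(2)[OF trans(2)]
  note cl = pos_neg_closed[OF words(1)] pos_neg_closed[OF words(2)] pos_neg_closed[OF words(3)]
  have "(pos u \<oplus>\<^bsub>R\<^esub> neg w) \<oplus>\<^bsub>R\<^esub> (pos v \<oplus>\<^bsub>R\<^esub> neg v) = (pos u \<oplus>\<^bsub>R\<^esub> neg v) \<oplus>\<^bsub>R\<^esub> (pos v \<oplus>\<^bsub>R\<^esub> neg w)"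
    using cl by (simp add: R.a_ac)
  also have "\<dots> = (pos w \<oplus>\<^bsub>R\<^esub> neg u) \<oplus>\<^bsub>R\<^esub> (pos v \<oplus>\<^bsub>R\<^esub> neg v)"
    unfolding trans.IH using cl by (simp add: R.a_ac)
  finally show ?case using cl by (elim cancel[rotated 3]) auto
next
  case (plus v w v' w')
  note words = T.tensor_rel_words[OF plus(1)] T.tensor_rel_words[OF plus(2)]
  note cl = pos_neg_closed[OF words(1)] pos_neg_closed[OF words(2)]
    pos_neg_closed[OF words(3)] pos_neg_closed[OF words(4)]
  have "pos (v + v') \<oplus>\<^bsub>R\<^esub> neg (w + w') = (pos v \<oplus>\<^bsub>R\<^esub> neg w) \<oplus>\<^bsub>R\<^esub> (pos v' \<oplus>\<^bsub>R\<^esub> neg w')"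
    using cl words by (simp add: pos_neg_plus R.a_ac)
  also have "\<dots> = pos (w + w') \<oplus>\<^bsub>R\<^esub> neg (v + v')"
    unfolding plus.IH using cl words by (simp add: pos_neg_plus R.a_ac)
  finally show ?case .
next
  case (add_left m m' c)
  then show ?case by (simp add: pos_neg_simps R.add.nat_pow_distrib R.a_ac)
next
  case (add_right m c d)
  have "nat (val c + val d) + (nat (- val c) + nat (- val d)) =
      nat (val c) + nat (val d) + nat (- (val c + val d))" by linarith
  then show ?case
    using add_right by (simp add: pos_neg_simps val_simps R.add.nat_pow_mult)
next
  case (balanced k m c)
  have "nat (- (int k * val c)) = k * nat (- val c)" "nat (int k * val c) = k * nat (val c)"
    by (simp_all add: nat_mult_distrib flip: mult_minus_right)
  with balanced show ?case
    by (simp add: pos_neg_simps val_simps R.add.nat_pow_pow R.a_comm)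
next
  case (refl w)
  then show ?case by simp
qed (simp_all add: pos_neg_simps val_simps)

text \<open>The product \<open>x\<^bsub>ab\<^esub> y\<^bsub>bb\<^esub>\<close> takes the value \<open>1\<close> at the elementary matrix.\<close>

lemma product_nonzero:
  assumes "\<one>\<^bsub>R\<^esub> \<noteq> \<zero>\<^bsub>R\<^esub>"
  shows "poly_elem (poly_var (X_entry a b) * poly_var (Y_entry b b)) \<noteq> \<zero>\<^bsub>B\<^esub>"
proof
  let ?p = "poly_var (X_entry a b) * poly_var (Y_entry b b) :: 'n gl_poly"
  assume "poly_elem ?p = \<zero>\<^bsub>B\<^esub>"
  then have "cls {#(\<one>\<^bsub>R\<^esub>, gl_class ?p)#} = cls {#}"
    by (simp add: poly_elem_def gl_algebra_def base_change_simps)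
  then have "({#(\<one>\<^bsub>R\<^esub>, gl_class ?p)#}, {#}) \<in> tensor_rel nat_semiring (nat_module R) (nat_module gl_nat_algebra)"
    using T.cls_eq_iff[OF poly_word, of "{#}"] by simp
  from pos_neg_rel[OF this] have "\<one>\<^bsub>R\<^esub> = \<zero>\<^bsub>R\<^esub>"
    using ab by (simp add: pos_neg_simps val_class poly_eval_mult poly_eval_var)
  with assms show False by simp
qed

text \<open>On the other hand it is a summand of an off-diagonal entry of a unit matrix.\<close>

lemma product_has_negative:
  "\<exists>q. poly_elem (poly_var (X_entry a b) * poly_var (Y_entry b b)) \<oplus>\<^bsub>B\<^esub> poly_elem q = \<zero>\<^bsub>B\<^esub>"
proof -
  let ?f = "\<lambda>k. poly_var (X_entry a k) * poly_var (Y_entry k b) :: 'n gl_poly"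
  have "?f b + sum ?f (UNIV - {b}) = sum ?f UNIV"
    by (simp add: sum.remove[of UNIV b ?f])
  then have "(?f b + sum ?f (UNIV - {b}), 0) \<in> gl_cong"
    using gl_cong.XY[of a b] ab by simp
  from poly_elem_cong[OF this] show ?thesis
    unfolding poly_elem_add poly_elem_zero by blast
qed

end

theorem GL_not_flat:
  fixes R :: "'r ring" and \<iota> :: "'r \<Rightarrow> 'u"
  assumes n: "card (UNIV :: 'n::finite set) \<ge> 2" and R: "csemiring R" and nz: "carrier R \<noteq> {\<zero>\<^bsub>R\<^esub>}"
    and canc: "additively_cancellative R" and nf: "negative_free R" and \<iota>: "inj_on \<iota> (carrier R)"
  shows "\<not> GL_flat TYPE('u) TYPE('n) R"
proof
  interpret R: csemiring R by (rule R)
  assume flat: "GL_flat TYPE('u) TYPE('n) R"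
  obtain a b :: 'n where ab: "a \<noteq> b"
    using n card_le_Suc0_iff_eq[of "UNIV :: 'n set"] by force
  interpret elementary_point R "TYPE('n)" a b
    by unfold_locales (rule ab, rule canc)
  have inf: "infinite (carrier R)"
    by (rule R.cancellative_negative_free_infinite[OF nz canc nf])
  have one: "\<one>\<^bsub>R\<^esub> \<noteq> \<zero>\<^bsub>R\<^esub>"
  proof
    assume "\<one>\<^bsub>R\<^esub> = \<zero>\<^bsub>R\<^esub>"
    then have "x = \<zero>\<^bsub>R\<^esub>" if "x \<in> carrier R" for x using that R.l_one[of x] R.l_null[of x] by simp
    then show False using nz by auto
  qed
  obtain \<kappa> :: "'r \<times> 'r \<Rightarrow> 'u" where \<kappa>: "inj_on \<kappa> (carrier R \<times> carrier R)"
    using inj_on_Times_if_infinite[OF inf \<iota>] by blast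
  interpret square_copy R \<kappa> by unfold_locales (rule \<kappa>)
  obtain q where q: "poly_elem (poly_var (X_entry a b) * poly_var (Y_entry b b)) \<oplus>\<^bsub>B\<^esub> poly_elem q = \<zero>\<^bsub>B\<^esub>"
    using product_has_negative by blast
  have M: "semimodule R (alg_module B)"
    by (rule semimodule_alg_module[OF R gl_algebra_is_algebra])
  have "poly_elem (poly_var (X_entry a b) * poly_var (Y_entry b b)) = \<zero>\<^bsub>alg_module B\<^esub>"
  proof (rule flat_imp_negative_free[OF nf M])
    show "flat TYPE('u) R (alg_module B)" using flat by (simp only: GL_flat_def)
    show "poly_elem (poly_var (X_entry a b) * poly_var (Y_entry b b)) \<in> carrier (alg_module B)"
      "poly_elem q \<in> carrier (alg_module B)"
      by (simp_all add: alg_module_def)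
    show "poly_elem (poly_var (X_entry a b) * poly_var (Y_entry b b)) \<oplus>\<^bsub>alg_module B\<^esub> poly_elem q =
        \<zero>\<^bsub>alg_module B\<^esub>"
      using q by (simp add: alg_module_def)
  qed
  then show False using product_nonzero[OF one] by (simp add: alg_module_def)
qed

section \<open>Finite sums and matrices over a semiring\<close>

lemma (in abelian_monoid) finsum_swap:
  assumes "finite A" "finite B" "\<And>i j. \<lbrakk>i \<in> A; j \<in> B\<rbrakk> \<Longrightarrow> f i j \<in> carrier G"
  shows "(\<Oplus>i\<in>A. \<Oplus>j\<in>B. f i j) = (\<Oplus>j\<in>B. \<Oplus>i\<in>A. f i j)"
  using assms
proof (induction A)
  case (insert a A)
  have "(\<Oplus>i\<in>insert a A. \<Oplus>j\<in>B. f i j) = (\<Oplus>j\<in>B. f a j) \<oplus> (\<Oplus>j\<in>B. \<Oplus>i\<in>A. f i j)"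
    using insert by (subst finsum_insert) auto
  also have "\<dots> = (\<Oplus>j\<in>B. f a j \<oplus> (\<Oplus>i\<in>A. f i j))"
    using insert by (intro finsum_addf[symmetric]) auto
  also have "\<dots> = (\<Oplus>j\<in>B. \<Oplus>i\<in>insert a A. f i j)"
    using insert by (intro finsum_cong') (auto simp: finsum_insert)
  finally show ?case .
qed simp

lemma (in abelian_monoid) finsum_Times:
  assumes "finite A" "finite B" "\<And>i j. \<lbrakk>i \<in> A; j \<in> B\<rbrakk> \<Longrightarrow> f (i, j) \<in> carrier G"
  shows "(\<Oplus>p\<in>A \<times> B. f p) = (\<Oplus>i\<in>A. \<Oplus>j\<in>B. f (i, j))"
  using assms
proof (induction A)
  case (insert a A)
  have "insert a A \<times> B = Pair a ` B \<union> A \<times> B" by auto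
  then have "(\<Oplus>p\<in>insert a A \<times> B. f p) = (\<Oplus>p\<in>Pair a ` B. f p) \<oplus> (\<Oplus>p\<in>A \<times> B. f p)"
    using insert by (simp only:, intro finsum_Un_disjoint) auto
  also have "(\<Oplus>p\<in>Pair a ` B. f p) = (\<Oplus>j\<in>B. f (a, j))"
    using insert by (intro finsum_reindex) (auto simp: inj_on_def)
  finally show ?case
    using insert by (subst finsum_insert) auto
qed simp

lemma (in abelian_monoid) finsum_single_term:
  assumes "finite A" "i \<in> A" "f i \<in> carrier G" "\<And>j. \<lbrakk>j \<in> A; j \<noteq> i\<rbrakk> \<Longrightarrow> f j = \<zero>"
  shows "(\<Oplus>j\<in>A. f j) = f i"
proof -
  have cl: "f j \<in> carrier G" if "j \<in> A" for j
    using assms(3) assms(4)[OF that] by (cases "j = i") auto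
  have "(\<Oplus>j\<in>A. f j) = (\<Oplus>j\<in>A. if i = j then f j else \<zero>)"
    using assms(4) cl by (intro finsum_cong') auto
  also have "\<dots> = f i"
    using assms cl by (intro finsum_singleton) auto
  finally show ?thesis .
qed

lemma (in csemiring) finprod_finsum_expand:
  assumes "finite J" "finite I" "\<And>i j. \<lbrakk>i \<in> I; j \<in> J\<rbrakk> \<Longrightarrow> f i j \<in> carrier R"
  shows "(\<Otimes>j\<in>J. \<Oplus>i\<in>I. f i j) = (\<Oplus>g\<in>J \<rightarrow>\<^sub>E I. \<Otimes>j\<in>J. f (g j) j)"
  using assms(1,3)
proof (induction J)
  case empty
  then show ?case by (simp add: finsum_insert)
next
  case (insert a J)
  let ?u = "\<lambda>(i, g). g(a := i)"
  have fin: "finite (J \<rightarrow>\<^sub>E I)" using insert assms(2) by (intro finite_PiE) auto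
  have P: "(\<Otimes>j\<in>J. f (g j) j) \<in> carrier R" if "g \<in> J \<rightarrow>\<^sub>E I" for g
    using that insert by (intro finprod_closed) (auto simp: PiE_iff)
  have fa: "f i a \<in> carrier R" if "i \<in> I" for i using that insert by simp
  have S: "(\<Oplus>i\<in>I. f i a) \<in> carrier R" using fa by (intro finsum_closed) auto
  have G: "(\<Oplus>g\<in>J \<rightarrow>\<^sub>E I. \<Otimes>j\<in>J. f (g j) j) \<in> carrier R" using P by (intro finsum_closed) auto
  have upd: "(\<Otimes>j\<in>insert a J. f ((g(a := i)) j) j) = f i a \<otimes> (\<Otimes>j\<in>J. f (g j) j)"
    if "i \<in> I" "g \<in> J \<rightarrow>\<^sub>E I" for i g
  proof -
    have "(\<Otimes>j\<in>J. f ((g(a := i)) j) j) = (\<Otimes>j\<in>J. f (g j) j)"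
      using insert that by (intro finprod_cong') (auto simp: PiE_iff)
    then show ?thesis
      using insert that fa by (subst finprod_insert) (auto simp: PiE_iff)
  qed
  have "(\<Otimes>j\<in>insert a J. \<Oplus>i\<in>I. f i j) = (\<Oplus>i\<in>I. f i a) \<otimes> (\<Oplus>g\<in>J \<rightarrow>\<^sub>E I. \<Otimes>j\<in>J. f (g j) j)"
    using insert by (subst finprod_insert) auto
  also have "\<dots> = (\<Oplus>i\<in>I. f i a \<otimes> (\<Oplus>g\<in>J \<rightarrow>\<^sub>E I. \<Otimes>j\<in>J. f (g j) j))"
    using assms(2) fa G by (intro finsum_ldistr) auto
  also have "\<dots> = (\<Oplus>i\<in>I. \<Oplus>g\<in>J \<rightarrow>\<^sub>E I. f i a \<otimes> (\<Otimes>j\<in>J. f (g j) j))"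
    using fin fa P by (intro finsum_cong' finsum_rdistr) auto
  also have "\<dots> = (\<Oplus>i\<in>I. \<Oplus>g\<in>J \<rightarrow>\<^sub>E I. \<Otimes>j\<in>insert a J. f (?u (i, g) j) j)"
    using fa P by (intro finsum_cong' finsum_closed) (auto simp: upd simp del: fun_upd_apply)
  also have "\<dots> = (\<Oplus>p\<in>I \<times> (J \<rightarrow>\<^sub>E I). \<Otimes>j\<in>insert a J. f (?u p j) j)"
    using assms(2) fin fa P
    by (intro finsum_Times[symmetric]) (auto simp: upd simp del: fun_upd_apply)
  also have "\<dots> = (\<Oplus>g\<in>?u ` (I \<times> (J \<rightarrow>\<^sub>E I)). \<Otimes>j\<in>insert a J. f (g j) j)"
  proof (rule finsum_reindex[symmetric])
    show "inj_on ?u (I \<times> (J \<rightarrow>\<^sub>E I))"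
      using inj_combinator[OF insert(2), of "\<lambda>_. I"] .
  qed (use fa P in \<open>auto simp: upd simp del: fun_upd_apply\<close>)
  also have "?u ` (I \<times> (J \<rightarrow>\<^sub>E I)) = insert a J \<rightarrow>\<^sub>E I"
    by (simp add: PiE_insert_eq)
  finally show ?case .
qed

lemma semiring_hom_simps:
  assumes "f \<in> semiring_hom R S"
  shows "x \<in> carrier R \<Longrightarrow> f x \<in> carrier S"
    and "\<lbrakk>x \<in> carrier R; y \<in> carrier R\<rbrakk> \<Longrightarrow> f (x \<otimes>\<^bsub>R\<^esub> y) = f x \<otimes>\<^bsub>S\<^esub> f y"
    and "\<lbrakk>x \<in> carrier R; y \<in> carrier R\<rbrakk> \<Longrightarrow> f (x \<oplus>\<^bsub>R\<^esub> y) = f x \<oplus>\<^bsub>S\<^esub> f y"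
    and "f \<one>\<^bsub>R\<^esub> = \<one>\<^bsub>S\<^esub>" "f \<zero>\<^bsub>R\<^esub> = \<zero>\<^bsub>S\<^esub>"
  using assms by (auto simp: semiring_hom_def ring_hom_def)

lemma semiring_hom_finsum:
  assumes f: "f \<in> semiring_hom R S" and "csemiring R" "csemiring S" and A: "finite A" "g \<in> A \<rightarrow> carrier R"
  shows "f (\<Oplus>\<^bsub>R\<^esub>i\<in>A. g i) = (\<Oplus>\<^bsub>S\<^esub>i\<in>A. f (g i))"
proof -
  interpret R: csemiring R by fact
  interpret S: csemiring S by fact
  show ?thesis
    using A by (induction A) (auto simp: semiring_hom_simps[OF f] R.finsum_insert S.finsum_insert Pi_iff)
qed

locale matrices = csemiring C for C :: "('r, 'c) alg" (structure)
begin

abbreviation Mat :: "('n::finite \<Rightarrow> 'n \<Rightarrow> 'c) monoid" where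
  "Mat \<equiv> mat_monoid C"

lemma Mat_simps:
  "carrier Mat = {A :: 'n::finite \<Rightarrow> 'n \<Rightarrow> 'c. \<forall>i j. A i j \<in> carrier C}"
  "A \<otimes>\<^bsub>Mat\<^esub> B = (\<lambda>(i::'n) j. \<Oplus>k\<in>UNIV. A i k \<otimes> B k j)"
  "\<one>\<^bsub>Mat\<^esub> = (\<lambda>(i::'n) j. if i = j then \<one> else \<zero>)"
  by (simp_all add: mat_monoid_def)

lemma monoid_Mat: "monoid (Mat :: ('n::finite \<Rightarrow> 'n \<Rightarrow> 'c) monoid)"
proof (rule monoidI)
  fix A B D :: "'n \<Rightarrow> 'n \<Rightarrow> 'c"
  assume A: "A \<in> carrier Mat" and B: "B \<in> carrier Mat" and D: "D \<in> carrier Mat"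
  then have cl: "A i j \<in> carrier C" "B i j \<in> carrier C" "D i j \<in> carrier C" for i j
    by (auto simp: Mat_simps)
  show "A \<otimes>\<^bsub>Mat\<^esub> B \<in> carrier Mat"
    using cl by (auto simp: Mat_simps intro!: finsum_closed)
  show "A \<otimes>\<^bsub>Mat\<^esub> B \<otimes>\<^bsub>Mat\<^esub> D = A \<otimes>\<^bsub>Mat\<^esub> (B \<otimes>\<^bsub>Mat\<^esub> D)"
  proof (intro ext)
    fix i j
    have "(\<Oplus>k\<in>UNIV. (\<Oplus>l\<in>UNIV. A i l \<otimes> B l k) \<otimes> D k j) =
        (\<Oplus>k\<in>UNIV. \<Oplus>l\<in>UNIV. A i l \<otimes> B l k \<otimes> D k j)"
      using cl by (intro finsum_cong' finsum_ldistr) auto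
    also have "\<dots> = (\<Oplus>l\<in>UNIV. \<Oplus>k\<in>UNIV. A i l \<otimes> B l k \<otimes> D k j)"
      using cl by (intro finsum_swap) auto
    also have "\<dots> = (\<Oplus>l\<in>UNIV. A i l \<otimes> (\<Oplus>k\<in>UNIV. B l k \<otimes> D k j))"
      using cl by (intro finsum_cong') (auto simp: m_assoc intro!: finsum_rdistr[symmetric])
    finally show "(A \<otimes>\<^bsub>Mat\<^esub> B \<otimes>\<^bsub>Mat\<^esub> D) i j = (A \<otimes>\<^bsub>Mat\<^esub> (B \<otimes>\<^bsub>Mat\<^esub> D)) i j"
      by (simp add: Mat_simps)
  qed
next
  show "(\<one>\<^bsub>Mat\<^esub> :: 'n \<Rightarrow> 'n \<Rightarrow> 'c) \<in> carrier Mat" by (simp add: Mat_simps)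
  fix A :: "'n \<Rightarrow> 'n \<Rightarrow> 'c" assume "A \<in> carrier Mat"
  then have cl: "A i j \<in> carrier C" for i j by (auto simp: Mat_simps)
  have "(\<Oplus>k\<in>UNIV. (if i = k then \<one> else \<zero>) \<otimes> A k j) = (if i = i then \<one> else \<zero>) \<otimes> A i j" for i j
    using cl by (intro finsum_single_term) auto
  then show "\<one>\<^bsub>Mat\<^esub> \<otimes>\<^bsub>Mat\<^esub> A = A" using cl by (simp add: Mat_simps)
  have "(\<Oplus>k\<in>UNIV. A i k \<otimes> (if k = j then \<one> else \<zero>)) = A i j \<otimes> (if j = j then \<one> else \<zero>)" for i j
    using cl by (intro finsum_single_term) auto
  then show "A \<otimes>\<^bsub>Mat\<^esub> \<one>\<^bsub>Mat\<^esub> = A" using cl by (simp add: Mat_simps)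
qed

lemma group_GL: "group (GL C :: ('n::finite \<Rightarrow> 'n \<Rightarrow> 'c) monoid)"
  unfolding GL_def by (rule monoid.units_group[OF monoid_Mat])

lemma GL_simps:
  "carrier (GL C) = {A :: 'n::finite \<Rightarrow> 'n \<Rightarrow> 'c. A \<in> carrier Mat \<and>
    (\<exists>B\<in>carrier Mat. B \<otimes>\<^bsub>Mat\<^esub> A = \<one>\<^bsub>Mat\<^esub> \<and> A \<otimes>\<^bsub>Mat\<^esub> B = \<one>\<^bsub>Mat\<^esub>)}"
  "A \<otimes>\<^bsub>GL C\<^esub> B = A \<otimes>\<^bsub>Mat\<^esub> (B :: 'n \<Rightarrow> 'n \<Rightarrow> 'c)"
  "\<one>\<^bsub>GL C\<^esub> = (\<one>\<^bsub>Mat\<^esub> :: 'n \<Rightarrow> 'n \<Rightarrow> 'c)"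
  by (auto simp: GL_def units_of_def Units_def)

end


section \<open>The torus normalizer\<close>

lemma finite_perms [simp]: "finite (perms :: ('n::finite \<Rightarrow> 'n) set)"
  by (rule finite_permutations) simp

text \<open>A point of the constant group scheme is a complete system of orthogonal idempotents.\<close>

locale idempotent_system = csemiring C for C :: "('r, 'c) alg" (structure) +
  fixes e :: "('n::finite \<Rightarrow> 'n) \<Rightarrow> 'c"
  assumes e: "e \<in> carrier (const_Sn C)"
begin

lemma e_closed [simp]: "\<sigma> permutes UNIV \<Longrightarrow> e \<sigma> \<in> carrier C"
  using e by (auto simp: const_Sn_def)

lemma e_extensional: "e \<in> extensional perms"
  using e by (auto simp: const_Sn_def PiE_def)

lemma e_orthogonal: "\<lbrakk>\<sigma> permutes UNIV; \<tau> permutes UNIV; \<sigma> \<noteq> \<tau>\<rbrakk> \<Longrightarrow> e \<sigma> \<otimes> e \<tau> = \<zero>"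
  using e by (auto simp: const_Sn_def)

lemma e_sum: "(\<Oplus>\<sigma>\<in>perms. e \<sigma>) = \<one>"
  using e by (auto simp: const_Sn_def)

lemma e_split:
  assumes "a \<in> carrier C"
  shows "a = (\<Oplus>\<sigma>\<in>perms. e \<sigma> \<otimes> a)"
proof -
  have "a = (\<Oplus>\<sigma>\<in>perms. e \<sigma>) \<otimes> a" using assms by (simp add: e_sum)
  also have "\<dots> = (\<Oplus>\<sigma>\<in>perms. e \<sigma> \<otimes> a)" using assms by (intro finsum_ldistr) auto
  finally show ?thesis .
qed

text \<open>The idempotents sum to \<open>1\<close> and so decompose the algebra into components; identities are
  checked on each of them.\<close>

lemma eq_locally:
  assumes "a \<in> carrier C" "b \<in> carrier C" "\<And>\<sigma>. \<sigma> permutes UNIV \<Longrightarrow> e \<sigma> \<otimes> a = e \<sigma> \<otimes> b"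
  shows "a = b"
proof -
  have "(\<Oplus>\<sigma>\<in>perms. e \<sigma> \<otimes> a) = (\<Oplus>\<sigma>\<in>perms. e \<sigma> \<otimes> b)"
    using assms by (intro finsum_cong') auto
  then show ?thesis using e_split[OF assms(1)] e_split[OF assms(2)] by simp
qed

lemma e_idem:
  assumes "\<sigma> permutes UNIV"
  shows "e \<sigma> \<otimes> e \<sigma> = e \<sigma>"
proof -
  have "e \<sigma> = (\<Oplus>\<tau>\<in>perms. e \<tau> \<otimes> e \<sigma>)" using assms by (intro e_split) simp
  also have "\<dots> = e \<sigma> \<otimes> e \<sigma>"
    using assms by (intro finsum_single_term) (auto simp: e_orthogonal)
  finally show ?thesis by simp
qed

text \<open>On the component of \<open>\<sigma>\<close>, a sum over permutations reduces to its term at \<open>\<sigma>\<close>.\<close>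

lemma component:
  assumes \<sigma>: "\<sigma> permutes UNIV" and a: "\<And>\<tau>. \<tau> permutes UNIV \<Longrightarrow> a \<tau> \<in> carrier C"
  shows "e \<sigma> \<otimes> (\<Oplus>\<tau>\<in>perms. e \<tau> \<otimes> a \<tau>) = e \<sigma> \<otimes> a \<sigma>"
proof -
  have "e \<sigma> \<otimes> (\<Oplus>\<tau>\<in>perms. e \<tau> \<otimes> a \<tau>) = (\<Oplus>\<tau>\<in>perms. e \<sigma> \<otimes> (e \<tau> \<otimes> a \<tau>))"
    using \<sigma> a by (intro finsum_rdistr) auto
  also have "\<dots> = e \<sigma> \<otimes> (e \<sigma> \<otimes> a \<sigma>)"
    using \<sigma> a by (intro finsum_single_term) (auto simp: m_assoc[symmetric] e_orthogonal)
  also have "\<dots> = e \<sigma> \<otimes> a \<sigma>" using \<sigma> a by (simp add: m_assoc[symmetric] e_idem)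
  finally show ?thesis .
qed

text \<open>The matrix \<open>\<Sum>\<^sub>\<sigma> e\<^sub>\<sigma> P\<^sub>\<sigma>\<close>, which is the permutation matrix of \<open>\<sigma>\<close> on the component of \<open>\<sigma>\<close>.\<close>

definition E :: "'n \<Rightarrow> 'n \<Rightarrow> 'c" where
  "E i j = (\<Oplus>\<sigma>\<in>perms. e \<sigma> \<otimes> perm_matrix C \<sigma> i j)"

lemma perm_matrix_closed [simp]: "perm_matrix C \<sigma> i j \<in> carrier C"
  by (simp add: perm_matrix_def)

lemma E_closed [simp]: "E i j \<in> carrier C"
  unfolding E_def by (intro finsum_closed) auto

lemma E_component: "\<sigma> permutes UNIV \<Longrightarrow> e \<sigma> \<otimes> E i j = (if i = \<sigma> j then e \<sigma> else \<zero>)"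
  unfolding E_def by (subst component) (auto simp: perm_matrix_def)

lemma E_row: "(\<Oplus>k\<in>UNIV. E i k \<otimes> E j k) = (if i = j then \<one> else \<zero>)"
proof (rule eq_locally)
  fix \<sigma> :: "'n \<Rightarrow> 'n" assume \<sigma>: "\<sigma> permutes UNIV"
  have eq: "e \<sigma> \<otimes> (E i k \<otimes> E j k) = (if k = inv_into UNIV \<sigma> i then if i = j then e \<sigma> else \<zero> else \<zero>)" for k
    using \<sigma> E_component[OF \<sigma>] permutes_inverses[OF \<sigma>]
    by (auto simp: m_assoc[symmetric])
  have "e \<sigma> \<otimes> (\<Oplus>k\<in>UNIV. E i k \<otimes> E j k) = (\<Oplus>k\<in>UNIV. e \<sigma> \<otimes> (E i k \<otimes> E j k))"
    using \<sigma> by (intro finsum_rdistr) auto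
  also have "\<dots> = e \<sigma> \<otimes> (E i (inv_into UNIV \<sigma> i) \<otimes> E j (inv_into UNIV \<sigma> i))"
    using \<sigma> by (intro finsum_single_term) (auto simp: eq)
  also have "\<dots> = e \<sigma> \<otimes> (if i = j then \<one> else \<zero>)" using \<sigma> by (simp add: eq)
  finally show "e \<sigma> \<otimes> (\<Oplus>k\<in>UNIV. E i k \<otimes> E j k) = e \<sigma> \<otimes> (if i = j then \<one> else \<zero>)" .
qed (auto intro!: finsum_closed)

lemma E_column: "(\<Oplus>k\<in>UNIV. E k i \<otimes> E k j) = (if i = j then \<one> else \<zero>)"
proof (rule eq_locally)
  fix \<sigma> :: "'n \<Rightarrow> 'n" assume \<sigma>: "\<sigma> permutes UNIV"
  have inj: "\<sigma> i = \<sigma> j \<longleftrightarrow> i = j" using permutes_inj[OF \<sigma>] by (auto dest: injD)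
  have eq: "e \<sigma> \<otimes> (E k i \<otimes> E k j) = (if k = \<sigma> i then if i = j then e \<sigma> else \<zero> else \<zero>)" for k
    using \<sigma> E_component[OF \<sigma>] inj by (auto simp: m_assoc[symmetric])
  have "e \<sigma> \<otimes> (\<Oplus>k\<in>UNIV. E k i \<otimes> E k j) = (\<Oplus>k\<in>UNIV. e \<sigma> \<otimes> (E k i \<otimes> E k j))"
    using \<sigma> by (intro finsum_rdistr) auto
  also have "\<dots> = e \<sigma> \<otimes> (E (\<sigma> i) i \<otimes> E (\<sigma> i) j)"
    using \<sigma> by (intro finsum_single_term) (auto simp: eq)
  also have "\<dots> = e \<sigma> \<otimes> (if i = j then \<one> else \<zero>)" using \<sigma> by (simp add: eq)
  finally show "e \<sigma> \<otimes> (\<Oplus>k\<in>UNIV. E k i \<otimes> E k j) = e \<sigma> \<otimes> (if i = j then \<one> else \<zero>)" .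
qed (auto intro!: finsum_closed)

lemma E_row_sum: "(\<Oplus>k\<in>UNIV. E i k) = \<one>"
proof (rule eq_locally)
  fix \<sigma> :: "'n \<Rightarrow> 'n" assume \<sigma>: "\<sigma> permutes UNIV"
  have "e \<sigma> \<otimes> (\<Oplus>k\<in>UNIV. E i k) = (\<Oplus>k\<in>UNIV. e \<sigma> \<otimes> E i k)"
    using \<sigma> by (intro finsum_rdistr) auto
  also have "\<dots> = e \<sigma> \<otimes> E i (inv_into UNIV \<sigma> i)"
    using \<sigma> permutes_inverses[OF \<sigma>] by (intro finsum_single_term) (auto simp: E_component)
  also have "\<dots> = e \<sigma> \<otimes> \<one>" using \<sigma> permutes_inverses[OF \<sigma>] by (simp add: E_component)
  finally show "e \<sigma> \<otimes> (\<Oplus>k\<in>UNIV. E i k) = e \<sigma> \<otimes> \<one>" .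
qed (auto intro!: finsum_closed)

lemma canonical_map_eq:
  assumes "\<And>i. d i \<in> carrier C"
  shows "canonical_map C (d, e) i j = d i \<otimes> E i j"
proof -
  have "canonical_map C (d, e) i j = (\<Oplus>k\<in>UNIV. (if i = k then d i else \<zero>) \<otimes> E k j)"
    by (simp add: canonical_map_def mat_monoid_def diag_matrix_def E_def)
  also have "\<dots> = (if i = i then d i else \<zero>) \<otimes> E i j"
    using assms by (intro finsum_single_term) auto
  finally show ?thesis by simp
qed

end

lemma const_SnI:
  assumes "e \<in> perms \<rightarrow>\<^sub>E carrier C"
    and "\<And>\<sigma> \<tau>. \<lbrakk>\<sigma> permutes UNIV; \<tau> permutes UNIV; \<sigma> \<noteq> \<tau>\<rbrakk> \<Longrightarrow> e \<sigma> \<otimes>\<^bsub>C\<^esub> e \<tau> = \<zero>\<^bsub>C\<^esub>"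
    and "(\<Oplus>\<^bsub>C\<^esub>\<sigma>\<in>perms. e \<sigma>) = \<one>\<^bsub>C\<^esub>"
  shows "e \<in> carrier (const_Sn C)"
  using assms by (simp add: const_Sn_def)

locale idempotent_system_pair =
  e: idempotent_system C e + e': idempotent_system C e'
  for C :: "('r, 'c) alg" (structure) and e e' :: "('n::finite \<Rightarrow> 'n) \<Rightarrow> 'c"
begin

lemma eq_locally2:
  assumes "a \<in> carrier C" "b \<in> carrier C"
    and "\<And>\<sigma> \<tau>. \<lbrakk>\<sigma> permutes UNIV; \<tau> permutes UNIV\<rbrakk> \<Longrightarrow> e' \<tau> \<otimes> (e \<sigma> \<otimes> a) = e' \<tau> \<otimes> (e \<sigma> \<otimes> b)"
  shows "a = b"
proof (rule e.eq_locally[OF assms(1,2)])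
  fix \<sigma> :: "'n \<Rightarrow> 'n" assume \<sigma>: "\<sigma> permutes UNIV"
  show "e \<sigma> \<otimes> a = e \<sigma> \<otimes> b"
    by (rule e'.eq_locally) (simp_all add: assms \<sigma>)
qed

abbreviation "conv \<equiv> e \<otimes>\<^bsub>const_Sn C\<^esub> e'"

lemma inv_comp_permutes: "\<lbrakk>\<sigma> permutes UNIV; \<rho> permutes UNIV\<rbrakk> \<Longrightarrow> inv_into UNIV \<sigma> \<circ> \<rho> permutes UNIV"
  by (intro permutes_compose permutes_inv)

lemma conv_eq:
  "\<rho> permutes UNIV \<Longrightarrow> conv \<rho> = (\<Oplus>\<sigma>\<in>perms. e \<sigma> \<otimes> e' (inv_into UNIV \<sigma> \<circ> \<rho>))"
  by (simp add: const_Sn_def)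

lemma conv_closed: "\<rho> permutes UNIV \<Longrightarrow> conv \<rho> \<in> carrier C"
  unfolding conv_eq by (intro e.finsum_closed) (auto simp: inv_comp_permutes)

text \<open>On the component of \<open>\<sigma>\<close> only the term \<open>e' (\<sigma>\<^sup>-\<^sup>1 \<circ> \<rho>)\<close> of the convolution is left, and \<open>e' \<tau>\<close>
  annihilates it unless \<open>\<sigma>\<^sup>-\<^sup>1 \<circ> \<rho> = \<tau>\<close>.\<close>

lemma conv_component:
  assumes "\<sigma> permutes UNIV" "\<tau> permutes UNIV" "\<rho> permutes UNIV"
  shows "e' \<tau> \<otimes> (e \<sigma> \<otimes> conv \<rho>) = (if \<rho> = \<sigma> \<circ> \<tau> then e' \<tau> \<otimes> e \<sigma> else \<zero>)"
proof -
  have iff: "inv_into UNIV \<sigma> \<circ> \<rho> = \<tau> \<longleftrightarrow> \<rho> = \<sigma> \<circ> \<tau>"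
    using permutes_inv_o[OF assms(1)] by (metis comp_assoc comp_id id_comp)
  note cl = inv_comp_permutes[OF assms(1,3)]
  have "e \<sigma> \<otimes> conv \<rho> = e \<sigma> \<otimes> e' (inv_into UNIV \<sigma> \<circ> \<rho>)"
    unfolding conv_eq[OF assms(3)] using assms by (intro e.component) (auto simp: inv_comp_permutes)
  then have "e' \<tau> \<otimes> (e \<sigma> \<otimes> conv \<rho>) = (e' \<tau> \<otimes> e' (inv_into UNIV \<sigma> \<circ> \<rho>)) \<otimes> e \<sigma>"
    using assms cl by (simp add: e.m_ac)
  also have "\<dots> = (if \<rho> = \<sigma> \<circ> \<tau> then e' \<tau> \<otimes> e \<sigma> else \<zero>)"
  proof (cases "\<rho> = \<sigma> \<circ> \<tau>")
    case True
    then show ?thesis using assms(1,2) iff by (simp add: e'.e_idem)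
  next
    case False
    then show ?thesis
      using assms cl iff e'.e_orthogonal[OF assms(2) cl] by auto
  qed
  finally show ?thesis .
qed

lemma conv_system: "conv \<in> carrier (const_Sn C)"
proof -
  have "conv \<rho> \<otimes> conv \<rho>' = \<zero>" if \<rho>: "\<rho> permutes UNIV" "\<rho>' permutes UNIV" "\<rho> \<noteq> \<rho>'" for \<rho> \<rho>'
  proof (rule eq_locally2)
    fix \<sigma> \<tau> :: "'n \<Rightarrow> 'n" assume st: "\<sigma> permutes UNIV" "\<tau> permutes UNIV"
    have "e' \<tau> \<otimes> (e \<sigma> \<otimes> (conv \<rho> \<otimes> conv \<rho>')) = (e' \<tau> \<otimes> (e \<sigma> \<otimes> conv \<rho>)) \<otimes> conv \<rho>'"
      using st \<rho> by (simp add: e.m_assoc conv_closed)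
    also have "\<dots> = (if \<rho> = \<sigma> \<circ> \<tau> then e' \<tau> \<otimes> (e \<sigma> \<otimes> conv \<rho>') else \<zero>)"
      using st \<rho> by (simp add: conv_component[OF st \<rho>(1)] e.m_assoc conv_closed)
    also have "\<dots> = e' \<tau> \<otimes> (e \<sigma> \<otimes> \<zero>)"
      using st \<rho> by (auto simp: conv_component[OF st \<rho>(2)])
    finally show "e' \<tau> \<otimes> (e \<sigma> \<otimes> (conv \<rho> \<otimes> conv \<rho>')) = e' \<tau> \<otimes> (e \<sigma> \<otimes> \<zero>)" .
  qed (use \<rho> in \<open>auto simp: conv_closed\<close>)
  moreover have "(\<Oplus>\<rho>\<in>perms. conv \<rho>) = \<one>"
  proof (rule eq_locally2)
    fix \<sigma> \<tau> :: "'n \<Rightarrow> 'n" assume st: "\<sigma> permutes UNIV" "\<tau> permutes UNIV"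
    then have "\<sigma> \<circ> \<tau> permutes UNIV" by (intro permutes_compose)
    have "e' \<tau> \<otimes> (e \<sigma> \<otimes> (\<Oplus>\<rho>\<in>perms. conv \<rho>)) = (\<Oplus>\<rho>\<in>perms. e' \<tau> \<otimes> (e \<sigma> \<otimes> conv \<rho>))"
      using st by (simp add: e.finsum_rdistr conv_closed Pi_iff)
    also have "\<dots> = e' \<tau> \<otimes> (e \<sigma> \<otimes> conv (\<sigma> \<circ> \<tau>))"
      using st \<open>\<sigma> \<circ> \<tau> permutes UNIV\<close>
      by (intro e.finsum_single_term) (auto simp: conv_component conv_closed)
    also have "\<dots> = e' \<tau> \<otimes> (e \<sigma> \<otimes> \<one>)"
      using st \<open>\<sigma> \<circ> \<tau> permutes UNIV\<close> by (simp add: conv_component)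
    finally show "e' \<tau> \<otimes> (e \<sigma> \<otimes> (\<Oplus>\<rho>\<in>perms. conv \<rho>)) = e' \<tau> \<otimes> (e \<sigma> \<otimes> \<one>)" .
  qed (auto simp: conv_closed intro!: e.finsum_closed)
  moreover have "conv \<in> perms \<rightarrow>\<^sub>E carrier C"
    using conv_closed by (auto simp: const_Sn_def)
  ultimately show ?thesis by (intro const_SnI)
qed

end

sublocale idempotent_system_pair \<subseteq> conv: idempotent_system C conv
  by unfold_locales (rule conv_system)

context idempotent_system_pair
begin

lemma conv_E_component:
  assumes st: "\<sigma> permutes UNIV" "\<tau> permutes UNIV"
  shows "e' \<tau> \<otimes> (e \<sigma> \<otimes> conv.E i j) = (if i = \<sigma> (\<tau> j) then e' \<tau> \<otimes> e \<sigma> else \<zero>)"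
proof -
  have p: "\<sigma> \<circ> \<tau> permutes UNIV" using st by (intro permutes_compose)
  have cc: "e' \<tau> \<otimes> (e \<sigma> \<otimes> conv (\<sigma> \<circ> \<tau>)) = e' \<tau> \<otimes> e \<sigma>"
    using conv_component[OF st p] by simp
  then have "e' \<tau> \<otimes> (e \<sigma> \<otimes> conv.E i j) = e' \<tau> \<otimes> (e \<sigma> \<otimes> (conv (\<sigma> \<circ> \<tau>) \<otimes> conv.E i j))"
    using st p by (simp add: e.m_assoc[symmetric] conv_closed)
  also have "\<dots> = (if i = \<sigma> (\<tau> j) then e' \<tau> \<otimes> e \<sigma> else \<zero>)"
    using conv.E_component[OF p, of i j] cc st by simp
  finally show ?thesis .
qed

end

context idempotent_system
begin

lemma perm_action_closed: "(\<And>i. d i \<in> carrier C) \<Longrightarrow> perm_action C e d i \<in> carrier C"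
  unfolding perm_action_def by (intro finsum_closed) auto

lemma perm_action_component:
  "\<lbrakk>\<sigma> permutes UNIV; \<And>i. d i \<in> carrier C\<rbrakk> \<Longrightarrow>
    e \<sigma> \<otimes> perm_action C e d i = e \<sigma> \<otimes> d (inv_into UNIV \<sigma> i)"
  unfolding perm_action_def by (rule component)

text \<open>On the component of \<open>\<sigma>\<close> the \<open>i\<close>-th entry is the unit \<open>d (\<sigma>\<^sup>-\<^sup>1 i)\<close>, so the inverse is obtained by
  acting on the inverses.\<close>

lemma perm_action_unit:
  assumes d: "\<And>i. d i \<in> Units C"
  shows "perm_action C e d i \<in> Units C"
proof -
  let ?d' = "\<lambda>i. inv (d i)"
  have cl: "d i \<in> carrier C" "?d' i \<in> carrier C" for i using d by auto
  note pcl = perm_action_closed[of d, OF cl(1)] perm_action_closed[of ?d', OF cl(2)]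
  have "perm_action C e d i \<otimes> perm_action C e ?d' i = \<one>"
  proof (rule eq_locally)
    fix \<sigma> :: "'n \<Rightarrow> 'n" assume \<sigma>: "\<sigma> permutes UNIV"
    let ?k = "inv_into UNIV \<sigma> i"
    have "e \<sigma> \<otimes> (perm_action C e d i \<otimes> perm_action C e ?d' i) =
        d ?k \<otimes> (e \<sigma> \<otimes> perm_action C e ?d' i)"
      using \<sigma> pcl cl perm_action_component[OF \<sigma>, of d i]
      by (simp add: m_assoc[symmetric]) (simp add: m_ac)
    also have "\<dots> = e \<sigma> \<otimes> (d ?k \<otimes> ?d' ?k)"
      using \<sigma> cl perm_action_component[OF \<sigma>, of ?d' i] by (simp add: m_ac)
    finally show "e \<sigma> \<otimes> (perm_action C e d i \<otimes> perm_action C e ?d' i) = e \<sigma> \<otimes> \<one>"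
      using d by simp
  qed (use pcl in auto)
  then show ?thesis
    using pcl m_comm[OF pcl, of i i] unfolding Units_def by auto
qed

end

sublocale idempotent_system \<subseteq> matrices C
  by unfold_locales

context idempotent_system
begin

lemma canonical_map_in_GL:
  assumes d: "\<And>i. d i \<in> Units C"
  shows "canonical_map C (d, e) \<in> carrier (GL C)"
proof -
  let ?A = "\<lambda>i j. d i \<otimes> E i j" and ?B = "\<lambda>i j. E j i \<otimes> inv (d j)"
  have cl: "d i \<in> carrier C" "inv (d i) \<in> carrier C" for i using d by auto
  have A: "canonical_map C (d, e) = ?A"
    using canonical_map_eq[of d, OF cl(1)] by blast
  have "(\<Oplus>k\<in>UNIV. ?A i k \<otimes> ?B k j) = (if i = j then \<one> else \<zero>)" for i j
  proof -
    have "(\<Oplus>k\<in>UNIV. ?A i k \<otimes> ?B k j) = (\<Oplus>k\<in>UNIV. (d i \<otimes> inv (d j)) \<otimes> (E i k \<otimes> E j k))"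
      using cl by (intro finsum_cong') (auto simp: m_ac)
    also have "\<dots> = (d i \<otimes> inv (d j)) \<otimes> (\<Oplus>k\<in>UNIV. E i k \<otimes> E j k)"
      using cl by (intro finsum_rdistr[symmetric]) auto
    finally show ?thesis using d cl by (simp add: E_row)
  qed
  moreover have "(\<Oplus>k\<in>UNIV. ?B i k \<otimes> ?A k j) = (if i = j then \<one> else \<zero>)" for i j
  proof -
    have "?B i k \<otimes> ?A k j = (inv (d k) \<otimes> d k) \<otimes> (E k i \<otimes> E k j)" for k
      using cl by (simp add: m_ac)
    then have "(\<Oplus>k\<in>UNIV. ?B i k \<otimes> ?A k j) = (\<Oplus>k\<in>UNIV. E k i \<otimes> E k j)"
      using d by (intro finsum_cong') auto
    then show ?thesis by (simp add: E_column)
  qed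
  ultimately show ?thesis
    unfolding A GL_simps using cl
    by (auto simp: Mat_simps intro!: exI[of _ ?B])
qed

lemma canonical_map_row_sum:
  assumes "\<And>i. d i \<in> carrier C"
  shows "(\<Oplus>k\<in>UNIV. canonical_map C (d, e) i k) = d i"
proof -
  have "(\<Oplus>k\<in>UNIV. canonical_map C (d, e) i k) = d i \<otimes> (\<Oplus>k\<in>UNIV. E i k)"
    using assms by (simp add: canonical_map_eq finsum_rdistr)
  then show ?thesis using assms by (simp add: E_row_sum)
qed

end

context idempotent_system_pair
begin

text \<open>On the common component of \<open>\<sigma>\<close> and \<open>\<tau>\<close> both sides are the monomial matrix of \<open>\<sigma> \<circ> \<tau>\<close> with the
  entry \<open>d i \<otimes> d' (\<sigma>\<^sup>-\<^sup>1 i)\<close> in row \<open>i\<close>.\<close>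

lemma canonical_map_mult:
  assumes d: "\<And>i. d i \<in> carrier C" "\<And>i. d' i \<in> carrier C"
  shows "canonical_map C (\<lambda>i. d i \<otimes> perm_action C e d' i, conv) =
    canonical_map C (d, e) \<otimes>\<^bsub>mat_monoid C\<^esub> canonical_map C (d', e')"
proof (intro ext)
  fix i j
  note pcl = e.perm_action_closed[of d', OF d(2)]
  have cl: "d i \<otimes> perm_action C e d' i \<in> carrier C" for i using pcl d by simp
  have "(d i \<otimes> perm_action C e d' i) \<otimes> conv.E i j = (\<Oplus>k\<in>UNIV. (d i \<otimes> e.E i k) \<otimes> (d' k \<otimes> e'.E k j))"
  proof (rule eq_locally2)
    fix \<sigma> \<tau> :: "'n \<Rightarrow> 'n" assume st: "\<sigma> permutes UNIV" "\<tau> permutes UNIV"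
    let ?k = "inv_into UNIV \<sigma> i"
    have ik: "i = \<sigma> k \<longleftrightarrow> k = ?k" for k using permutes_inverses[OF st(1)] by auto
    have "e' \<tau> \<otimes> (e \<sigma> \<otimes> ((d i \<otimes> perm_action C e d' i) \<otimes> conv.E i j)) =
        (e \<sigma> \<otimes> perm_action C e d' i) \<otimes> (d i \<otimes> (e' \<tau> \<otimes> conv.E i j))"
      using st d pcl by (simp add: e.m_ac)
    also have "\<dots> = (d' ?k \<otimes> d i) \<otimes> (e' \<tau> \<otimes> (e \<sigma> \<otimes> conv.E i j))"
      using st d by (simp add: e.perm_action_component e.m_ac)
    also have "\<dots> = (if \<tau> j = ?k then (d' ?k \<otimes> d i) \<otimes> (e' \<tau> \<otimes> e \<sigma>) else \<zero>)"
      using st d by (simp add: conv_E_component ik)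
    finally have lhs: "e' \<tau> \<otimes> (e \<sigma> \<otimes> ((d i \<otimes> perm_action C e d' i) \<otimes> conv.E i j)) =
      (if \<tau> j = ?k then (d' ?k \<otimes> d i) \<otimes> (e' \<tau> \<otimes> e \<sigma>) else \<zero>)" .
    have summand: "e' \<tau> \<otimes> (e \<sigma> \<otimes> ((d i \<otimes> e.E i k) \<otimes> (d' k \<otimes> e'.E k j))) =
        (if k = ?k then if k = \<tau> j then (d' k \<otimes> d i) \<otimes> (e' \<tau> \<otimes> e \<sigma>) else \<zero> else \<zero>)" for k
    proof -
      have "e' \<tau> \<otimes> (e \<sigma> \<otimes> ((d i \<otimes> e.E i k) \<otimes> (d' k \<otimes> e'.E k j))) =
          (d' k \<otimes> d i) \<otimes> ((e' \<tau> \<otimes> e'.E k j) \<otimes> (e \<sigma> \<otimes> e.E i k))"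
        using st d by (simp add: e.m_ac)
      then show ?thesis
        using st d by (simp add: e.E_component e'.E_component ik)
    qed
    have "e' \<tau> \<otimes> (e \<sigma> \<otimes> (\<Oplus>k\<in>UNIV. (d i \<otimes> e.E i k) \<otimes> (d' k \<otimes> e'.E k j))) =
        (\<Oplus>k\<in>UNIV. e' \<tau> \<otimes> (e \<sigma> \<otimes> ((d i \<otimes> e.E i k) \<otimes> (d' k \<otimes> e'.E k j))))"
      using st d by (simp add: e.finsum_rdistr)
    also have "\<dots> = e' \<tau> \<otimes> (e \<sigma> \<otimes> ((d i \<otimes> e.E i ?k) \<otimes> (d' ?k \<otimes> e'.E ?k j)))"
      using st d by (intro e.finsum_single_term) (auto simp: summand)
    also have "\<dots> = (if \<tau> j = ?k then (d' ?k \<otimes> d i) \<otimes> (e' \<tau> \<otimes> e \<sigma>) else \<zero>)"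
      unfolding summand by auto
    finally show "e' \<tau> \<otimes> (e \<sigma> \<otimes> ((d i \<otimes> perm_action C e d' i) \<otimes> conv.E i j)) =
      e' \<tau> \<otimes> (e \<sigma> \<otimes> (\<Oplus>k\<in>UNIV. (d i \<otimes> e.E i k) \<otimes> (d' k \<otimes> e'.E k j)))"
      by (simp only: lhs)
  qed (use cl d in \<open>auto intro!: e.finsum_closed\<close>)
  then show "canonical_map C (\<lambda>i. d i \<otimes> perm_action C e d' i, conv) i j =
      (canonical_map C (d, e) \<otimes>\<^bsub>mat_monoid C\<^esub> canonical_map C (d', e')) i j"
    using d by (simp add: e.Mat_simps e.canonical_map_eq e'.canonical_map_eq conv.canonical_map_eq[OF cl])
qed

text \<open>The row sums of the matrix are the \<open>d i\<close>. Dividing by them leaves the matrix \<open>E\<close>, and different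
  permutations \<open>\<sigma>\<close> and \<open>\<tau>\<close> differ in some entry, so that \<open>e \<sigma>\<close> and \<open>e' \<tau>\<close> are orthogonal.\<close>

lemma canonical_map_inj:
  assumes d: "\<And>i. d i \<in> Units C" "\<And>i. d' i \<in> Units C"
    and eq: "canonical_map C (d, e) = canonical_map C (d', e')"
  shows "d = d'" "e = e'"
proof -
  have cl: "d i \<in> carrier C" "d' i \<in> carrier C" "inv (d i) \<in> carrier C" for i using d by auto
  show dd: "d = d'"
    using e.canonical_map_row_sum[of d, OF cl(1)] e'.canonical_map_row_sum[of d', OF cl(2)] eq
    by (intro ext) metis
  have EE: "e.E i j = e'.E i j" for i j
  proof -
    have "d i \<otimes> e.E i j = d i \<otimes> e'.E i j"
      using eq e.canonical_map_eq[of d, OF cl(1)] e'.canonical_map_eq[of d', OF cl(2)] dd by metis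
    then have "inv (d i) \<otimes> (d i \<otimes> e.E i j) = inv (d i) \<otimes> (d i \<otimes> e'.E i j)" by simp
    then show ?thesis using cl d by (simp add: e.m_assoc[symmetric])
  qed
  have orth: "e \<sigma> \<otimes> e' \<tau> = \<zero>" if st: "\<sigma> permutes UNIV" "\<tau> permutes UNIV" "\<sigma> \<noteq> \<tau>" for \<sigma> \<tau>
  proof -
    obtain j where j: "\<sigma> j \<noteq> \<tau> j" using st(3) by blast
    have "e \<sigma> \<otimes> e' \<tau> = (e \<sigma> \<otimes> e.E (\<sigma> j) j) \<otimes> e' \<tau>" using st by (simp add: e.E_component)
    also have "\<dots> = e \<sigma> \<otimes> (e' \<tau> \<otimes> e'.E (\<sigma> j) j)" using st by (simp add: EE e.m_ac)
    also have "\<dots> = \<zero>" using st j by (simp add: e'.E_component)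
    finally show ?thesis .
  qed
  have "e \<sigma> = e' \<sigma>" if \<sigma>: "\<sigma> permutes UNIV" for \<sigma>
  proof -
    have "e \<sigma> = (\<Oplus>\<tau>\<in>perms. e' \<tau> \<otimes> e \<sigma>)" using \<sigma> by (intro e'.e_split) simp
    also have "\<dots> = e' \<sigma> \<otimes> e \<sigma>"
      using \<sigma> by (intro e.finsum_single_term) (auto simp: orth e.m_comm)
    finally have 1: "e \<sigma> = e' \<sigma> \<otimes> e \<sigma>" .
    have "e' \<sigma> = (\<Oplus>\<tau>\<in>perms. e \<tau> \<otimes> e' \<sigma>)" using \<sigma> by (intro e.e_split) simp
    also have "\<dots> = e \<sigma> \<otimes> e' \<sigma>"
      using \<sigma> by (intro e.finsum_single_term) (auto simp: orth)
    finally show ?thesis using 1 \<sigma> by (simp add: e.m_comm)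
  qed
  then show "e = e'"
    using e.e_extensional e'.e_extensional by (intro extensionalityI[of _ perms]) auto
qed

end

context matrices
begin

lemma carrier_torus_normalizer:
  "(d, e) \<in> carrier (torus_normalizer C :: (('n::finite \<Rightarrow> 'c) \<times> _) monoid) \<longleftrightarrow>
    (\<forall>i. d i \<in> Units C) \<and> e \<in> carrier (const_Sn C)"
  by (auto simp: torus_normalizer_def torus_def units_of_def)

lemma idempotent_systemI: "e \<in> carrier (const_Sn C) \<Longrightarrow> idempotent_system C e"
  by (intro idempotent_system.intro idempotent_system_axioms.intro csemiring_axioms)

lemma torus_normalizer_mult:
  "(d, e) \<otimes>\<^bsub>torus_normalizer C\<^esub> (d', e') = (\<lambda>i. d i \<otimes> perm_action C e d' i, e \<otimes>\<^bsub>const_Sn C\<^esub> e')"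
  by (simp add: torus_normalizer_def torus_def)

lemma torus_normalizer_m_closed:
  fixes x y :: "('n::finite \<Rightarrow> 'c) \<times> (('n \<Rightarrow> 'n) \<Rightarrow> 'c)"
  assumes "x \<in> carrier (torus_normalizer C)" "y \<in> carrier (torus_normalizer C)"
  shows "x \<otimes>\<^bsub>torus_normalizer C\<^esub> y \<in> carrier (torus_normalizer C)"
    and "canonical_map C (x \<otimes>\<^bsub>torus_normalizer C\<^esub> y) =
      canonical_map C x \<otimes>\<^bsub>GL C\<^esub> canonical_map C y"
proof -
  obtain d e d' e' where xy: "x = (d, e)" "y = (d', e')" by (cases x, cases y) auto
  have d: "d i \<in> Units C" "d' i \<in> Units C" for i
    using assms by (auto simp: xy carrier_torus_normalizer)
  interpret idempotent_system_pair C e e'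
    using assms by (intro idempotent_system_pair.intro idempotent_systemI)
      (auto simp: xy carrier_torus_normalizer)
  show "x \<otimes>\<^bsub>torus_normalizer C\<^esub> y \<in> carrier (torus_normalizer C)"
    using d e.perm_action_unit[of d'] conv_system
    by (simp add: xy torus_normalizer_mult carrier_torus_normalizer)
  show "canonical_map C (x \<otimes>\<^bsub>torus_normalizer C\<^esub> y) =
      canonical_map C x \<otimes>\<^bsub>GL C\<^esub> canonical_map C y"
    unfolding xy torus_normalizer_mult GL_simps using d by (intro canonical_map_mult) auto
qed

lemma torus_normalizer_one:
  shows "\<one>\<^bsub>torus_normalizer C\<^esub> \<in> carrier (torus_normalizer C :: (('n::finite \<Rightarrow> 'c) \<times> _) monoid)"
    and "canonical_map C \<one>\<^bsub>torus_normalizer C\<^esub> = (\<one>\<^bsub>GL C\<^esub> :: 'n \<Rightarrow> 'n \<Rightarrow> 'c)"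
proof -
  let ?e = "\<one>\<^bsub>const_Sn C\<^esub> :: ('n \<Rightarrow> 'n) \<Rightarrow> 'c"
  have one: "\<one>\<^bsub>torus_normalizer C\<^esub> = (\<lambda>_. \<one>, ?e)" by (simp add: torus_normalizer_def torus_def)
  have id: "(id :: 'n \<Rightarrow> 'n) permutes UNIV" by (rule permutes_id)
  have e_eq: "?e \<sigma> = (if \<sigma> = id then \<one> else \<zero>)" if "\<sigma> permutes UNIV" for \<sigma>
    using that by (simp add: const_Sn_def)
  have e: "?e \<in> carrier (const_Sn C)"
  proof (rule const_SnI)
    show "?e \<in> perms \<rightarrow>\<^sub>E carrier C" by (auto simp: const_Sn_def)
    show "(\<Oplus>\<sigma>\<in>perms. ?e \<sigma>) = \<one>"
      using finsum_single_term[of perms id ?e] id by (simp add: e_eq)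
  qed (auto simp: e_eq)
  then show "\<one>\<^bsub>torus_normalizer C\<^esub> \<in> carrier (torus_normalizer C :: (('n \<Rightarrow> 'c) \<times> _) monoid)"
    by (simp add: one carrier_torus_normalizer)
  interpret idempotent_system C ?e by (rule idempotent_systemI[OF e])
  have "?e id = \<one>" using id by (simp add: e_eq)
  then have "E i j = (if i = j then \<one> else \<zero>)" for i j
    using E_component[OF id, of i j] by simp
  then show "canonical_map C \<one>\<^bsub>torus_normalizer C\<^esub> = (\<one>\<^bsub>GL C\<^esub> :: 'n \<Rightarrow> 'n \<Rightarrow> 'c)"
    by (intro ext) (simp add: one canonical_map_eq GL_simps Mat_simps)
qed

lemma canonical_map_closed:
  assumes "x \<in> carrier (torus_normalizer C)"
  shows "canonical_map C x \<in> carrier (GL C)"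
proof (cases x)
  case (Pair d e)
  then interpret idempotent_system C e
    using assms by (intro idempotent_systemI) (simp add: carrier_torus_normalizer)
  show ?thesis
    using assms by (simp add: Pair carrier_torus_normalizer canonical_map_in_GL)
qed

lemma inj_on_canonical_map:
  "inj_on (canonical_map C) (carrier (torus_normalizer C :: (('n::finite \<Rightarrow> 'c) \<times> _) monoid))"
proof (rule inj_onI, clarify)
  fix d d' :: "'n \<Rightarrow> 'c" and e e'
  assume x: "(d, e) \<in> carrier (torus_normalizer C)" "(d', e') \<in> carrier (torus_normalizer C)"
    and eq: "canonical_map C (d, e) = canonical_map C (d', e')"
  interpret idempotent_system_pair C e e'
    using x by (intro idempotent_system_pair.intro idempotent_systemI)
      (auto simp: carrier_torus_normalizer)
  show "d = d' \<and> e = e'"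
    using x canonical_map_inj[OF _ _ eq] by (simp add: carrier_torus_normalizer)
qed

end

text \<open>Transport along a multiplicative bijection. It gives the group axioms for the semidirect product
  from those for invertible matrices.\<close>

lemma group_by_bijection:
  assumes "group H"
    and m_closed: "\<And>x y. \<lbrakk>x \<in> carrier G; y \<in> carrier G\<rbrakk> \<Longrightarrow> x \<otimes>\<^bsub>G\<^esub> y \<in> carrier G"
    and one_closed: "\<one>\<^bsub>G\<^esub> \<in> carrier G"
    and h: "bij_betw h (carrier G) (carrier H)"
    and mult: "\<And>x y. \<lbrakk>x \<in> carrier G; y \<in> carrier G\<rbrakk> \<Longrightarrow> h (x \<otimes>\<^bsub>G\<^esub> y) = h x \<otimes>\<^bsub>H\<^esub> h y"
    and one: "h \<one>\<^bsub>G\<^esub> = \<one>\<^bsub>H\<^esub>"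
  shows "group G" "h \<in> iso G H"
proof -
  interpret H: group H by fact
  have closed: "h x \<in> carrier H" if "x \<in> carrier G" for x using h that by (auto simp: bij_betw_def)
  have eqI: "x = y" if "x \<in> carrier G" "y \<in> carrier G" "h x = h y" for x y
    using h that by (auto simp: bij_betw_def dest: inj_onD)
  show "group G"
  proof (rule groupI)
    show "x \<otimes>\<^bsub>G\<^esub> y \<otimes>\<^bsub>G\<^esub> z = x \<otimes>\<^bsub>G\<^esub> (y \<otimes>\<^bsub>G\<^esub> z)"
      if "x \<in> carrier G" "y \<in> carrier G" "z \<in> carrier G" for x y z
      using that by (intro eqI) (simp_all add: m_closed mult closed H.m_assoc)
    show "\<one>\<^bsub>G\<^esub> \<otimes>\<^bsub>G\<^esub> x = x" if "x \<in> carrier G" for x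
      using that by (intro eqI) (simp_all add: m_closed one_closed mult closed one)
    show "\<exists>y\<in>carrier G. y \<otimes>\<^bsub>G\<^esub> x = \<one>\<^bsub>G\<^esub>" if x: "x \<in> carrier G" for x
    proof -
      obtain y where y: "y \<in> carrier G" "h y = inv\<^bsub>H\<^esub> (h x)"
        using h closed[OF x] by (metis H.inv_closed bij_betw_imp_surj_on imageE)
      then have "y \<otimes>\<^bsub>G\<^esub> x = \<one>\<^bsub>G\<^esub>"
        using x by (intro eqI) (simp_all add: m_closed one_closed mult closed one)
      with y show ?thesis by blast
    qed
  qed (auto simp: m_closed one_closed)
  show "h \<in> iso G H"
    using h closed mult by (auto simp: iso_def hom_def)
qed

section \<open>Inverse matrices over an additively idempotent semiring\<close>

locale inverse_matrices = matrices C for C :: "('r, 'c) alg" (structure) +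
  fixes x y :: "'n::finite \<Rightarrow> 'n \<Rightarrow> 'c"
  assumes idem: "a \<in> carrier C \<Longrightarrow> a \<oplus> a = a"
    and x_closed [simp]: "x i j \<in> carrier C" and y_closed [simp]: "y i j \<in> carrier C"
    and xy: "(\<Oplus>k\<in>UNIV. x i k \<otimes> y k j) = (if i = j then \<one> else \<zero>)"
    and yx: "(\<Oplus>k\<in>UNIV. y i k \<otimes> x k j) = (if i = j then \<one> else \<zero>)"
begin

text \<open>Idempotence makes the semiring negative free: \<open>a = a + 0 = a + (a + b) = a + b = 0\<close>.\<close>

lemma sum_zeroD:
  assumes "a \<in> carrier C" "b \<in> carrier C" "a \<oplus> b = \<zero>"
  shows "a = \<zero>"
proof -
  have "a = a \<oplus> (a \<oplus> b)" using assms by simp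
  also have "\<dots> = a \<oplus> b" using assms(1,2) by (simp add: a_assoc[symmetric] idem)
  finally show ?thesis using assms(3) by simp
qed

lemma finsum_zeroD:
  assumes "finite A" "g \<in> A \<rightarrow> carrier C" "(\<Oplus>k\<in>A. g k) = \<zero>" "k \<in> A"
  shows "g k = \<zero>"
proof -
  have "(\<Oplus>k\<in>insert k (A - {k}). g k) = g k \<oplus> (\<Oplus>k\<in>A - {k}. g k)"
    using assms by (intro finsum_insert) auto
  then show ?thesis
    using assms by (intro sum_zeroD[of "g k" "\<Oplus>k\<in>A - {k}. g k"]) (auto simp: insert_absorb intro!: finsum_closed)
qed

lemma xy_zero: "i \<noteq> j \<Longrightarrow> x i k \<otimes> y k j = \<zero>"
  using finsum_zeroD[of UNIV "\<lambda>k. x i k \<otimes> y k j" k] xy[of i j] by simp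

lemma yx_zero: "i \<noteq> j \<Longrightarrow> y i k \<otimes> x k j = \<zero>"
  using finsum_zeroD[of UNIV "\<lambda>k. y i k \<otimes> x k j" k] yx[of i j] by simp

text \<open>In \<open>x\<^bsub>ik\<^esub> = x\<^bsub>ik\<^esub> (\<Sum>\<^sub>m y\<^bsub>km\<^esub> x\<^bsub>mk\<^esub>)\<close> only the term \<open>m = i\<close> survives. Consequently whatever is
  annihilated by \<open>y\<^bsub>ki\<^esub>\<close> is annihilated by \<open>x\<^bsub>ik\<^esub>\<close>.\<close>

lemma xyx: "x i k \<otimes> y k i \<otimes> x i k = x i k"
proof -
  have "x i k = x i k \<otimes> (\<Oplus>m\<in>UNIV. y k m \<otimes> x m k)" by (simp add: yx)
  also have "\<dots> = (\<Oplus>m\<in>UNIV. x i k \<otimes> (y k m \<otimes> x m k))" by (intro finsum_rdistr) auto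
  also have "\<dots> = x i k \<otimes> (y k i \<otimes> x i k)"
    by (intro finsum_single_term) (auto simp: m_assoc[symmetric] xy_zero)
  finally show ?thesis by (simp add: m_assoc)
qed

lemma x_row_zero:
  assumes "k \<noteq> l"
  shows "x i k \<otimes> x i l = \<zero>"
proof -
  have "x i k \<otimes> x i l = x i k \<otimes> y k i \<otimes> x i k \<otimes> x i l" by (simp add: xyx)
  also have "\<dots> = x i k \<otimes> x i k \<otimes> (y k i \<otimes> x i l)" by (simp add: m_ac)
  finally show ?thesis using assms by (simp add: yx_zero)
qed

lemma x_column_zero:
  assumes "i \<noteq> j"
  shows "x i k \<otimes> x j k = \<zero>"
proof -
  have "x i k \<otimes> x j k = x i k \<otimes> y k i \<otimes> x i k \<otimes> x j k" by (simp add: xyx)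
  also have "\<dots> = x i k \<otimes> x i k \<otimes> (x j k \<otimes> y k i)" by (simp add: m_ac)
  finally show ?thesis using assms by (simp add: xy_zero)
qed

lemma swap: "inverse_matrices C y x"
  by unfold_locales (simp_all add: idem xy yx)

lemma y_row_zero: "k \<noteq> l \<Longrightarrow> y i k \<otimes> y i l = \<zero>"
  by (rule inverse_matrices.x_row_zero[OF swap])

text \<open>The idempotent that cuts out the locus where the entry \<open>(i, j)\<close> is invertible.\<close>

definition f :: "'n \<Rightarrow> 'n \<Rightarrow> 'c" where
  "f i j = x i j \<otimes> y j i"

lemma f_closed [simp]: "f i j \<in> carrier C"
  by (simp add: f_def)

lemma f_idem: "f i j \<otimes> f i j = f i j"
proof -
  have "f i j \<otimes> f i j = (x i j \<otimes> y j i \<otimes> x i j) \<otimes> y j i" by (simp add: f_def m_ac)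
  then show ?thesis by (simp only: xyx f_def)
qed

lemma f_row_zero:
  assumes "k \<noteq> l"
  shows "f i k \<otimes> f i l = \<zero>"
proof -
  have "f i k \<otimes> f i l = (x i k \<otimes> x i l) \<otimes> (y k i \<otimes> y l i)" by (simp add: f_def m_ac)
  then show ?thesis using assms by (simp add: x_row_zero)
qed

lemma f_column_zero:
  assumes "i \<noteq> j"
  shows "f i k \<otimes> f j k = \<zero>"
proof -
  have "f i k \<otimes> f j k = (x i k \<otimes> x j k) \<otimes> (y k i \<otimes> y k j)" by (simp add: f_def m_ac)
  then show ?thesis using assms by (simp add: x_column_zero)
qed

lemma f_column_sum: "(\<Oplus>i\<in>UNIV. f i j) = \<one>"
  using yx[of j j] by (simp add: f_def m_comm)

text \<open>Cuts out the component on which \<open>x\<close> is supported on the graph of \<open>\<sigma>\<close>.\<close>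

definition idempotent :: "('n \<Rightarrow> 'n) \<Rightarrow> 'c" where
  "idempotent \<sigma> = (\<Otimes>j\<in>UNIV. f (\<sigma> j) j)"

lemma idempotent_closed [simp]: "idempotent \<sigma> \<in> carrier C"
  unfolding idempotent_def by (intro finprod_closed) auto

lemma idempotent_split: "idempotent \<sigma> = f (\<sigma> j) j \<otimes> (\<Otimes>k\<in>UNIV - {j}. f (\<sigma> k) k)"
  using finprod_insert[of "UNIV - {j}" j "\<lambda>j. f (\<sigma> j) j"]
  by (simp add: idempotent_def insert_absorb)

lemma idempotent_absorb: "idempotent \<sigma> \<otimes> f (\<sigma> j) j = idempotent \<sigma>"
proof -
  let ?P = "\<Otimes>k\<in>UNIV - {j}. f (\<sigma> k) k"
  have P: "?P \<in> carrier C" by (intro finprod_closed) auto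
  have "idempotent \<sigma> \<otimes> f (\<sigma> j) j = (f (\<sigma> j) j \<otimes> f (\<sigma> j) j) \<otimes> ?P"
    using P by (simp add: idempotent_split[of \<sigma> j] m_ac)
  then show ?thesis by (simp add: f_idem idempotent_split[of \<sigma> j])
qed

lemma idempotent_annihilate:
  assumes "a \<in> carrier C" "f (\<sigma> j) j \<otimes> a = \<zero>"
  shows "idempotent \<sigma> \<otimes> a = \<zero>"
proof -
  have "idempotent \<sigma> \<otimes> a = idempotent \<sigma> \<otimes> (f (\<sigma> j) j \<otimes> a)"
    using assms(1) by (simp add: m_assoc[symmetric] idempotent_absorb)
  then show ?thesis using assms(2) by simp
qed

lemma idempotent_x: "i \<noteq> \<sigma> j \<Longrightarrow> idempotent \<sigma> \<otimes> x i j = \<zero>"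
proof (rule idempotent_annihilate)
  assume "i \<noteq> \<sigma> j"
  then have "x (\<sigma> j) j \<otimes> x i j = \<zero>" by (intro x_column_zero) auto
  moreover have "f (\<sigma> j) j \<otimes> x i j = y j (\<sigma> j) \<otimes> (x (\<sigma> j) j \<otimes> x i j)" by (simp add: f_def m_ac)
  ultimately show "f (\<sigma> j) j \<otimes> x i j = \<zero>" by simp
qed simp

lemma idempotent_y: "i \<noteq> \<sigma> j \<Longrightarrow> idempotent \<sigma> \<otimes> y j i = \<zero>"
proof (rule idempotent_annihilate)
  assume "i \<noteq> \<sigma> j"
  then have "y j (\<sigma> j) \<otimes> y j i = \<zero>" by (intro y_row_zero) auto
  moreover have "f (\<sigma> j) j \<otimes> y j i = x (\<sigma> j) j \<otimes> (y j (\<sigma> j) \<otimes> y j i)" by (simp add: f_def m_ac)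
  ultimately show "f (\<sigma> j) j \<otimes> y j i = \<zero>" by simp
qed simp

lemma idempotent_noninjective:
  assumes "\<not> inj g"
  shows "idempotent g = \<zero>"
proof -
  obtain j l where jl: "g j = g l" "j \<noteq> l" using assms by (auto simp: inj_def)
  have "f (g j) j \<otimes> f (g l) l = \<zero>" using jl f_row_zero[of j l "g l"] by simp
  then have "idempotent g \<otimes> f (g l) l = \<zero>" by (intro idempotent_annihilate) auto
  then show ?thesis by (simp add: idempotent_absorb)
qed

text \<open>The sum is obtained by expanding \<open>1 = \<Prod>\<^sub>j \<Sum>\<^sub>i f\<^bsub>ij\<^esub>\<close>: a choice of rows \<open>i = g j\<close> that is not
  injective repeats a row and contributes nothing.\<close>

lemma idempotent_system: "restrict idempotent perms \<in> carrier (const_Sn C)"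
proof (rule const_SnI)
  show "restrict idempotent perms \<in> perms \<rightarrow>\<^sub>E carrier C" by auto
  show "restrict idempotent perms \<sigma> \<otimes> restrict idempotent perms \<tau> = \<zero>"
    if st: "\<sigma> permutes UNIV" "\<tau> permutes UNIV" "\<sigma> \<noteq> \<tau>" for \<sigma> \<tau>
  proof -
    obtain j where j: "\<sigma> j \<noteq> \<tau> j" using st(3) by blast
    have "idempotent \<tau> \<otimes> f (\<sigma> j) j = \<zero>"
      using j by (intro idempotent_annihilate[of _ _ j]) (auto simp: f_column_zero)
    moreover have "idempotent \<sigma> \<otimes> idempotent \<tau> = idempotent \<sigma> \<otimes> (idempotent \<tau> \<otimes> f (\<sigma> j) j)"
      using idempotent_absorb[of \<sigma> j] by (metis f_closed idempotent_closed m_assoc m_comm)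
    ultimately show ?thesis using st by simp
  qed
  have "\<one> = (\<Otimes>j\<in>UNIV. \<Oplus>i\<in>UNIV. f i j)" by (simp add: f_column_sum)
  also have "\<dots> = (\<Oplus>g\<in>UNIV. idempotent g)"
    unfolding idempotent_def by (subst finprod_finsum_expand) auto
  also have "\<dots> = (\<Oplus>\<sigma>\<in>perms. restrict idempotent perms \<sigma>)"
  proof (rule add.finprod_mono_neutral_cong_right)
    show "idempotent g = \<zero>" if "g \<in> UNIV - perms" for g
    proof (rule idempotent_noninjective)
      show "\<not> inj g"
      proof
        assume "inj g"
        then have "bij g" using finite_UNIV_inj_surj[of g] by (simp add: bij_def)
        then have "g permutes UNIV" by (intro bij_imp_permutes) simp_all
        with that show False by simp
      qed
    qed
  qed auto
  finally show "(\<Oplus>\<sigma>\<in>perms. restrict idempotent perms \<sigma>) = \<one>" by simp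
qed

text \<open>On the component of \<open>\<sigma>\<close> the only nonzero entry in row \<open>\<sigma> j\<close> is the one in column \<open>j\<close>, so the
  diagonal entries \<open>d\<close> have to be the row sums. Their inverses are the column sums of \<open>y\<close>.\<close>

lemma canonical_map_onto: "x \<in> canonical_map C ` carrier (torus_normalizer C)"
proof -
  define e where "e = restrict idempotent perms"
  interpret idempotent_system C e
    unfolding e_def by (rule idempotent_systemI[OF idempotent_system])
  have ex: "e \<sigma> \<otimes> x i j = \<zero>" and ey: "e \<sigma> \<otimes> y j i = \<zero>" if "\<sigma> permutes UNIV" "i \<noteq> \<sigma> j" for \<sigma> i j
    using that by (auto simp: e_def idempotent_x idempotent_y)
  define d where "d i = (\<Oplus>k\<in>UNIV. x i k)" for i
  define d' where "d' i = (\<Oplus>k\<in>UNIV. y k i)" for i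
  have cl [simp]: "d i \<in> carrier C" "d' i \<in> carrier C" for i
    by (auto simp: d_def d'_def intro!: finsum_closed)
  have ed: "e \<sigma> \<otimes> d i = e \<sigma> \<otimes> x i j" "e \<sigma> \<otimes> d' i = e \<sigma> \<otimes> y j i"
    if \<sigma>: "\<sigma> permutes UNIV" and i: "i = \<sigma> j" for \<sigma> i j
  proof -
    have ne: "i \<noteq> \<sigma> k" if "k \<noteq> j" for k using permutes_inj[OF \<sigma>] that i by (auto dest: injD)
    show "e \<sigma> \<otimes> d i = e \<sigma> \<otimes> x i j"
      unfolding d_def using \<sigma> ne
      by (subst finsum_rdistr) (auto intro!: finsum_single_term simp: ex)
    show "e \<sigma> \<otimes> d' i = e \<sigma> \<otimes> y j i"
      unfolding d'_def using \<sigma> ne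
      by (subst finsum_rdistr) (auto intro!: finsum_single_term simp: ey)
  qed
  have "d i \<otimes> d' i = \<one>" for i
  proof (rule eq_locally)
    fix \<sigma> :: "'n \<Rightarrow> 'n" assume \<sigma>: "\<sigma> permutes UNIV"
    obtain j where j: "i = \<sigma> j" using permutes_surj[OF \<sigma>] by (metis surjD)
    have "e \<sigma> \<otimes> (d i \<otimes> d' i) = (e \<sigma> \<otimes> d' i) \<otimes> x i j"
      using \<sigma> ed(1)[OF \<sigma> j] by (simp add: m_assoc[symmetric]) (simp add: m_ac)
    also have "\<dots> = e \<sigma> \<otimes> f (\<sigma> j) j"
      using \<sigma> ed(2)[OF \<sigma> j] by (simp add: f_def m_ac j)
    also have "\<dots> = e \<sigma> \<otimes> \<one>" using \<sigma> by (simp add: e_def idempotent_absorb)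
    finally show "e \<sigma> \<otimes> (d i \<otimes> d' i) = e \<sigma> \<otimes> \<one>" .
  qed auto
  then have d: "d i \<in> Units C" for i
    using m_comm[OF cl, of i i] cl[of i] unfolding Units_def by auto
  have "canonical_map C (d, e) = x"
  proof (intro ext)
    fix i j
    have "d i \<otimes> E i j = x i j"
    proof (rule eq_locally)
      fix \<sigma> :: "'n \<Rightarrow> 'n" assume \<sigma>: "\<sigma> permutes UNIV"
      have "e \<sigma> \<otimes> (d i \<otimes> E i j) = d i \<otimes> (e \<sigma> \<otimes> E i j)" using \<sigma> by (simp add: m_ac)
      also have "\<dots> = (if i = \<sigma> j then e \<sigma> \<otimes> d i else \<zero>)"
        using \<sigma> by (simp add: E_component m_comm)
      also have "\<dots> = e \<sigma> \<otimes> x i j" using \<sigma> ed(1) ex by auto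
      finally show "e \<sigma> \<otimes> (d i \<otimes> E i j) = e \<sigma> \<otimes> x i j" .
    qed auto
    then show "canonical_map C (d, e) i j = x i j" by (simp add: canonical_map_eq)
  qed
  moreover have "(d, e) \<in> carrier (torus_normalizer C)"
    using d by (simp add: carrier_torus_normalizer e)
  ultimately show ?thesis by (metis imageI)
qed

end


section \<open>The canonical isomorphism\<close>

lemma (in matrices) GL_inverse_matrices:
  assumes "\<And>a. a \<in> carrier C \<Longrightarrow> a \<oplus> a = a" "A \<in> carrier (GL C)"
  shows "\<exists>B. inverse_matrices C A B"
proof -
  obtain B where "A \<in> carrier Mat" "B \<in> carrier Mat" "B \<otimes>\<^bsub>Mat\<^esub> A = \<one>\<^bsub>Mat\<^esub>" "A \<otimes>\<^bsub>Mat\<^esub> B = \<one>\<^bsub>Mat\<^esub>"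
    using assms(2) unfolding GL_simps by blast
  then show ?thesis
    using assms(1) by (intro exI[of _ B], unfold_locales) (auto simp: Mat_simps fun_eq_iff)
qed

lemma (in matrices) canonical_map_iso:
  assumes "\<And>a. a \<in> carrier C \<Longrightarrow> a \<oplus> a = a"
  shows "group (torus_normalizer C :: (('n::finite \<Rightarrow> 'c) \<times> _) monoid)"
    and "canonical_map C \<in> iso (torus_normalizer C :: (('n \<Rightarrow> 'c) \<times> _) monoid) (GL C)"
proof -
  have "canonical_map C ` carrier (torus_normalizer C) = (carrier (GL C) :: ('n \<Rightarrow> 'n \<Rightarrow> 'c) set)"
  proof (intro equalityI subsetI)
    fix A :: "'n \<Rightarrow> 'n \<Rightarrow> 'c" assume "A \<in> carrier (GL C)"
    then obtain B where "inverse_matrices C A B" using GL_inverse_matrices assms by blast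
    then show "A \<in> canonical_map C ` carrier (torus_normalizer C)"
      by (rule inverse_matrices.canonical_map_onto)
  qed (auto intro: canonical_map_closed)
  then have bij: "bij_betw (canonical_map C) (carrier (torus_normalizer C))
      (carrier (GL C) :: ('n \<Rightarrow> 'n \<Rightarrow> 'c) set)"
    using inj_on_canonical_map by (simp add: bij_betw_def)
  show "group (torus_normalizer C :: (('n::finite \<Rightarrow> 'c) \<times> _) monoid)"
    "canonical_map C \<in> iso (torus_normalizer C :: (('n \<Rightarrow> 'c) \<times> _) monoid) (GL C)"
    by (rule group_by_bijection[OF group_GL _ _ bij];
        simp add: torus_normalizer_m_closed torus_normalizer_one)+
qed

locale matrices_hom = C: matrices C + D: matrices D
  for C D :: "('r, 'c) alg" +
  fixes h :: "'c \<Rightarrow> 'c"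
  assumes hom: "h \<in> semiring_hom C D"
begin

lemmas hom_simps [simp] = semiring_hom_simps[OF hom]

lemma hom_finsum:
  "\<lbrakk>finite A; g \<in> A \<rightarrow> carrier C\<rbrakk> \<Longrightarrow> h (\<Oplus>\<^bsub>C\<^esub>i\<in>A. g i) = (\<Oplus>\<^bsub>D\<^esub>i\<in>A. h (g i))"
  by (rule semiring_hom_finsum[OF hom C.csemiring_axioms D.csemiring_axioms])

lemma hom_Units: "a \<in> Units C \<Longrightarrow> h a \<in> Units D"
  by (auto simp: Units_def) (metis hom_simps(1,2,4))

lemma GL_map_Mat:
  fixes A B :: "'n::finite \<Rightarrow> 'n \<Rightarrow> 'c"
  assumes "A \<in> carrier C.Mat" "B \<in> carrier C.Mat"
  shows "GL_map h A \<in> carrier D.Mat"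
    and "GL_map h (A \<otimes>\<^bsub>C.Mat\<^esub> B) = GL_map h A \<otimes>\<^bsub>D.Mat\<^esub> GL_map h B"
  using assms by (auto simp: GL_map_def C.Mat_simps D.Mat_simps hom_finsum Pi_iff)

lemma GL_map_one: "GL_map h \<one>\<^bsub>C.Mat\<^esub> = (\<one>\<^bsub>D.Mat\<^esub> :: 'n::finite \<Rightarrow> 'n \<Rightarrow> 'c)"
  by (intro ext) (simp add: GL_map_def C.Mat_simps D.Mat_simps)

lemma GL_map_hom: "GL_map h \<in> hom (GL C :: ('n::finite \<Rightarrow> 'n \<Rightarrow> 'c) monoid) (GL D)"
proof (rule homI)
  fix A :: "'n \<Rightarrow> 'n \<Rightarrow> 'c" assume A: "A \<in> carrier (GL C)"
  then obtain B where AB: "A \<in> carrier C.Mat" "B \<in> carrier C.Mat"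
      "B \<otimes>\<^bsub>C.Mat\<^esub> A = \<one>\<^bsub>C.Mat\<^esub>" "A \<otimes>\<^bsub>C.Mat\<^esub> B = \<one>\<^bsub>C.Mat\<^esub>"
    unfolding C.GL_simps by blast
  have "GL_map h B \<otimes>\<^bsub>D.Mat\<^esub> GL_map h A = \<one>\<^bsub>D.Mat\<^esub>" "GL_map h A \<otimes>\<^bsub>D.Mat\<^esub> GL_map h B = \<one>\<^bsub>D.Mat\<^esub>"
    using AB by (simp_all flip: GL_map_Mat(2) add: GL_map_one)
  then show "GL_map h A \<in> carrier (GL D)"
    using GL_map_Mat(1)[OF AB(1,1)] GL_map_Mat(1)[OF AB(2,2)] unfolding D.GL_simps by blast
  fix B' :: "'n \<Rightarrow> 'n \<Rightarrow> 'c" assume "B' \<in> carrier (GL C)"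
  then show "GL_map h (A \<otimes>\<^bsub>GL C\<^esub> B') = GL_map h A \<otimes>\<^bsub>GL D\<^esub> GL_map h B'"
    using A GL_map_Mat(2)[of A B'] by (simp add: C.GL_simps D.GL_simps)
qed

lemma torus_normalizer_map_closed:
  fixes t :: "('n::finite \<Rightarrow> 'c) \<times> (('n \<Rightarrow> 'n) \<Rightarrow> 'c)"
  assumes "t \<in> carrier (torus_normalizer C)"
  shows "torus_normalizer_map h t \<in> carrier (torus_normalizer D)"
    and "canonical_map D (torus_normalizer_map h t) = GL_map h (canonical_map C t)"
proof -
  obtain d e where t: "t = (d, e)" by (cases t) auto
  have d: "\<And>i. d i \<in> Units C" and e: "e \<in> carrier (const_Sn C)"
    using assms by (auto simp: t C.carrier_torus_normalizer)
  have dC: "d i \<in> carrier C" for i using d by auto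
  interpret e: idempotent_system C e by (rule C.idempotent_systemI[OF e])
  let ?e = "\<lambda>\<sigma>\<in>perms. h (e \<sigma>)"
  have he: "?e \<in> carrier (const_Sn D)"
  proof (rule const_SnI)
    show "?e \<sigma> \<otimes>\<^bsub>D\<^esub> ?e \<tau> = \<zero>\<^bsub>D\<^esub>" if "\<sigma> permutes UNIV" "\<tau> permutes UNIV" "\<sigma> \<noteq> \<tau>" for \<sigma> \<tau>
      using that by (simp flip: hom_simps(2) add: e.e_orthogonal)
    have "(\<Oplus>\<^bsub>D\<^esub>\<sigma>\<in>perms. ?e \<sigma>) = h (\<Oplus>\<^bsub>C\<^esub>\<sigma>\<in>perms. e \<sigma>)"
      by (subst hom_finsum) (auto intro!: D.finsum_cong')
    then show "(\<Oplus>\<^bsub>D\<^esub>\<sigma>\<in>perms. ?e \<sigma>) = \<one>\<^bsub>D\<^esub>" by (simp add: e.e_sum)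
  qed auto
  show "torus_normalizer_map h t \<in> carrier (torus_normalizer D)"
    using d he by (simp add: t torus_normalizer_map_def D.carrier_torus_normalizer hom_Units)
  interpret he: idempotent_system D ?e by (rule D.idempotent_systemI[OF he])
  have hP: "h (perm_matrix C \<sigma> i j) = perm_matrix D \<sigma> i j" for \<sigma> :: "'n \<Rightarrow> 'n" and i j
    by (simp add: perm_matrix_def)
  have "h (e.E i j) = he.E i j" for i j
    unfolding e.E_def he.E_def by (subst hom_finsum) (auto intro!: D.finsum_cong' simp: hP)
  then show "canonical_map D (torus_normalizer_map h t) = GL_map h (canonical_map C t)"
    using dC by (intro ext)
      (simp add: t torus_normalizer_map_def GL_map_def e.canonical_map_eq he.canonical_map_eq)
qed

end

lemma matrices_homI:
  assumes "is_algebra R C" "is_algebra R D" "h \<in> alg_hom R C D"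
  shows "matrices_hom C D h"
  using assms
  by (auto simp: matrices_hom_def matrices_hom_axioms_def matrices_def is_algebra_def alg_hom_def)

theorem canonical_map_group_functor_iso:
  fixes R :: "'r ring"
  assumes idem: "\<And>(C :: ('r, 'c) alg) a. \<lbrakk>is_algebra R C; a \<in> carrier C\<rbrakk> \<Longrightarrow> a \<oplus>\<^bsub>C\<^esub> a = a"
  shows "group_functor_iso R
    (torus_normalizer :: ('r, 'c) alg \<Rightarrow> (('n::finite \<Rightarrow> 'c) \<times> (('n \<Rightarrow> 'n) \<Rightarrow> 'c)) monoid)
    torus_normalizer_map GL GL_map canonical_map"
  unfolding group_functor_iso_def
proof (intro conjI allI impI ballI)
  have mat: "matrices C" if "is_algebra R C" for C :: "('r, 'c) alg"
    using that by (simp add: matrices_def is_algebra_def)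
  show "group_functor R (GL :: ('r, 'c) alg \<Rightarrow> ('n \<Rightarrow> 'n \<Rightarrow> 'c) monoid) GL_map"
    unfolding group_functor_def
    using matrices.group_GL[OF mat] matrices_hom.GL_map_hom[OF matrices_homI]
    by (auto simp: GL_map_def)
  show iso: "canonical_map C \<in> iso (torus_normalizer C :: (('n \<Rightarrow> 'c) \<times> _) monoid) (GL C)"
    if "is_algebra R C" for C :: "('r, 'c) alg"
    using matrices.canonical_map_iso(2)[OF mat[OF that]] idem[OF that] by blast
  show nat: "canonical_map D (torus_normalizer_map h t) = GL_map h (canonical_map C t)"
    if "is_algebra R C \<and> is_algebra R D \<and> h \<in> alg_hom R C D" "t \<in> carrier (torus_normalizer C)"
    for C D :: "('r, 'c) alg" and h and t :: "('n \<Rightarrow> 'c) \<times> (('n \<Rightarrow> 'n) \<Rightarrow> 'c)"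
    using that by (intro matrices_hom.torus_normalizer_map_closed(2)[OF matrices_homI]) auto
  show "group_functor R (torus_normalizer :: ('r, 'c) alg \<Rightarrow> (('n \<Rightarrow> 'c) \<times> _) monoid) torus_normalizer_map"
    unfolding group_functor_def
  proof (intro conjI allI impI ballI)
    fix C :: "('r, 'c) alg" assume C: "is_algebra R C"
    interpret matrices C by (rule mat[OF C])
    show "group (torus_normalizer C :: (('n \<Rightarrow> 'c) \<times> _) monoid)"
      using canonical_map_iso(1) idem[OF C] by blast
    show "torus_normalizer_map id t = t" if "t \<in> carrier (torus_normalizer C)"
      for t :: "('n \<Rightarrow> 'c) \<times> (('n \<Rightarrow> 'n) \<Rightarrow> 'c)"
      using that
      by (cases t) (auto simp: carrier_torus_normalizer torus_normalizer_map_def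
          const_Sn_def PiE_def extensional_restrict)
  next
    fix C D :: "('r, 'c) alg" and h
    assume CD: "is_algebra R C \<and> is_algebra R D \<and> h \<in> alg_hom R C D"
    interpret matrices_hom C D h using CD by (intro matrices_homI) auto
    show "torus_normalizer_map h \<in> hom (torus_normalizer C :: (('n \<Rightarrow> 'c) \<times> _) monoid) (torus_normalizer D)"
    proof (rule homI)
      fix t u :: "('n \<Rightarrow> 'c) \<times> (('n \<Rightarrow> 'n) \<Rightarrow> 'c)"
      assume t: "t \<in> carrier (torus_normalizer C)"
      show "torus_normalizer_map h t \<in> carrier (torus_normalizer D)"
        by (rule torus_normalizer_map_closed(1)[OF t])
      assume u: "u \<in> carrier (torus_normalizer C)"
      let ?F = "torus_normalizer_map h"
      note closed = torus_normalizer_map_closed(1)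
      note tu = C.torus_normalizer_m_closed[OF t u]
      \<comment> \<open>Both sides have the same image under the injective canonical map of \<open>D\<close>.\<close>
      have "canonical_map D (?F (t \<otimes>\<^bsub>torus_normalizer C\<^esub> u)) =
          GL_map h (canonical_map C t \<otimes>\<^bsub>GL C\<^esub> canonical_map C u)"
        by (simp only: torus_normalizer_map_closed(2)[OF tu(1)] tu(2))
      also have "\<dots> = GL_map h (canonical_map C t) \<otimes>\<^bsub>GL D\<^esub> GL_map h (canonical_map C u)"
        by (intro hom_mult[OF GL_map_hom] C.canonical_map_closed t u)
      also have "\<dots> = canonical_map D (?F t \<otimes>\<^bsub>torus_normalizer D\<^esub> ?F u)"
        by (simp only: D.torus_normalizer_m_closed(2)[OF closed[OF t] closed[OF u]]
            torus_normalizer_map_closed(2)[OF t] torus_normalizer_map_closed(2)[OF u])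
      finally show "?F (t \<otimes>\<^bsub>torus_normalizer C\<^esub> u) = ?F t \<otimes>\<^bsub>torus_normalizer D\<^esub> ?F u"
        by (rule inj_onD[OF D.inj_on_canonical_map])
           (intro closed tu(1) D.torus_normalizer_m_closed(1) t u)+
    qed
  next
    fix g h and t :: "('n \<Rightarrow> 'c) \<times> (('n \<Rightarrow> 'n) \<Rightarrow> 'c)"
    show "torus_normalizer_map (g \<circ> h) t = torus_normalizer_map g (torus_normalizer_map h t)"
      by (cases t) (auto simp: torus_normalizer_map_def)
  qed
qed

text \<open>The relation \<open>1 + 1 = 1\<close> is inherited from the Boolean semifield.\<close>

lemma bool_algebra_idempotent:
  assumes "is_algebra bool_semifield C" "a \<in> carrier C"
  shows "a \<oplus>\<^bsub>C\<^esub> a = a"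
proof -
  interpret csemiring C using assms(1) by (simp add: is_algebra_def)
  have s: "structure_map C \<in> semiring_hom bool_semifield C"
    using assms(1) by (simp add: is_algebra_def)
  have "\<one>\<^bsub>C\<^esub> \<oplus>\<^bsub>C\<^esub> \<one>\<^bsub>C\<^esub> = \<one>\<^bsub>C\<^esub>"
    using semiring_hom_simps(3)[OF s, of True True] semiring_hom_simps(4)[OF s]
    by (simp add: bool_semifield_def)
  then have "(\<one>\<^bsub>C\<^esub> \<oplus>\<^bsub>C\<^esub> \<one>\<^bsub>C\<^esub>) \<otimes>\<^bsub>C\<^esub> a = \<one>\<^bsub>C\<^esub> \<otimes>\<^bsub>C\<^esub> a" by simp
  then show ?thesis using assms(2) by (simp add: l_distr)
qed

section \<open>A dual basis of the coordinate algebra over the Boolean semifield\<close>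

lemma keys_add_nat: "keys (p + q) = keys p \<union> keys q" for p q :: "'a \<Rightarrow>\<^sub>0 nat"
  by (auto simp: in_keys_iff lookup_add)

lemma keys_sum_nat: "keys (sum p I) = (\<Union>i\<in>I. keys (p i))" if "finite I"
  for p :: "'i \<Rightarrow> 'a \<Rightarrow>\<^sub>0 nat"
  using that by (induction I) (auto simp: keys_add_nat)

lemma keys_mult_nat:
  fixes p q :: "'a::comm_monoid_add \<Rightarrow>\<^sub>0 nat"
  shows "keys (p * q) = (\<Union>m\<in>keys p. \<Union>m'\<in>keys q. {m + m'})"
  by (subst poly_mult_sum_single) (simp add: keys_sum_nat in_keys_iff)

text \<open>The monomials that do not vanish on the component of \<open>\<sigma>\<close> are those in the entries of \<open>x\<close> and
  \<open>y\<close> at the positions \<open>(\<sigma> j, j)\<close> and \<open>(j, \<sigma> j)\<close>. On that component \<open>x\<^bsub>\<sigma> j, j\<^esub>\<close> and \<open>y\<^bsub>j, \<sigma> j\<^esub>\<close> are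
  inverse units, so only the difference of their exponents matters.\<close>

fun on_graph :: "('n \<Rightarrow> 'n) \<Rightarrow> 'n gl_var \<Rightarrow> bool" where
  "on_graph \<sigma> (X_entry i j) \<longleftrightarrow> i = \<sigma> j"
| "on_graph \<sigma> (Y_entry j i) \<longleftrightarrow> i = \<sigma> j"

definition compatible :: "('n \<Rightarrow> 'n) \<Rightarrow> ('n gl_var \<Rightarrow>\<^sub>0 nat) \<Rightarrow> bool" where
  "compatible \<sigma> m \<longleftrightarrow> (\<forall>v\<in>keys m. on_graph \<sigma> v)"

definition weight :: "('n \<Rightarrow> 'n) \<Rightarrow> ('n gl_var \<Rightarrow>\<^sub>0 nat) \<Rightarrow> 'n \<Rightarrow> int" where
  "weight \<sigma> m j = int (lookup m (X_entry (\<sigma> j) j)) - int (lookup m (Y_entry j (\<sigma> j)))"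

text \<open>The Laurent monomials \<open>(\<sigma>, a)\<close> that occur in a polynomial, where \<open>a\<close> lists the exponents of the
  \<open>x\<^bsub>\<sigma> j, j\<^esub>\<close>. Natural coefficients cannot cancel, so supports add and multiply like the polynomials.\<close>

definition poly_support :: "'n::finite gl_poly \<Rightarrow> (('n \<Rightarrow> 'n) \<times> ('n \<Rightarrow> int)) set" where
  "poly_support p = {(\<sigma>, weight \<sigma> m) | \<sigma> m. \<sigma> permutes UNIV \<and> m \<in> keys p \<and> compatible \<sigma> m}"

lemma compatible_add: "compatible \<sigma> (m + m') \<longleftrightarrow> compatible \<sigma> m \<and> compatible \<sigma> m'"
  by (auto simp: compatible_def keys_add_nat)

lemma weight_add: "weight \<sigma> (m + m') = (\<lambda>j. weight \<sigma> m j + weight \<sigma> m' j)"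
  by (auto simp: weight_def lookup_add)

lemma weight_zero: "weight \<sigma> 0 = (\<lambda>_. 0)"
  by (auto simp: weight_def)

lemma finite_poly_support: "finite (poly_support p)"
proof -
  have "poly_support p \<subseteq> (\<lambda>(\<sigma>, m). (\<sigma>, weight \<sigma> m)) ` (perms \<times> keys p)"
    by (auto simp: poly_support_def)
  then show ?thesis by (rule finite_subset) auto
qed

lemma poly_support_add: "poly_support (p + q) = poly_support p \<union> poly_support q"
  by (auto simp: poly_support_def keys_add_nat)

lemma poly_support_zero: "poly_support 0 = {}"
  by (simp add: poly_support_def)

lemma poly_support_sum: "finite I \<Longrightarrow> poly_support (sum p I) = (\<Union>i\<in>I. poly_support (p i))"
  by (induction I rule: finite_induct) (auto simp: poly_support_add poly_support_zero)

lemma poly_support_one: "poly_support 1 = perms \<times> {\<lambda>_. 0}"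
  by (auto simp: poly_support_def compatible_def weight_zero)

lemma poly_support_mult:
  "poly_support (p * q) = {(\<sigma>, \<lambda>j. a j + b j) | \<sigma> a b. (\<sigma>, a) \<in> poly_support p \<and> (\<sigma>, b) \<in> poly_support q}"
proof (intro equalityI subsetI)
  fix \<kappa> assume "\<kappa> \<in> poly_support (p * q)"
  then obtain \<sigma> m m' where *: "\<kappa> = (\<sigma>, weight \<sigma> (m + m'))" "\<sigma> permutes UNIV" "m \<in> keys p" "m' \<in> keys q"
      "compatible \<sigma> m" "compatible \<sigma> m'"
    by (auto simp: poly_support_def keys_mult_nat compatible_add)
  then have "(\<sigma>, weight \<sigma> m) \<in> poly_support p" "(\<sigma>, weight \<sigma> m') \<in> poly_support q"
    by (auto simp: poly_support_def)
  then show "\<kappa> \<in> {(\<sigma>, \<lambda>j. a j + b j) | \<sigma> a b. (\<sigma>, a) \<in> poly_support p \<and> (\<sigma>, b) \<in> poly_support q}"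
    using *(1) unfolding weight_add by blast
next
  fix \<kappa> assume "\<kappa> \<in> {(\<sigma>, \<lambda>j. a j + b j) | \<sigma> a b. (\<sigma>, a) \<in> poly_support p \<and> (\<sigma>, b) \<in> poly_support q}"
  then obtain \<sigma> m m' where "\<kappa> = (\<sigma>, weight \<sigma> (m + m'))" "\<sigma> permutes UNIV" "m \<in> keys p" "m' \<in> keys q"
      "compatible \<sigma> m" "compatible \<sigma> m'"
    by (auto simp: poly_support_def weight_add)
  moreover from this have "m + m' \<in> keys (p * q)" by (auto simp: keys_mult_nat)
  ultimately show "\<kappa> \<in> poly_support (p * q)"
    unfolding poly_support_def using compatible_add by blast
qed

lemma poly_support_var_pair:
  "poly_support (poly_var (X_entry i k) * poly_var (Y_entry l j)) =
    {(\<sigma>, weight \<sigma> (Poly_Mapping.single (X_entry i k) 1 + Poly_Mapping.single (Y_entry l j) 1)) | \<sigma>.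
      \<sigma> permutes UNIV \<and> i = \<sigma> k \<and> j = \<sigma> l}"
  by (auto simp: poly_support_def poly_var_def mult_single compatible_def keys_add_nat)

lemma weight_pair:
  "weight \<sigma> (Poly_Mapping.single (X_entry (\<sigma> k) k) 1 + Poly_Mapping.single (Y_entry k (\<sigma> k)) 1) = (\<lambda>_. 0)"
  by (auto simp: weight_def lookup_add lookup_single when_def)

text \<open>A permutation meets every row and every column once. Hence in the sum over \<open>k\<close> a given \<open>\<sigma>\<close>
  contributes one term when \<open>i = j\<close>, of weight zero, and no term otherwise.\<close>

lemma poly_support_gl_cong:
  assumes "(p, q) \<in> gl_cong"
  shows "poly_support p = poly_support q"
  using assms
proof (induction rule: gl_cong.induct)
  case (XY i j)
  have "poly_support (poly_var (X_entry i k) * poly_var (Y_entry k j)) =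
      {(\<sigma>, \<lambda>_. 0) | \<sigma>. \<sigma> permutes UNIV \<and> i = \<sigma> k \<and> j = \<sigma> k}" for k
    unfolding poly_support_var_pair by (auto simp: weight_pair[simplified])
  moreover have "\<exists>k. j = \<sigma> k" if "\<sigma> permutes UNIV" for \<sigma> :: "'a \<Rightarrow> 'a"
    using permutes_surj[OF that] by (metis surjD)
  ultimately show ?case
    by (auto simp: poly_support_sum poly_support_one poly_support_zero)
next
  case (YX i j)
  have "poly_support (poly_var (Y_entry i k) * poly_var (X_entry k j)) =
      (if i = j then {(\<sigma>, \<lambda>_. 0) | \<sigma>. \<sigma> permutes UNIV \<and> k = \<sigma> i} else {})" for k
  proof -
    have "\<sigma> j \<noteq> \<sigma> i" if "\<sigma> permutes UNIV" "i \<noteq> j" for \<sigma> :: "'a \<Rightarrow> 'a"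
      using permutes_inj[OF that(1)] that(2) by (auto dest: injD)
    then show ?thesis
      unfolding mult.commute[of "poly_var (Y_entry i k)"] poly_support_var_pair
      by (auto simp: weight_pair[simplified])
  qed
  then show ?case
    by (auto simp: poly_support_sum poly_support_one poly_support_zero)
qed (auto simp: poly_support_add poly_support_mult)

lemma bool_semifield_simps:
  "carrier bool_semifield = UNIV"
  "\<zero>\<^bsub>bool_semifield\<^esub> = False" "\<one>\<^bsub>bool_semifield\<^esub> = True"
  "r \<oplus>\<^bsub>bool_semifield\<^esub> s = (r \<or> s)" "r \<otimes>\<^bsub>bool_semifield\<^esub> s = (r \<and> s)"
  by (simp_all add: bool_semifield_def)

lemma csemiring_bool: "csemiring bool_semifield"
  by unfold_locales (auto simp: bool_semifield_def)

lemma (in csemiring) finsum_idempotent_image: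
  assumes idem: "\<And>a. a \<in> carrier R \<Longrightarrow> a \<oplus> a = a"
    and "finite I" "\<And>k. k \<in> h ` I \<Longrightarrow> g k \<in> carrier R"
  shows "(\<Oplus>i\<in>I. g (h i)) = (\<Oplus>k\<in>h ` I. g k)"
  using assms(2,3)
proof (induction I)
  case (insert i I)
  have cl: "(\<Oplus>k\<in>h ` I. g k) \<in> carrier R" using insert by (intro finsum_closed) auto
  have "(\<Oplus>i\<in>insert i I. g (h i)) = g (h i) \<oplus> (\<Oplus>k\<in>h ` I. g k)"
    using insert by (subst finsum_insert) auto
  also have "\<dots> = (\<Oplus>k\<in>h ` insert i I. g k)"
  proof (cases "h i \<in> h ` I")
    case False
    then show ?thesis using insert by (subst image_insert, subst finsum_insert) auto
  next
    case True
    let ?r = "\<Oplus>k\<in>h ` I - {h i}. g k"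
    have r: "?r \<in> carrier R" using insert by (intro finsum_closed) auto
    have "(\<Oplus>k\<in>insert (h i) (h ` I - {h i}). g k) = g (h i) \<oplus> ?r"
      using insert by (intro finsum_insert) auto
    then have split: "(\<Oplus>k\<in>h ` I. g k) = g (h i) \<oplus> ?r"
      using True by (simp add: insert_absorb)
    have "g (h i) \<oplus> (g (h i) \<oplus> ?r) = g (h i) \<oplus> ?r"
      using r insert.prems by (subst a_assoc[symmetric]) (auto simp: idem)
    then show ?thesis using True split by (simp add: insert_absorb)
  qed
  finally show ?case .
qed simp

locale gl_bool =
  fixes n :: "'n::finite itself"

sublocale gl_bool \<subseteq> gl_over bool_semifield n
  by (intro gl_over.intro csemiring_bool)

context gl_bool
begin

abbreviation X :: "'n \<Rightarrow> 'n \<Rightarrow> (bool \<times> 'n gl_poly set) multiset set" where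
  "X i j \<equiv> poly_elem (poly_var (X_entry i j))"

abbreviation Y :: "'n \<Rightarrow> 'n \<Rightarrow> (bool \<times> 'n gl_poly set) multiset set" where
  "Y i j \<equiv> poly_elem (poly_var (Y_entry i j))"

lemma csemiring_B: "csemiring B"
  using gl_algebra_is_algebra by (simp add: is_algebra_def)

lemma poly_elem_sum:
  assumes "finite I"
  shows "poly_elem (sum p I) = (\<Oplus>\<^bsub>B\<^esub>i\<in>I. poly_elem (p i))"
proof -
  interpret csemiring B by (rule csemiring_B)
  show ?thesis
    using assms by (induction I) (simp_all add: poly_elem_zero poly_elem_add finsum_insert)
qed

end

sublocale gl_bool \<subseteq> gen: inverse_matrices B X Y
proof (intro inverse_matrices.intro matrices.intro inverse_matrices_axioms.intro csemiring_B)
  show "a \<oplus>\<^bsub>B\<^esub> a = a" if "a \<in> carrier B" for a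
    by (rule bool_algebra_idempotent[OF gl_algebra_is_algebra that])
  have "poly_elem (if i = j then 1 else 0) = (if i = j then \<one>\<^bsub>B\<^esub> else \<zero>\<^bsub>B\<^esub>)" for i j :: 'n
    by (simp add: poly_elem_one poly_elem_zero)
  then show "(\<Oplus>\<^bsub>B\<^esub>k\<in>UNIV. X i k \<otimes>\<^bsub>B\<^esub> Y k j) = (if i = j then \<one>\<^bsub>B\<^esub> else \<zero>\<^bsub>B\<^esub>)"
    "(\<Oplus>\<^bsub>B\<^esub>k\<in>UNIV. Y i k \<otimes>\<^bsub>B\<^esub> X k j) = (if i = j then \<one>\<^bsub>B\<^esub> else \<zero>\<^bsub>B\<^esub>)" for i j
    using poly_elem_cong[OF gl_cong.XY[of i j]] poly_elem_cong[OF gl_cong.YX[of i j]]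
    by (simp_all add: poly_elem_sum poly_elem_mult)
qed simp_all

context gl_bool
begin

lemma poly_elem_surj:
  assumes "z \<in> carrier B"
  obtains p where "z = poly_elem p"
proof -
  obtain w where w: "w \<in> T.words" "z = cls w"
    using assms base_change_E unfolding gl_algebra_def by blast
  have "\<exists>p. cls w = poly_elem p"
    using w(1)
  proof (induction w)
    case empty
    show ?case using poly_elem_zero by (metis base_change_simps(2) gl_algebra_def)
  next
    case (add u w)
    obtain r p where u: "u = (r, gl_class p)"
      using add.prems by (cases u) (auto simp: carrier_gl_nat_algebra)
    obtain q where q: "cls w = poly_elem q" using add by auto
    have uw: "{#u#} \<in> T.words" "w \<in> T.words" using add.prems by auto
    have "cls {#u#} = poly_elem (if r then p else 0)"
    proof (cases r)
      case True
      then show ?thesis by (simp add: poly_elem_def u bool_semifield_simps)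
    next
      case False
      have "cls {#u#} = cls {#}"
        using tensor_rel.zero_left[where R = nat_semiring and M = "nat_module bool_semifield" and
            N = "nat_module gl_nat_algebra" and n = "gl_class p"] False
        by (intro T.cls_eqI) (simp add: u carrier_gl_nat_algebra bool_semifield_simps)
      then show ?thesis
        using False by (simp add: poly_elem_zero gl_algebra_def base_change_simps)
    qed
    then have "cls ({#u#} + w) = poly_elem ((if r then p else 0) + q)"
      using q base_change_add[OF uw] by (simp only: poly_elem_add gl_algebra_def)
    then show ?case by auto
  qed
  then show ?thesis using that w by auto
qed

text \<open>For a fixed index \<open>\<kappa>\<close>, the truth value of \<open>r \<and> \<kappa> \<in> poly_support p\<close> is bilinear in \<open>r\<close> and the
  class of \<open>p\<close>, so it is an invariant of the image of \<open>p\<close> in \<open>\<bool> \<otimes> A\<^sub>n\<close>.\<close>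

lemma poly_support_well_defined:
  assumes "poly_elem p = poly_elem q"
  shows "poly_support p = poly_support q"
proof -
  let ?P = "regular_module bool_semifield"
  define csupp :: "'n gl_poly set \<Rightarrow> _" where "csupp c = poly_support (SOME p. p \<in> c)" for c
  have csupp: "csupp (gl_class p) = poly_support p" for p
  proof -
    have "(SOME q. q \<in> gl_class p) \<in> gl_class p"
      by (rule someI[of _ p]) (simp add: gl_cong.refl)
    then show ?thesis unfolding csupp_def using poly_support_gl_cong by blast
  qed
  interpret P: semimodule bool_semifield ?P by (rule semimodule_regular[OF csemiring_bool])
  have rel: "({#(\<one>\<^bsub>bool_semifield\<^esub>, gl_class p)#}, {#(\<one>\<^bsub>bool_semifield\<^esub>, gl_class q)#})
      \<in> tensor_rel nat_semiring (nat_module bool_semifield) (nat_module gl_nat_algebra)"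
    using assms T.cls_eq_iff[OF poly_word poly_word] by (simp add: poly_elem_def)
  have A: "csupp (c \<oplus>\<^bsub>gl_nat_algebra\<^esub> d) = csupp c \<union> csupp d"
    if "c \<in> carrier gl_nat_algebra" "d \<in> carrier gl_nat_algebra" for c d
    using that by (auto simp: carrier_gl_nat_algebra gl_class_simps csupp poly_support_add)
  have Z: "csupp \<zero>\<^bsub>gl_nat_algebra\<^esub> = {}" by (simp add: gl_class_simps csupp poly_support_zero)
  have bool_multiple: "[k] \<cdot>\<^bsub>bool_semifield\<^esub> r \<longleftrightarrow> k \<noteq> 0 \<and> r" for k :: nat and r
    by (induction k) (auto, auto simp: bool_semifield_simps)
  have multiple: "csupp ([k] \<cdot>\<^bsub>gl_nat_algebra\<^esub> c) = (if k = 0 then {} else csupp c)"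
    if "c \<in> carrier gl_nat_algebra" for k :: nat and c
    using that by (induction k) (auto simp: A Z)
  have "\<kappa> \<in> poly_support p \<longleftrightarrow> \<kappa> \<in> poly_support q" for \<kappa>
  proof -
    have "msum ?P (\<lambda>(r, c). r \<and> \<kappa> \<in> csupp c) {#(\<one>\<^bsub>bool_semifield\<^esub>, gl_class p)#} =
        msum ?P (\<lambda>(r, c). r \<and> \<kappa> \<in> csupp c) {#(\<one>\<^bsub>bool_semifield\<^esub>, gl_class q)#}"
      by (rule T.msum_tensor_rel[OF P.M.abelian_monoid_axioms _ _ _ _ _ _ rel])
         (auto simp: A Z bool_multiple multiple regular_module_def bool_semifield_simps)
    moreover have "x \<in> carrier ?P" for x
      by (simp add: regular_module_def bool_semifield_simps)
    ultimately show ?thesis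
      by (simp add: csupp bool_semifield_simps)
  qed
  then show ?thesis by blast
qed

definition coefficient :: "('n \<Rightarrow> 'n) \<times> ('n \<Rightarrow> int) \<Rightarrow> (bool \<times> 'n gl_poly set) multiset set \<Rightarrow> bool" where
  "coefficient \<kappa> z \<longleftrightarrow> (\<exists>p. z = poly_elem p \<and> \<kappa> \<in> poly_support p)"

lemma coefficient_poly_elem: "coefficient \<kappa> (poly_elem p) \<longleftrightarrow> \<kappa> \<in> poly_support p"
  using poly_support_well_defined[of p] unfolding coefficient_def by blast

definition mon :: "('n gl_var \<Rightarrow>\<^sub>0 nat) \<Rightarrow> (bool \<times> 'n gl_poly set) multiset set" where
  "mon m = poly_elem (Poly_Mapping.single m 1)"

lemma mon_closed [simp]: "mon m \<in> carrier B"
  by (simp add: mon_def)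

lemma mon_add: "mon (m + m') = mon m \<otimes>\<^bsub>B\<^esub> mon m'"
  by (simp add: mon_def poly_elem_mult[symmetric] mult_single)

lemma mon_zero: "mon 0 = \<one>\<^bsub>B\<^esub>"
  unfolding mon_def single_one by (rule poly_elem_one)

lemma mon_sum: "finite I \<Longrightarrow> mon (sum m I) = (\<Otimes>\<^bsub>B\<^esub>i\<in>I. mon (m i))"
  by (induction I rule: finite_induct) (simp_all add: mon_zero mon_add)

lemma mon_var:
  "mon (Poly_Mapping.single (X_entry i j) 1) = X i j"
  "mon (Poly_Mapping.single (Y_entry i j) 1) = Y i j"
  by (simp_all add: mon_def poly_var_def)

lemma poly_elem_eq_sum_mon: "poly_elem p = (\<Oplus>\<^bsub>B\<^esub>m\<in>keys p. mon m)"
proof -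
  have multiple: "poly_elem (Poly_Mapping.single m (Suc c)) = mon m" for m c
  proof (induction c)
    case (Suc c)
    have "Poly_Mapping.single m (Suc (Suc c)) = Poly_Mapping.single m (Suc c) + Poly_Mapping.single m 1"
      by (simp add: single_add[symmetric])
    then show ?case
      using Suc gen.idem[OF mon_closed[of m]] by (simp only: poly_elem_add mon_def)
  qed (simp add: mon_def)
  have "poly_elem p = (\<Oplus>\<^bsub>B\<^esub>m\<in>keys p. poly_elem (Poly_Mapping.single m (lookup p m)))"
    using poly_elem_sum[of "keys p" "\<lambda>m. Poly_Mapping.single m (lookup p m)"]
      poly_mapping_sum_single[of p] by simp
  also have "\<dots> = (\<Oplus>\<^bsub>B\<^esub>m\<in>keys p. mon m)"
  proof (rule gen.finsum_cong')
    fix m assume "m \<in> keys p"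
    then obtain c where "lookup p m = Suc c" by (metis in_keys_iff not0_implies_Suc)
    then show "poly_elem (Poly_Mapping.single m (lookup p m)) = mon m" by (simp add: multiple)
  qed auto
  finally show ?thesis .
qed

text \<open>The monomial \<open>x\<^bsub>\<sigma> j, j\<^esub>\<^sup>a y\<^bsub>j, \<sigma> j\<^esub>\<^sup>b\<close>.\<close>

definition graph_mon :: "('n \<Rightarrow> 'n) \<Rightarrow> 'n \<Rightarrow> nat \<Rightarrow> nat \<Rightarrow> ('n gl_var \<Rightarrow>\<^sub>0 nat)" where
  "graph_mon \<sigma> j a b =
    Poly_Mapping.single (X_entry (\<sigma> j) j) a + Poly_Mapping.single (Y_entry j (\<sigma> j)) b"

lemma graph_mon_add: "graph_mon \<sigma> j (a + a') (b + b') = graph_mon \<sigma> j a b + graph_mon \<sigma> j a' b'"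
  by (simp add: graph_mon_def single_add ac_simps)

lemma mon_graph_mon_11: "mon (graph_mon \<sigma> j 1 1) = gen.f (\<sigma> j) j"
  unfolding graph_mon_def mon_add mon_var gen.f_def ..

lemma mon_graph_mon_reduce:
  "mon (graph_mon \<sigma> j (Suc (Suc a)) (Suc (Suc b))) = mon (graph_mon \<sigma> j (Suc a) (Suc b))"
proof -
  have "mon (graph_mon \<sigma> j (a + 1 + 1) (b + 1 + 1)) = mon (graph_mon \<sigma> j (a + 1) (b + 1))"
    unfolding graph_mon_add mon_add mon_graph_mon_11 by (simp add: gen.m_assoc gen.f_idem)
  then show ?thesis by simp
qed

text \<open>By \<open>xyxy = xy\<close> a common factor \<open>xy\<close> can be removed as long as both exponents stay positive. The
  normal form keeps one copy of \<open>xy\<close> and has at most one larger exponent.\<close>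

lemma mon_graph_mon_normalize:
  "mon (graph_mon \<sigma> j (Suc a) (Suc b)) =
    mon (graph_mon \<sigma> j (Suc (nat (int a - int b))) (Suc (nat (int b - int a))))"
proof (induction a arbitrary: b)
  case (Suc a)
  show ?case
  proof (cases b)
    case (Suc b')
    then show ?thesis using Suc.IH[of b'] by (simp add: mon_graph_mon_reduce)
  qed (simp add: nat_add_distrib)
qed simp

text \<open>The exponents are shifted by one, which amounts to the factor \<open>\<Prod>\<^sub>j x\<^bsub>\<sigma> j, j\<^esub> y\<^bsub>j, \<sigma> j\<^esub> = e\<^sub>\<sigma>\<close> and
  places the Laurent monomial on the component of \<open>\<sigma>\<close>.\<close>

definition basis :: "('n \<Rightarrow> 'n) \<times> ('n \<Rightarrow> int) \<Rightarrow> (bool \<times> 'n gl_poly set) multiset set" where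
  "basis = (\<lambda>(\<sigma>, a). mon (\<Sum>j\<in>UNIV. graph_mon \<sigma> j (Suc (nat (a j))) (Suc (nat (- a j)))))"

lemma compatible_eq_sum:
  assumes "compatible \<sigma> m"
  shows "m = (\<Sum>j\<in>UNIV. graph_mon \<sigma> j (lookup m (X_entry (\<sigma> j) j)) (lookup m (Y_entry j (\<sigma> j))))"
proof (rule poly_mapping_eqI)
  fix v
  have "lookup m v = (\<Sum>j\<in>UNIV. (lookup m (X_entry (\<sigma> j) j) when X_entry (\<sigma> j) j = v) +
      (lookup m (Y_entry j (\<sigma> j)) when Y_entry j (\<sigma> j) = v))"
  proof (cases v)
    case (X_entry i j)
    have "lookup m v = 0" if "i \<noteq> \<sigma> j"
      using assms that X_entry by (metis compatible_def in_keys_iff on_graph.simps(1))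
    moreover have "(\<Sum>k\<in>UNIV. (lookup m (X_entry (\<sigma> k) k) when X_entry (\<sigma> k) k = v) +
        (lookup m (Y_entry k (\<sigma> k)) when Y_entry k (\<sigma> k) = v)) =
        (\<Sum>k\<in>UNIV. if k = j then (if i = \<sigma> j then lookup m v else 0) else 0)"
      by (intro sum.cong) (auto simp: X_entry when_def)
    ultimately show ?thesis by auto
  next
    case (Y_entry j i)
    have "lookup m v = 0" if "i \<noteq> \<sigma> j"
      using assms that Y_entry by (metis compatible_def in_keys_iff on_graph.simps(2))
    moreover have "(\<Sum>k\<in>UNIV. (lookup m (X_entry (\<sigma> k) k) when X_entry (\<sigma> k) k = v) +
        (lookup m (Y_entry k (\<sigma> k)) when Y_entry k (\<sigma> k) = v)) =
        (\<Sum>k\<in>UNIV. if k = j then (if i = \<sigma> j then lookup m v else 0) else 0)"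
      by (intro sum.cong) (auto simp: Y_entry when_def)
    ultimately show ?thesis by auto
  qed
  then show "lookup m v = lookup (\<Sum>j\<in>UNIV. graph_mon \<sigma> j (lookup m (X_entry (\<sigma> j) j))
      (lookup m (Y_entry j (\<sigma> j)))) v"
    by (simp add: lookup_sum graph_mon_def lookup_add lookup_single)
qed

lemma idempotent_mon_compatible:
  assumes "compatible \<sigma> m"
  shows "gen.idempotent \<sigma> \<otimes>\<^bsub>B\<^esub> mon m = basis (\<sigma>, weight \<sigma> m)"
proof -
  let ?a = "\<lambda>j. lookup m (X_entry (\<sigma> j) j)" and ?b = "\<lambda>j. lookup m (Y_entry j (\<sigma> j))"
  have "gen.idempotent \<sigma> = mon (\<Sum>j\<in>UNIV. graph_mon \<sigma> j 1 1)"
    by (simp only: gen.idempotent_def mon_sum finite mon_graph_mon_11)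
  then have "gen.idempotent \<sigma> \<otimes>\<^bsub>B\<^esub> mon m =
      mon ((\<Sum>j\<in>UNIV. graph_mon \<sigma> j 1 1) + (\<Sum>j\<in>UNIV. graph_mon \<sigma> j (?a j) (?b j)))"
    using compatible_eq_sum[OF assms] by (metis mon_add)
  also have "\<dots> = mon (\<Sum>j\<in>UNIV. graph_mon \<sigma> j (Suc (?a j)) (Suc (?b j)))"
    by (simp add: sum.distrib[symmetric] graph_mon_add[symmetric])
  also have "\<dots> = (\<Otimes>\<^bsub>B\<^esub>j\<in>UNIV. mon (graph_mon \<sigma> j (Suc (?a j)) (Suc (?b j))))"
    by (simp add: mon_sum)
  also have "\<dots> = (\<Otimes>\<^bsub>B\<^esub>j\<in>UNIV. mon (graph_mon \<sigma> j (Suc (nat (weight \<sigma> m j))) (Suc (nat (- weight \<sigma> m j)))))"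
    by (subst mon_graph_mon_normalize) (simp add: weight_def)
  also have "\<dots> = basis (\<sigma>, weight \<sigma> m)"
    by (simp add: basis_def mon_sum)
  finally show ?thesis .
qed

lemma idempotent_mon_incompatible:
  assumes "\<not> compatible \<sigma> m"
  shows "gen.idempotent \<sigma> \<otimes>\<^bsub>B\<^esub> mon m = \<zero>\<^bsub>B\<^esub>"
proof -
  obtain v where v: "v \<in> keys m" "\<not> on_graph \<sigma> v" using assms by (auto simp: compatible_def)
  then have "lookup m v \<noteq> 0" by (simp add: in_keys_iff)
  then have "m = Poly_Mapping.single v 1 + (m - Poly_Mapping.single v 1)"
    by (intro poly_mapping_eqI) (auto simp: lookup_add lookup_minus lookup_single when_def)
  then have m: "mon m = mon (Poly_Mapping.single v 1) \<otimes>\<^bsub>B\<^esub> mon (m - Poly_Mapping.single v 1)"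
    by (metis mon_add)
  have "gen.idempotent \<sigma> \<otimes>\<^bsub>B\<^esub> mon (Poly_Mapping.single v 1) = \<zero>\<^bsub>B\<^esub>"
  proof (cases v)
    case (X_entry i j)
    show ?thesis using v(2) unfolding X_entry mon_var by (intro gen.idempotent_x) simp
  next
    case (Y_entry j i)
    show ?thesis using v(2) unfolding Y_entry mon_var by (intro gen.idempotent_y) simp
  qed
  then show ?thesis by (simp add: m gen.m_assoc[symmetric])
qed

text \<open>Multiplication by \<open>1 = \<Sum>\<^sub>\<sigma> e\<^sub>\<sigma>\<close> splits each monomial into its parts on the components, and each
  part is zero or a basis element.\<close>

lemma poly_elem_expansion: "poly_elem p = (\<Oplus>\<^bsub>B\<^esub>\<kappa>\<in>poly_support p. basis \<kappa>)"
proof -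
  interpret sys: idempotent_system B "restrict gen.idempotent perms"
    by (rule gen.idempotent_systemI[OF gen.idempotent_system])
  let ?I = "{(\<sigma>, m). (\<sigma>, m) \<in> perms \<times> keys p \<and> compatible \<sigma> m}"
  let ?h = "\<lambda>(\<sigma>, m). (\<sigma>, weight \<sigma> m)"
  have [simp]: "basis \<kappa> \<in> carrier B" for \<kappa> by (simp add: basis_def split_beta)
  have "poly_elem p = (\<Oplus>\<^bsub>B\<^esub>\<sigma>\<in>perms. restrict gen.idempotent perms \<sigma> \<otimes>\<^bsub>B\<^esub> poly_elem p)"
    by (rule sys.e_split) simp
  also have "\<dots> = (\<Oplus>\<^bsub>B\<^esub>\<sigma>\<in>perms. \<Oplus>\<^bsub>B\<^esub>m\<in>keys p. gen.idempotent \<sigma> \<otimes>\<^bsub>B\<^esub> mon m)"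
  proof (rule gen.finsum_cong')
    fix \<sigma> :: "'n \<Rightarrow> 'n" assume "\<sigma> \<in> perms"
    then show "restrict gen.idempotent perms \<sigma> \<otimes>\<^bsub>B\<^esub> poly_elem p =
        (\<Oplus>\<^bsub>B\<^esub>m\<in>keys p. gen.idempotent \<sigma> \<otimes>\<^bsub>B\<^esub> mon m)"
      unfolding poly_elem_eq_sum_mon[of p] by (simp add: gen.finsum_rdistr)
  qed (auto intro!: gen.finsum_closed)
  also have "\<dots> = (\<Oplus>\<^bsub>B\<^esub>i\<in>perms \<times> keys p. gen.idempotent (fst i) \<otimes>\<^bsub>B\<^esub> mon (snd i))"
    by (subst gen.finsum_Times) auto
  also have "\<dots> = (\<Oplus>\<^bsub>B\<^esub>i\<in>?I. basis (?h i))"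
  proof (rule gen.add.finprod_mono_neutral_cong_right)
    show "gen.idempotent (fst i) \<otimes>\<^bsub>B\<^esub> mon (snd i) = \<zero>\<^bsub>B\<^esub>" if "i \<in> perms \<times> keys p - ?I" for i
      using that by (intro idempotent_mon_incompatible) auto
    show "gen.idempotent (fst i) \<otimes>\<^bsub>B\<^esub> mon (snd i) = basis (?h i)" if "i \<in> ?I" for i
      using that idempotent_mon_compatible[of "fst i" "snd i"] by (simp add: split_beta)
  qed auto
  also have "\<dots> = (\<Oplus>\<^bsub>B\<^esub>\<kappa>\<in>?h ` ?I. basis \<kappa>)"
    by (rule gen.finsum_idempotent_image)
       (auto simp: gen.idem intro: finite_subset[of _ "perms \<times> keys p"])
  also have "?h ` ?I = poly_support p"
    by (force simp: poly_support_def image_iff)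
  finally show ?thesis .
qed

lemma dual_basis_B: "dual_basis bool_semifield (alg_module B) UNIV basis coefficient"
proof (intro dual_basis.intro dual_basis_axioms.intro)
  show "semimodule bool_semifield (alg_module B)"
    by (rule semimodule_alg_module[OF csemiring_bool gl_algebra_is_algebra])
  have M: "carrier (alg_module B) = carrier B" "\<zero>\<^bsub>alg_module B\<^esub> = \<zero>\<^bsub>B\<^esub>"
    "add (alg_module B) = add B" "r \<odot>\<^bsub>alg_module B\<^esub> z = structure_map B r \<otimes>\<^bsub>B\<^esub> z" for r z
    by (auto simp: alg_module_def)
  have s: "structure_map B \<in> semiring_hom bool_semifield B"
    using gl_algebra_is_algebra by (simp add: is_algebra_def)
  have scalar: "r \<odot>\<^bsub>alg_module B\<^esub> z = (if r then z else \<zero>\<^bsub>B\<^esub>)" if "z \<in> carrier B" for r z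
    using that semiring_hom_simps(4,5)[OF s] by (cases r) (simp_all add: M bool_semifield_simps)
  show basis: "basis \<kappa> \<in> carrier (alg_module B)" for \<kappa> by (simp add: M basis_def split_beta)
  show "coefficient \<kappa> \<in> semimodule_hom bool_semifield (alg_module B) (regular_module bool_semifield)" for \<kappa>
  proof -
    have zero: "\<not> coefficient \<kappa> \<zero>\<^bsub>B\<^esub>"
      unfolding poly_elem_zero[symmetric] coefficient_poly_elem by (simp add: poly_support_zero)
    have add: "coefficient \<kappa> (y \<oplus>\<^bsub>B\<^esub> z) \<longleftrightarrow> coefficient \<kappa> y \<or> coefficient \<kappa> z"
      if yz: "y \<in> carrier B" "z \<in> carrier B" for y z
    proof -
      obtain p q where "y = poly_elem p" "z = poly_elem q" using yz by (metis poly_elem_surj)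
      then show ?thesis
        by (simp add: poly_elem_add[symmetric] coefficient_poly_elem poly_support_add)
    qed
    show ?thesis
      unfolding semimodule_hom_def
      by (auto simp: zero add scalar M(1,2,3) regular_module_def) (auto simp: bool_semifield_simps)
  qed
  fix z assume "z \<in> carrier (alg_module B)"
  then obtain p where p: "z = poly_elem p" by (metis M(1) poly_elem_surj)
  have supp: "{\<kappa> \<in> UNIV. coefficient \<kappa> z \<noteq> \<zero>\<^bsub>bool_semifield\<^esub>} = poly_support p"
    by (simp add: p coefficient_poly_elem bool_semifield_simps)
  show "finite {\<kappa> \<in> UNIV. coefficient \<kappa> z \<noteq> \<zero>\<^bsub>bool_semifield\<^esub>}"
    unfolding supp by (rule finite_poly_support)
  have fin: "finsum (alg_module B) g S = finsum B g S" for g :: "_ \<Rightarrow> _" and S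
    by (simp add: finsum_def finprod_def alg_module_def)
  show "z = (\<Oplus>\<^bsub>alg_module B\<^esub>\<kappa>\<in>{\<kappa> \<in> UNIV. coefficient \<kappa> z \<noteq> \<zero>\<^bsub>bool_semifield\<^esub>}.
      coefficient \<kappa> z \<odot>\<^bsub>alg_module B\<^esub> basis \<kappa>)"
    unfolding supp fin
  proof -
    have "z = (\<Oplus>\<^bsub>B\<^esub>\<kappa>\<in>poly_support p. basis \<kappa>)" unfolding p by (rule poly_elem_expansion)
    also have "\<dots> = (\<Oplus>\<^bsub>B\<^esub>\<kappa>\<in>poly_support p. coefficient \<kappa> z \<odot>\<^bsub>alg_module B\<^esub> basis \<kappa>)"
    proof (rule gen.finsum_cong')
      show "(\<lambda>\<kappa>. coefficient \<kappa> z \<odot>\<^bsub>alg_module B\<^esub> basis \<kappa>) \<in> poly_support p \<rightarrow> carrier B"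
        using basis by (simp add: scalar M(1))
      show "basis \<kappa> = coefficient \<kappa> z \<odot>\<^bsub>alg_module B\<^esub> basis \<kappa>" if "\<kappa> \<in> poly_support p" for \<kappa>
        using basis that by (simp add: scalar M(1) p coefficient_poly_elem)
    qed simp
    finally show "z = (\<Oplus>\<^bsub>B\<^esub>\<kappa>\<in>poly_support p. coefficient \<kappa> z \<odot>\<^bsub>alg_module B\<^esub> basis \<kappa>)" .
  qed
qed

end

theorem GL_flat_bool: "GL_flat TYPE('v) TYPE('n::finite) bool_semifield"
  unfolding GL_flat_def
  by (rule dual_basis.dual_basis_imp_flat[OF gl_bool.dual_basis_B])

theorem theorem1p4:
  assumes "card (UNIV :: 'n::finite set) \<ge> 2"
  shows
    "(\<forall>R :: 'r ring.
        csemiring R \<and> carrier R \<noteq> {\<zero>\<^bsub>R\<^esub>} \<and> additively_cancellative R \<and> negative_free R \<and>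
        (\<exists>\<iota> :: 'r \<Rightarrow> 'u. inj_on \<iota> (carrier R)) \<longrightarrow>
        \<not> GL_flat TYPE('u) TYPE('n) R) \<and>
     (GL_flat TYPE('v) TYPE('n) bool_semifield \<and>
      group_functor_iso bool_semifield
        (torus_normalizer :: (bool, 'c) alg \<Rightarrow> (('n \<Rightarrow> 'c) \<times> (('n \<Rightarrow> 'n) \<Rightarrow> 'c)) monoid)
        torus_normalizer_map
        GL GL_map
        canonical_map)"
proof (intro conjI allI impI)
  show "\<not> GL_flat TYPE('u) TYPE('n) R"
    if R: "csemiring R \<and> carrier R \<noteq> {\<zero>\<^bsub>R\<^esub>} \<and> additively_cancellative R \<and> negative_free R \<and>
      (\<exists>\<iota> :: 'r \<Rightarrow> 'u. inj_on \<iota> (carrier R))" for R :: "'r ring"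
    using R GL_not_flat[OF assms] by blast
  show "GL_flat TYPE('v) TYPE('n) bool_semifield" by (rule GL_flat_bool)
  show "group_functor_iso bool_semifield
      (torus_normalizer :: (bool, 'c) alg \<Rightarrow> (('n \<Rightarrow> 'c) \<times> (('n \<Rightarrow> 'n) \<Rightarrow> 'c)) monoid)
      torus_normalizer_map GL GL_map canonical_map"
    by (rule canonical_map_group_functor_iso[OF bool_algebra_idempotent])
qed

end
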